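(* Let $\beta^*\in\mathbb{R}^p$ in the conditional $\tau$-quantile model be $s$-sparse, assume Conditions (B1)–(B3) hold and $\kappa_l=\min_{|u|\le 1}K(u)>0$. Let $\hat\beta=\hat\beta_h$ be a solution of the $\ell_1$-penalized smoothed quantile regression problem $$\min_{\beta\in\mathbb{R}^p}\{\hat Q_h(\beta)+\lambda\|\beta\|_1\}$$ with $\lambda\asymp\sigma_x\sqrt{\tau(1-\tau)\log(p)/n}$. Suppose the bandwidth satisfies $$\max\Big(\frac{\sigma_x}{f_l}\sqrt{\frac{s\log p}{n}},\ \frac{\sigma_x^2f_u}{f_l^2}\frac{s\log p}{n}\Big)\lesssim h\le\min\big\{f_l/(2l_0),\,(s^{1/2}\lambda)^{1/2}\big\}.$$ Then, with probability at least $1-p^{-1}$, $$\|\hat\beta-\beta^*\|_2\le C_1f_l^{-1}s^{1/2}\lambda\quad\text{and}\quad\|\hat\beta-\beta^*\|_1\le C_2f_l^{-1}s\lambda,$$ where the constants $C_1,C_2>0$ depend only on $(l_0,\upsilon_0,\gamma_p,\kappa_l,\kappa_2)$.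
   Context: Model. Fix $\tau\in(0,1)$. $x=(x_1,\dots,x_p)^T$ is a random vector with $x_1\equiv1$, $y=x^T\beta^*+\varepsilon$ with $P(\varepsilon\le0\mid x)=\tau$, $\beta^*\in\mathbb{R}^p$; $(y_i,x_i)_{i=1}^n$ are i.i.d. copies of $(y,x)$. "$s$-sparse" means the support $\mathcal S=\{j:\beta_j^*\ne0\}$ has cardinality $s$. $\Sigma=E(xx^T)$ is positive definite, $\gamma_p\in(0,1]$ is its smallest eigenvalue, $\sigma_x^2=\max_{1\le j\le p}E(x_j^2)$. Covariates are normalized so that $E(x_j)=0$ for $2\le j\le p$. Smoothed loss. $\rho_\tau(u)=u\{\tau-1(u<0)\}$; $K$ is a kernel, $h>0$ a bandwidth, $K_h(u)=h^{-1}K(u/h)$, $\ell_h(u)=\int\rho_\tau(v)K_h(v-u)\,dv$, and $\hat Q_h(\beta)=\frac1n\sum_{i=1}^n\ell_h(y_i-x_i^T\beta)$. (B1) The conditional density $f_{\varepsilon|x}$ of $\varepsilon$ given $x$ satisfies $f_l\le f_{\varepsilon|x}(0)\le f_u$ almost surely for some $f_u\ge f_l>0$, and $|f_{\varepsilon|x}(u)-f_{\varepsilon|x}(v)|\le l_0|u-v|$ for all $u,v\in\mathbb{R}$ almost surely, for some $l_0>0$. (B2) $K:\mathbb{R}\to[0,\infty)$ is symmetric about zero, $\int K=1$, $\int u^2K(u)\,du<\infty$; $\kappa_\ell=\int|u|^\ell K(u)\,du$. (B3) $\Sigma$ is positive definite and $z=\Sigma^{-1/2}x$ is sub-exponential: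 there is $\upsilon_0\ge1$ with $P(|z^Tu|\ge\upsilon_0\|u\|_2t)\le e^{-t}$ for all $u\in\mathbb{R}^p$, $t\ge0$. Convention on constants. $a\lesssim b$ means $a\le Cb$ with a constant $C$ not depending on $(s,p,n)$; $a\asymp b$ means $a\lesssim b$ and $b\lesssim a$. In hypotheses, $\lesssim$ and $\asymp$ are understood with suitably chosen such constants (in particular $\lambda$ is a suitably chosen constant multiple of the indicated rate).
   Formalization: Condition (B3) as printed cannot hold (it fails at u = 0 and, since x_1 = 1, at u = Σ^{1/2}e_1 for small t > 0); it is replaced by the weaker bound P(|z^T u| ≥ υ_0‖u‖_2 t) ≤ 2e^{-t} for all u ≠ 0, t ≥ 0. *)

theory Defs
  imports "HOL-Probability.Probability" "Jordan_Normal_Form.Char_Poly"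
begin

unbundle no vec_syntax

text \<open>
  The constants of the theorem are uniform in the dimension \<open>p\<close>, so \<open>p\<close> is a natural number and
  vectors are elements of \<^term>\<open>carrier_vec p\<close>, indexed from 0; the intercept \<open>x\<^sub>1\<close> is coordinate 0.
  An observation is a pair (covariate vector, response). Its law \<open>D\<close> is a probability measure on
  \<open>\<real>\<^sup>p \<times> \<real>\<close>, and \<open>n\<close> i.i.d. copies are distributed according to the product measure
  \<open>PiM {..<n} (\<lambda>_. D)\<close>.
\<close>

type_synonym obs = "real Matrix.vec \<times> real"

text \<open>The Borel \<open>\<sigma>\<close>-algebra of \<open>\<real>\<^sup>p\<close> (only its measurable sets matter, not the measure).\<close>

definition vec_borel :: "nat \<Rightarrow> real Matrix.vec measure" where
  "vec_borel p = vimage_algebra (carrier_vec p) (\<lambda>v. \<lambda>j\<in>{..<p}. v $ j) (PiM {..<p} (\<lambda>_. borel))"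

definition l1_norm :: "real Matrix.vec \<Rightarrow> real" where
  "l1_norm v = (\<Sum>j<dim_vec v. \<bar>v $ j\<bar>)"

definition l2_norm :: "real Matrix.vec \<Rightarrow> real" where
  "l2_norm v = sqrt (\<Sum>j<dim_vec v. (v $ j)\<^sup>2)"

definition support :: "real Matrix.vec \<Rightarrow> nat set" where
  "support v = {j. j < dim_vec v \<and> v $ j \<noteq> 0}"

definition pos_def_mat :: "nat \<Rightarrow> real mat \<Rightarrow> bool" where
  "pos_def_mat p A \<longleftrightarrow> A \<in> carrier_mat p p \<and> transpose_mat A = A \<and>
     (\<forall>v\<in>carrier_vec p. v \<noteq> 0\<^sub>v p \<longrightarrow> v \<bullet> (A *\<^sub>v v) > 0)"

text \<open>\<open>W = A\<^sup>-\<^sup>1\<^sup>/\<^sup>2\<close>; such a \<open>W\<close> exists and is unique if \<open>A\<close> is positive definite.\<close>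

definition is_inv_sqrt_mat :: "nat \<Rightarrow> real mat \<Rightarrow> real mat \<Rightarrow> bool" where
  "is_inv_sqrt_mat p A W \<longleftrightarrow> pos_def_mat p W \<and> W * W * A = 1\<^sub>m p"

definition is_smallest_eigenvalue :: "real mat \<Rightarrow> real \<Rightarrow> bool" where
  "is_smallest_eigenvalue A g \<longleftrightarrow> eigenvalue A g \<and> (\<forall>k. eigenvalue A k \<longrightarrow> g \<le> k)"

definition Sigma_mat :: "nat \<Rightarrow> obs measure \<Rightarrow> real mat" where
  "Sigma_mat p D = mat p p (\<lambda>(j, k). \<integral>w. fst w $ j * fst w $ k \<partial>D)"

definition sigma_x :: "nat \<Rightarrow> obs measure \<Rightarrow> real" where
  "sigma_x p D = sqrt (Max ((\<lambda>j. \<integral>w. (fst w $ j)\<^sup>2 \<partial>D) ` {..<p}))"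

definition err :: "real Matrix.vec \<Rightarrow> obs \<Rightarrow> real" where
  "err \<beta> w = snd w - fst w \<bullet> \<beta>"

text \<open>A version of \<open>P(\<epsilon> \<in> B | x)\<close>.\<close>

definition cond_prob_err :: "nat \<Rightarrow> obs measure \<Rightarrow> real Matrix.vec \<Rightarrow> real set \<Rightarrow> obs \<Rightarrow> real" where
  "cond_prob_err p D \<beta> B =
     real_cond_exp D (vimage_algebra (space D) fst (vec_borel p)) (indicator {w \<in> space D. err \<beta> w \<in> B})"

definition quantile_model :: "nat \<Rightarrow> real \<Rightarrow> obs measure \<Rightarrow> real Matrix.vec \<Rightarrow> bool" where
  "quantile_model p \<tau> D \<beta> \<longleftrightarrow>
     prob_space D \<and> sets D = sets (vec_borel p \<Otimes>\<^sub>M borel) \<and> \<beta> \<in> carrier_vec p \<and>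
     (AE w in D. fst w $ 0 = 1) \<and>
     (\<forall>j<p. \<forall>k<p. integrable D (\<lambda>w. fst w $ j * fst w $ k)) \<and>
     (\<forall>j\<in>{1..<p}. (\<integral>w. fst w $ j \<partial>D) = 0) \<and>
     (AE w in D. cond_prob_err p D \<beta> {..0} w = \<tau>)"

definition is_cond_density ::
    "nat \<Rightarrow> obs measure \<Rightarrow> real Matrix.vec \<Rightarrow> (real Matrix.vec \<Rightarrow> real \<Rightarrow> real) \<Rightarrow> bool" where
  "is_cond_density p D \<beta> f \<longleftrightarrow>
     (\<lambda>(v, u). f v u) \<in> borel_measurable (vec_borel p \<Otimes>\<^sub>M borel) \<and>
     (\<forall>v\<in>carrier_vec p. \<forall>u. 0 \<le> f v u) \<and>
     (\<forall>B\<in>sets borel. AE w in D. cond_prob_err p D \<beta> B w = (LINT u:B|lborel. f (fst w) u))"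

definition cond_B1 ::
    "nat \<Rightarrow> obs measure \<Rightarrow> real Matrix.vec \<Rightarrow> real \<Rightarrow> real \<Rightarrow> real \<Rightarrow> bool" where
  "cond_B1 p D \<beta> f\<^sub>l f\<^sub>u l\<^sub>0 \<longleftrightarrow> 0 < f\<^sub>l \<and> f\<^sub>l \<le> f\<^sub>u \<and> 0 < l\<^sub>0 \<and>
     (\<exists>f. is_cond_density p D \<beta> f \<and>
        (AE w in D. f\<^sub>l \<le> f (fst w) 0 \<and> f (fst w) 0 \<le> f\<^sub>u) \<and>
        (AE w in D. \<forall>u v. \<bar>f (fst w) u - f (fst w) v\<bar> \<le> l\<^sub>0 * \<bar>u - v\<bar>))"

definition cond_B2 :: "(real \<Rightarrow> real) \<Rightarrow> bool" where
  "cond_B2 K \<longleftrightarrow> K \<in> borel_measurable borel \<and> (\<forall>u. 0 \<le> K u) \<and> (\<forall>u. K (- u) = K u) \<and>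
     integrable lborel K \<and> (\<integral>u. K u \<partial>lborel) = 1 \<and> integrable lborel (\<lambda>u. u\<^sup>2 * K u)"

definition kernel_moment :: "(real \<Rightarrow> real) \<Rightarrow> nat \<Rightarrow> real" where
  "kernel_moment K l = (\<integral>u. \<bar>u\<bar> ^ l * K u \<partial>lborel)"

definition is_kernel_min :: "(real \<Rightarrow> real) \<Rightarrow> real \<Rightarrow> bool" where
  "is_kernel_min K m \<longleftrightarrow> (\<exists>u. \<bar>u\<bar> \<le> 1 \<and> K u = m) \<and> (\<forall>u. \<bar>u\<bar> \<le> 1 \<longrightarrow> m \<le> K u)"

text \<open>
  The tail bound is \<open>2 * exp (- t)\<close>, for \<open>u \<noteq> 0\<close>. The bound \<open>exp (- t)\<close> for all \<open>u\<close> and all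
  \<open>t \<ge> 0\<close> is contradictory: it fails at \<open>u = 0\<close> for \<open>t > 0\<close>, and also for
  \<open>u = \<Sigma>\<^sup>1\<^sup>/\<^sup>2 e\<^sub>1\<close>, where \<open>z\<^sup>T u = x\<^sub>1 = 1\<close> and \<open>\<parallel>u\<parallel>\<^sub>2 = 1\<close>, so that the probability is 1 for
  \<open>0 < t \<le> 1 / \<upsilon>\<^sub>0\<close>. The condition below is implied by that bound.
\<close>

definition cond_B3 :: "nat \<Rightarrow> obs measure \<Rightarrow> real \<Rightarrow> bool" where
  "cond_B3 p D \<upsilon>\<^sub>0 \<longleftrightarrow> 1 \<le> \<upsilon>\<^sub>0 \<and> pos_def_mat p (Sigma_mat p D) \<and>
     (\<exists>W. is_inv_sqrt_mat p (Sigma_mat p D) W \<and>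
        (\<forall>u\<in>carrier_vec p. \<forall>t\<ge>0. u \<noteq> 0\<^sub>v p \<longrightarrow>
           measure D {w \<in> space D. \<bar>(W *\<^sub>v fst w) \<bullet> u\<bar> \<ge> \<upsilon>\<^sub>0 * l2_norm u * t} \<le> 2 * exp (- t)))"

definition check_loss :: "real \<Rightarrow> real \<Rightarrow> real" where
  "check_loss \<tau> u = u * (\<tau> - indicator {..<0} u)"

definition smoothed_loss :: "real \<Rightarrow> (real \<Rightarrow> real) \<Rightarrow> real \<Rightarrow> real \<Rightarrow> real" where
  "smoothed_loss \<tau> K h u = (\<integral>v. check_loss \<tau> v * (K ((v - u) / h) / h) \<partial>lborel)"

definition emp_loss ::
    "real \<Rightarrow> (real \<Rightarrow> real) \<Rightarrow> real \<Rightarrow> nat \<Rightarrow> (nat \<Rightarrow> obs) \<Rightarrow> real Matrix.vec \<Rightarrow> real" where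
  "emp_loss \<tau> K h n \<omega> \<beta> = (\<Sum>i<n. smoothed_loss \<tau> K h (err \<beta> (\<omega> i))) / real n"

definition l1_sqr_solution ::
    "nat \<Rightarrow> real \<Rightarrow> (real \<Rightarrow> real) \<Rightarrow> real \<Rightarrow> real \<Rightarrow> nat \<Rightarrow> (nat \<Rightarrow> obs) \<Rightarrow> real Matrix.vec \<Rightarrow> bool" where
  "l1_sqr_solution p \<tau> K h lam n \<omega> =
     is_arg_min (\<lambda>\<beta>. emp_loss \<tau> K h n \<omega> \<beta> + lam * l1_norm \<beta>) (\<lambda>\<beta>. \<beta> \<in> carrier_vec p)"

text \<open>
  For a measurable property this is \<open>P(\<phi>) \<ge> q\<close>. Minimizers need not depend measurably on the data,
  hence the formulation by an event contained in \<open>\<phi>\<close>.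
\<close>

definition with_prob_at_least :: "'a measure \<Rightarrow> real \<Rightarrow> ('a \<Rightarrow> bool) \<Rightarrow> bool" where
  "with_prob_at_least M q \<phi> \<longleftrightarrow> (\<exists>A\<in>sets M. measure M A \<ge> q \<and> (\<forall>\<omega>\<in>A. \<phi> \<omega>))"

end

theory Submission
  imports Defs
begin

text \<open>
  Write \<open>\<delta>\<close> for the error of the estimator and \<open>q \<delta> = \<delta>\<^sup>T \<Sigma> \<delta>\<close>. By convexity it suffices to exclude
  \<open>q \<delta> = r\<^sup>2\<close> for \<open>r\<close> a large multiple of \<open>s\<^sup>1\<^sup>/\<^sup>2 \<lambda> / f\<^sub>l\<close>. On the event that the centred score is bounded by
  \<open>\<lambda> / 2\<close> in sup norm, \<open>\<delta>\<close> lies in an \<open>\<ell>\<^sub>1\<close>-cone, because the smoothing bias is of order \<open>h\<^sup>2 \<le> s\<^sup>1\<^sup>/\<^sup>2 \<lambda>\<close>.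
  There the excess loss dominates \<open>h\<^sup>-\<^sup>1\<close> times the empirical mean of a truncated, hence Lipschitz, version
  of \<open>(x\<^sup>T \<delta>)\<^sup>2\<close> over \<open>\<bar>\<epsilon>\<bar> \<le> h / 2\<close>, whose expectation is at least a multiple of \<open>f\<^sub>l r\<^sup>2\<close>.

  Both events follow from one exponential inequality for the supremum of an empirical process indexed by an
  \<open>\<ell>\<^sub>1\<close>-ball. Symmetrization and contraction are done one observation at a time under the exponential; the
  random signs are absorbed into \<open>cosh (a + b) + cosh (a - b) = 2 cosh a cosh b\<close>, and what remains is
  the product of \<open>E cosh\<close> of single coordinates. So no concentration inequality for suprema is needed.
\<close>

section \<open>Symmetrization and contraction\<close>

text \<open>All rates come from one choice of scale. Put \<open>\<rho> = sqrt (ln p / n)\<close>.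
  Both processes are rescaled so that each coordinate enters \<open>cosh\<close> at an argument of
  size \<open>\<upsilon> * \<rho>\<close>, measured against its own tail. There
  \<open>E cosh\<close> is \<open>1 + O(\<rho>\<^sup>2)\<close>, so its n-th power is only a fixed
  power of \<open>p\<close>, and a deviation of a multiple of \<open>ln p\<close> beats both this
  power and the union over coordinates. The expansion is valid only for
  \<open>\<upsilon> * \<rho> \<le> 1/2\<close>, which has to be extracted from the two-sided
  bandwidth condition. Undoing the scale, the score deviates by a multiple of
  \<open>\<sigma> * \<rho>\<close>, the rate of the penalty level. On directions with
  \<open>q d = r\<^sup>2\<close> and l1 norm at most \<open>L * r\<close>, the truncated squares
  deviate by a multiple of \<open>L * r * R * \<sigma> * \<rho>\<close> with \<open>R\<close>
  proportional to \<open>r\<close>. This must stay below a multiple of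
  \<open>h * f\<^sub>l * r\<^sup>2\<close>; the factor \<open>r\<^sup>2\<close> cancels, and since
  \<open>L\<close> is proportional to \<open>sqrt s\<close>, what remains is a lower bound on
  \<open>h\<close>. The same lower bound gives \<open>R \<le> h / 2\<close>, since \<open>r\<close>
  is a multiple of \<open>sqrt s * lam / f\<^sub>l\<close>.\<close>

lemma exp_weak_majorization:
  fixes a b c d :: real
  assumes "max a b \<le> max c d" "a + b \<le> c + d"
  shows "exp a + exp b \<le> exp c + exp d"
proof -
  have *: "exp a + exp b \<le> exp c + exp d"
    if "b \<le> a" "d \<le> c" "a \<le> c" "a + b \<le> c + d" for a b c d :: real
  proof (cases "b \<le> d")
    case True
    then show ?thesis using that by (intro add_mono) auto
  next
    case False
    have tan: "exp y * (x - y) \<le> exp x - exp y" for x y :: real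
    proof -
      have "exp y * (1 + (x - y)) \<le> exp y * exp (x - y)"
        by (intro mult_left_mono exp_ge_add_one_self) auto
      then show ?thesis by (simp add: exp_diff algebra_simps)
    qed
    \<comment> \<open>Here \<open>d < b\<close>, and the sum condition gives
      \<open>b - d \<le> c - a\<close>. The smaller entry drops by \<open>b - d\<close> at slope at
      most \<open>exp b\<close>; the larger one rises by at least as much at slope at least
      \<open>exp a\<close>, which is no smaller.\<close>
    have "exp b - exp d \<le> exp b * (b - d)"
      using tan[of b d] by (simp add: algebra_simps)
    also have "\<dots> \<le> exp a * (c - a)"
      using that False by (intro mult_mono) auto
    also have "\<dots> \<le> exp c - exp a" by (rule tan)
    finally show ?thesis by simp
  qed
  show ?thesis
    using *[of b a d c] *[of a b d c] *[of b a c d] *[of a b c d] assms by linarith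
qed

text \<open>This is the contraction principle for a single random sign. Let \<open>s\<close> and
  \<open>t\<close> maximize the two sides on the left. By \<open>lip\<close>, the increment
  \<open>g s - g t\<close> is dominated by \<open>b s - b t\<close> or by its negative, which bounds
  the sum of the maxima; by \<open>dom\<close>, each maximum is reached with one of the two signs of
  \<open>b\<close>. The two maxima cannot be compared one by one, so weak majorization is the right
  tool.\<close>

lemma exp_Max_contraction:
  fixes a b g :: "'i \<Rightarrow> real"
  assumes F: "finite F" "F \<noteq> {}"
    and lip: "\<And>i j. i \<in> F \<Longrightarrow> j \<in> F \<Longrightarrow> \<bar>g i - g j\<bar> \<le> \<bar>b i - b j\<bar>"
    and dom: "\<And>i. i \<in> F \<Longrightarrow> \<bar>g i\<bar> \<le> \<bar>b i\<bar>"
  shows "exp (Max ((\<lambda>i. a i + g i) ` F)) + exp (Max ((\<lambda>i. a i - g i) ` F))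
    \<le> exp (Max ((\<lambda>i. a i + b i) ` F)) + exp (Max ((\<lambda>i. a i - b i) ` F))"
proof (rule exp_weak_majorization)
  let ?P = "Max ((\<lambda>i. a i + b i) ` F)" and ?Q = "Max ((\<lambda>i. a i - b i) ` F)"
  have P: "a i + b i \<le> ?P" "a i - b i \<le> ?Q" if "i \<in> F" for i
    using F that by auto
  have "Max ((\<lambda>i. a i + g i) ` F) \<in> (\<lambda>i. a i + g i) ` F"
    using F by (intro Max_in) auto
  then obtain s where s: "s \<in> F" "Max ((\<lambda>i. a i + g i) ` F) = a s + g s" by auto
  have "Max ((\<lambda>i. a i - g i) ` F) \<in> (\<lambda>i. a i - g i) ` F"
    using F by (intro Max_in) auto
  then obtain t where t: "t \<in> F" "Max ((\<lambda>i. a i - g i) ` F) = a t - g t" by auto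
  note bounds = P[OF s(1)] P[OF t(1)] dom[OF s(1)] dom[OF t(1)] lip[OF s(1) t(1)]
  show "max (Max ((\<lambda>i. a i + g i) ` F)) (Max ((\<lambda>i. a i - g i) ` F)) \<le> max ?P ?Q"
    unfolding s(2) t(2) using bounds by linarith
  show "Max ((\<lambda>i. a i + g i) ` F) + Max ((\<lambda>i. a i - g i) ` F) \<le> ?P + ?Q"
    unfolding s(2) t(2) using bounds by linarith
qed

text \<open>Jensen's inequality from the tangent line at the mean. With a nonnegative integral on
  the right, a non-integrable exponential is the trivial case.\<close>

lemma (in prob_space) exp_expectation_le:
  assumes "integrable M f"
  shows "ennreal (exp (expectation f)) \<le> (\<integral>\<^sup>+w. ennreal (exp (f w)) \<partial>M)"
proof (cases "integrable M (\<lambda>w. exp (f w))")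
  case True
  let ?m = "expectation f"
  have "exp ?m = expectation (\<lambda>w. exp ?m * (1 + (f w - ?m)))"
    using assms by (simp add: prob_space)
  also have "\<dots> \<le> expectation (\<lambda>w. exp (f w))"
  proof (rule integral_mono)
    fix w
    have "exp ?m * (1 + (f w - ?m)) \<le> exp ?m * exp (f w - ?m)"
      by (intro mult_left_mono exp_ge_add_one_self) auto
    then show "exp ?m * (1 + (f w - ?m)) \<le> exp (f w)" by (simp add: exp_diff)
  qed (use assms True in auto)
  finally show ?thesis
    using True by (subst nn_integral_eq_integral) auto
next
  case False
  then have "(\<integral>\<^sup>+w. ennreal (exp (f w)) \<partial>M) = \<infinity>"
    using assms by (auto simp: integrable_iff_bounded less_top[symmetric])
  then show ?thesis by simp
qed

text \<open>No ghost sample is introduced. At the maximizing index, convexity of \<open>exp\<close>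
  splits the exponent into \<open>2 * expectation (g s)\<close> and \<open>- 2 * g s w\<close>,
  which is the origin of the factor 2. Jensen turns the first half into an average over an
  independent observation; since both halves are then integrated over the same law, they recombine
  into an average over the two signs, and contraction applies for each \<open>w\<close>.\<close>

lemma (in prob_space) symmetrization_step:
  fixes a :: "'i \<Rightarrow> real" and b g :: "'i \<Rightarrow> 'a \<Rightarrow> real"
  assumes F: "finite F" "F \<noteq> {}"
    and g: "\<And>i. i \<in> F \<Longrightarrow> integrable M (g i)"
    and b: "\<And>i. i \<in> F \<Longrightarrow> b i \<in> borel_measurable M"
    and lip: "\<And>i j w. i \<in> F \<Longrightarrow> j \<in> F \<Longrightarrow> \<bar>g i w - g j w\<bar> \<le> \<bar>b i w - b j w\<bar>"
    and dom: "\<And>i w. i \<in> F \<Longrightarrow> \<bar>g i w\<bar> \<le> \<bar>b i w\<bar>"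
  shows "(\<integral>\<^sup>+w. exp (Max ((\<lambda>i. a i + (expectation (g i) - g i w)) ` F)) \<partial>M)
    \<le> (\<integral>\<^sup>+w. ennreal (1/2) * (ennreal (exp (Max ((\<lambda>i. a i + 2 * b i w) ` F)))
          + ennreal (exp (Max ((\<lambda>i. a i - 2 * b i w) ` F)))) \<partial>M)"
proof -
  let ?P = "\<lambda>w. exp (Max ((\<lambda>i. a i + 2 * g i w) ` F))"
  let ?Q = "\<lambda>w. exp (Max ((\<lambda>i. a i - 2 * g i w) ` F))"
  have gm: "\<And>i. i \<in> F \<Longrightarrow> g i \<in> borel_measurable M" using g by auto
  have [measurable]: "?P \<in> borel_measurable M" "?Q \<in> borel_measurable M"
    "(\<lambda>w. exp (Max ((\<lambda>i. a i + 2 * b i w) ` F))) \<in> borel_measurable M"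
    "(\<lambda>w. exp (Max ((\<lambda>i. a i - 2 * b i w) ` F))) \<in> borel_measurable M"
    using F gm b by (auto intro!: borel_measurable_exp borel_measurable_Max measurable_compose[OF _ borel_measurable_exp])
  let ?I = "\<integral>\<^sup>+w. ennreal (?P w) \<partial>M"
  have pw: "ennreal (exp (Max ((\<lambda>i. a i + (expectation (g i) - g i w)) ` F)))
      \<le> ennreal (1/2) * ?I + ennreal (1/2) * ennreal (?Q w)" for w
  proof -
    have "Max ((\<lambda>i. a i + (expectation (g i) - g i w)) ` F) \<in> (\<lambda>i. a i + (expectation (g i) - g i w)) ` F"
      using F by (intro Max_in) auto
    then obtain s where s: "s \<in> F"
      "Max ((\<lambda>i. a i + (expectation (g i) - g i w)) ` F) = a s + (expectation (g s) - g s w)" by auto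
    have cvx: "exp ((x + y) / 2) \<le> 1/2 * exp x + 1/2 * exp y" for x y :: real
      using exp_weak_majorization[of "(x+y)/2" "(x+y)/2" x y] by (auto simp: max_def field_simps)
    have "exp (a s + (expectation (g s) - g s w))
        \<le> 1/2 * exp (a s + 2 * expectation (g s)) + 1/2 * exp (a s - 2 * g s w)"
      using cvx[of "a s + 2 * expectation (g s)" "a s - 2 * g s w"]
      by (simp add: algebra_simps add_divide_distrib diff_divide_distrib)
    then have "ennreal (exp (a s + (expectation (g s) - g s w)))
        \<le> ennreal (1/2 * exp (a s + 2 * expectation (g s)) + 1/2 * exp (a s - 2 * g s w))"
      by (rule ennreal_leI)
    also have "\<dots> = ennreal (1/2) * ennreal (exp (a s + 2 * expectation (g s)))
        + ennreal (1/2) * ennreal (exp (a s - 2 * g s w))"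
      by (simp add: ennreal_plus ennreal_mult'[symmetric] del: ennreal_half)
    also have "\<dots> \<le> ennreal (1/2) * ?I + ennreal (1/2) * ennreal (?Q w)"
    proof (intro add_mono mult_left_mono)
      have "ennreal (exp (a s + 2 * expectation (g s))) = ennreal (exp (expectation (\<lambda>w. a s + 2 * g s w)))"
        using g[OF s(1)] by (simp add: prob_space)
      also have "\<dots> \<le> (\<integral>\<^sup>+w. ennreal (exp (a s + 2 * g s w)) \<partial>M)"
        using g[OF s(1)] by (intro exp_expectation_le) auto
      also have "\<dots> \<le> ?I"
        using F s(1) by (intro nn_integral_mono ennreal_leI) auto
      finally show "ennreal (exp (a s + 2 * expectation (g s))) \<le> ?I" .
      show "ennreal (exp (a s - 2 * g s w)) \<le> ennreal (?Q w)"
        using F s(1) by (intro ennreal_leI) auto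
    qed auto
    finally show ?thesis using s(2) by simp
  qed
  have "(\<integral>\<^sup>+w. exp (Max ((\<lambda>i. a i + (expectation (g i) - g i w)) ` F)) \<partial>M)
      \<le> (\<integral>\<^sup>+w. ennreal (1/2) * ?I + ennreal (1/2) * ennreal (?Q w) \<partial>M)"
    by (intro nn_integral_mono pw)
  also have "\<dots> = ennreal (1/2) * ?I + ennreal (1/2) * (\<integral>\<^sup>+w. ennreal (?Q w) \<partial>M)"
    by (subst nn_integral_add) (auto simp: nn_integral_cmult emeasure_space_1 simp del: ennreal_half)
  also have "\<dots> = (\<integral>\<^sup>+w. ennreal (1/2) * (ennreal (?P w) + ennreal (?Q w)) \<partial>M)"
    by (subst nn_integral_cmult) (auto simp: nn_integral_add distrib_left simp del: ennreal_half)
  also have "\<dots> \<le> (\<integral>\<^sup>+w. ennreal (1/2) * (ennreal (exp (Max ((\<lambda>i. a i + 2 * b i w) ` F)))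
          + ennreal (exp (Max ((\<lambda>i. a i - 2 * b i w) ` F)))) \<partial>M)"
  proof (intro nn_integral_mono mult_left_mono)
    fix w
    have "?P w + ?Q w \<le> exp (Max ((\<lambda>i. a i + 2 * b i w) ` F)) + exp (Max ((\<lambda>i. a i - 2 * b i w) ` F))"
    proof (rule exp_Max_contraction[OF F])
      show "\<bar>2 * g i w - 2 * g j w\<bar> \<le> \<bar>2 * b i w - 2 * b j w\<bar>" if "i \<in> F" "j \<in> F" for i j
        using lip[OF that, of w] by linarith
      show "\<bar>2 * g i w\<bar> \<le> \<bar>2 * b i w\<bar>" if "i \<in> F" for i
        using dom[OF that, of w] by linarith
    qed
    then show "ennreal (?P w) + ennreal (?Q w) \<le> ennreal (exp (Max ((\<lambda>i. a i + 2 * b i w) ` F)))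
          + ennreal (exp (Max ((\<lambda>i. a i - 2 * b i w) ` F)))"
      by (simp add: ennreal_plus[symmetric] del: ennreal_plus)
  qed auto
  finally show ?thesis .
qed

text \<open>Directions are functions on \<open>nat\<close> because the product topology on them is
  second countable, which gives the countable dense index sets of
  \<open>uniform_lower_bound\<close>.\<close>

definition dot :: "nat \<Rightarrow> (nat \<Rightarrow> real) \<Rightarrow> (nat \<Rightarrow> real) \<Rightarrow> real" where
  "dot p u v = (\<Sum>j<p. u j * v j)"

lemma dot_add_left: "dot p (\<lambda>j. u j + u' j) v = dot p u v + dot p u' v"
  and dot_diff_left: "dot p (\<lambda>j. u j - u' j) v = dot p u v - dot p u' v"
  and dot_scale_left: "dot p (\<lambda>j. c * u j) v = c * dot p u v"
  and dot_diff_right: "dot p u (\<lambda>j. v j - v' j) = dot p u v - dot p u v'"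
  and dot_scale_right: "dot p u (\<lambda>j. c * v j) = c * dot p u v"
  by (auto simp: dot_def algebra_simps sum.distrib sum_subtractf sum_distrib_left)

lemma dot_measurable [measurable (raw)]:
  assumes "\<And>j. j < p \<Longrightarrow> (\<lambda>w. u w j) \<in> borel_measurable M"
  shows "(\<lambda>w. dot p (u w) v) \<in> borel_measurable M"
  unfolding dot_def using assms by measurable

text \<open>Duality of the l1 and sup norms, with the maximum over coordinates replaced by a sum.
  The resulting sum of one-coordinate hyperbolic cosines is the shape that the recursion in
  \<open>exp_Max_sum_le\<close> reproduces.\<close>

lemma exp_dot_le_sum_cosh:
  assumes p: "1 \<le> p" and B: "(\<Sum>j<p. \<bar>d j\<bar>) \<le> B"
  shows "exp (dot p v d) \<le> (\<Sum>j<p. 2 * cosh (B * v j))"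
proof -
  let ?m = "Max ((\<lambda>j. \<bar>v j\<bar>) ` {..<p})"
  have "?m \<in> (\<lambda>j. \<bar>v j\<bar>) ` {..<p}"
    using p by (intro Max_in) (auto simp: lessThan_empty_iff)
  then obtain k where k: "k < p" "?m = \<bar>v k\<bar>" by auto
  have B0: "0 \<le> B" using B by (meson abs_ge_zero order_trans sum_nonneg)
  have "dot p v d \<le> (\<Sum>j<p. ?m * \<bar>d j\<bar>)"
    unfolding dot_def
  proof (rule sum_mono)
    fix j assume "j \<in> {..<p}"
    then have "\<bar>v j\<bar> \<le> ?m" by auto
    then have "\<bar>v j\<bar> * \<bar>d j\<bar> \<le> ?m * \<bar>d j\<bar>" by (intro mult_right_mono) auto
    then show "v j * d j \<le> ?m * \<bar>d j\<bar>"
      using abs_ge_self[of "v j * d j"] by (simp add: abs_mult)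
  qed
  also have "\<dots> = \<bar>v k\<bar> * (\<Sum>j<p. \<bar>d j\<bar>)" by (simp only: sum_distrib_left k(2))
  also have "\<dots> \<le> \<bar>v k\<bar> * B" using B by (intro mult_left_mono) auto
  also have "\<dots> = \<bar>B * v k\<bar>" using B0 by (simp add: abs_mult)
  finally have "exp (dot p v d) \<le> exp \<bar>B * v k\<bar>" by simp
  also have "\<dots> \<le> 2 * cosh (B * v k)"
    by (cases "B * v k \<ge> 0") (auto simp: cosh_def)
  also have "\<dots> \<le> (\<Sum>j<p. 2 * cosh (B * v j))"
    using k by (intro member_le_sum) (auto intro: cosh_real_nonneg)
  finally show ?thesis .
qed

context prob_space
begin

text \<open>The induction works because \<open>v\<close> is arbitrary: the linear term collects the
  observations that have already been symmetrized. A step trades the centred term of observation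
  \<open>n\<close> for \<open>\<plusminus> 2 * x\<close> added to \<open>v\<close>; averaging the
  bound for the two shifted vectors factors out \<open>cosh (2 * B * x j)\<close>, whose integral
  contributes one more factor \<open>c\<close>.\<close>

lemma exp_Max_sum_le:
  fixes x :: "nat \<Rightarrow> 'a \<Rightarrow> real" and g :: "(nat \<Rightarrow> real) \<Rightarrow> 'a \<Rightarrow> real"
  assumes F: "finite F" "F \<noteq> {}" and p: "1 \<le> p"
    and B: "\<And>d. d \<in> F \<Longrightarrow> (\<Sum>j<p. \<bar>d j\<bar>) \<le> B"
    and x [measurable]: "\<And>j. j < p \<Longrightarrow> x j \<in> borel_measurable M"
    and g: "\<And>d. d \<in> F \<Longrightarrow> integrable M (g d)"
    and lip: "\<And>d d' w. d \<in> F \<Longrightarrow> d' \<in> F \<Longrightarrow> \<bar>g d w - g d' w\<bar> \<le> \<bar>dot p (\<lambda>j. x j w) d - dot p (\<lambda>j. x j w) d'\<bar>"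
    and dom: "\<And>d w. d \<in> F \<Longrightarrow> \<bar>g d w\<bar> \<le> \<bar>dot p (\<lambda>j. x j w) d\<bar>"
    and c: "\<And>j. j < p \<Longrightarrow> (\<integral>\<^sup>+w. ennreal (cosh (2 * B * x j w)) \<partial>M) \<le> ennreal c" "0 \<le> c"
  shows "(\<integral>\<^sup>+\<omega>. ennreal (exp (Max ((\<lambda>d. dot p v d + (\<Sum>i<n. expectation (g d) - g d (\<omega> i))) ` F)))
      \<partial>PiM {..<n} (\<lambda>_. M)) \<le> ennreal (c ^ n * (\<Sum>j<p. 2 * cosh (B * v j)))"
proof (induction n arbitrary: v)
  case 0
  have "Max ((\<lambda>d. dot p v d) ` F) \<in> (\<lambda>d. dot p v d) ` F"
    using F by (intro Max_in) auto
  then obtain d where d: "d \<in> F" "Max ((\<lambda>d. dot p v d) ` F) = dot p v d" by auto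
  show ?case
    using exp_dot_le_sum_cosh[OF p B[OF d(1)], of v] d(2)
    by (simp add: PiM_empty nn_integral_count_space_finite ennreal_leI)
next
  case (Suc n)
  interpret P: product_sigma_finite "\<lambda>_. M" by standard
  have gm': "(\<lambda>\<omega>. g d (\<omega> i)) \<in> borel_measurable (PiM I (\<lambda>_. M))" if "d \<in> F" "i \<in> I" for d i and I :: "nat set"
    using that g[OF that(1)] by (intro measurable_compose[OF measurable_component_singleton]) auto
  have x': "(\<lambda>\<omega>. x j (\<omega> i)) \<in> borel_measurable (PiM I (\<lambda>_. M))" if "j < p" "i \<in> I" for j i and I :: "nat set"
    using that x by (intro measurable_compose[OF measurable_component_singleton]) auto
  let ?S = "\<lambda>d \<omega>. \<Sum>i<n. expectation (g d) - g d (\<omega> i)"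
  let ?x = "\<lambda>y j. x j y"
  define H where "H = (\<lambda>v \<omega>. ennreal (exp (Max ((\<lambda>d. dot p v d + ?S d \<omega>) ` F))))"
  \<comment> \<open>The average over the sign of the last observation, now absorbed into the linear
    term.\<close>
  define G where "G = (\<lambda>\<omega>. ennreal (1/2) * (H (\<lambda>j. v j + 2 * x j (\<omega> n)) \<omega> + H (\<lambda>j. v j - 2 * x j (\<omega> n)) \<omega>))"
  have eq: "{..<Suc n} = insert n {..<n}" by auto
  have upd: "?S d ((fun_upd \<omega> n y)) = ?S d \<omega>" for d \<omega> y by (intro sum.cong) auto
  have Hupd: "H v ((fun_upd \<omega> n y)) = H v \<omega>" for v \<omega> y unfolding H_def upd ..
  have Sm: "(\<lambda>\<omega>. ?S d \<omega>) \<in> borel_measurable (PiM I (\<lambda>_. M))" if "d \<in> F" "{..<n} \<subseteq> I" for d I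
    using that
    by (intro borel_measurable_sum borel_measurable_diff borel_measurable_const
         gm') auto
  have expMaxm: "(\<lambda>\<omega>. ennreal (exp (Max ((\<lambda>d. f d \<omega>) ` F)))) \<in> borel_measurable N"
    if "\<And>d. d \<in> F \<Longrightarrow> f d \<in> borel_measurable N" for f :: "(nat \<Rightarrow> real) \<Rightarrow> (nat \<Rightarrow> 'a) \<Rightarrow> real" and N
  proof -
    have [measurable]: "(\<lambda>\<omega>. Max ((\<lambda>d. f d \<omega>) ` F)) \<in> borel_measurable N"
      using F(1) that by (rule borel_measurable_Max)
    show ?thesis by measurable
  qed
  have dotm: "(\<lambda>\<omega>. dot p (\<lambda>j. v j + s * x j (\<omega> n)) d) \<in> borel_measurable (PiM (insert n {..<n}) (\<lambda>_. M))" for s d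
  proof (rule dot_measurable)
    fix j assume "j < p"
    then have [measurable]: "(\<lambda>\<omega>. x j (\<omega> n)) \<in> borel_measurable (PiM (insert n {..<n}) (\<lambda>_. M))"
      by (intro x') auto
    show "(\<lambda>\<omega>. v j + s * x j (\<omega> n)) \<in> borel_measurable (PiM (insert n {..<n}) (\<lambda>_. M))" by measurable
  qed
  have Gm: "G \<in> borel_measurable (PiM (insert n {..<n}) (\<lambda>_. M))"
    unfolding G_def H_def
    using dotm[of 2] dotm[of "- 2"]
    by (intro borel_measurable_times_ennreal borel_measurable_add expMaxm Sm borel_measurable_const) auto
  have Hm: "(\<lambda>\<omega>. H v \<omega>) \<in> borel_measurable (PiM {..<n} (\<lambda>_. M))" for v
    unfolding H_def by (intro expMaxm borel_measurable_add Sm borel_measurable_const) auto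
  define J where "J = (\<lambda>\<omega>. ennreal (exp (Max ((\<lambda>d. dot p v d + (\<Sum>i<Suc n. expectation (g d) - g d (\<omega> i))) ` F))))"
  have Jm: "J \<in> borel_measurable (PiM (insert n {..<n}) (\<lambda>_. M))"
    unfolding J_def
    by (intro expMaxm borel_measurable_add borel_measurable_diff borel_measurable_const
          borel_measurable_sum gm') auto
  have Jupd: "J (fun_upd \<omega> n y)
      = ennreal (exp (Max ((\<lambda>d. (dot p v d + ?S d \<omega>) + (expectation (g d) - g d y)) ` F)))" for \<omega> y
    unfolding J_def sum.lessThan_Suc upd by (simp add: add.assoc)
  have "(\<integral>\<^sup>+\<omega>. J \<omega> \<partial>PiM {..<Suc n} (\<lambda>_. M))
     = (\<integral>\<^sup>+\<omega>. (\<integral>\<^sup>+y. ennreal (exp (Max ((\<lambda>d. (dot p v d + ?S d \<omega>) + (expectation (g d) - g d y)) ` F))) \<partial>M)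
        \<partial>PiM {..<n} (\<lambda>_. M))"
    unfolding eq Jupd[symmetric] by (rule P.product_nn_integral_insert) (use Jm in auto)
  also have "\<dots> \<le> (\<integral>\<^sup>+\<omega>. (\<integral>\<^sup>+y. G ((fun_upd \<omega> n y)) \<partial>M) \<partial>PiM {..<n} (\<lambda>_. M))"
  proof (rule nn_integral_mono)
    fix \<omega>
    have "(\<integral>\<^sup>+y. ennreal (exp (Max ((\<lambda>d. (dot p v d + ?S d \<omega>) + (expectation (g d) - g d y)) ` F))) \<partial>M)
      \<le> (\<integral>\<^sup>+w. ennreal (1/2) * (ennreal (exp (Max ((\<lambda>d. (dot p v d + ?S d \<omega>) + 2 * dot p (?x w) d) ` F)))
          + ennreal (exp (Max ((\<lambda>d. (dot p v d + ?S d \<omega>) - 2 * dot p (?x w) d) ` F)))) \<partial>M)"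
      using lip dom by (intro symmetrization_step F g) auto
    also have "\<dots> = (\<integral>\<^sup>+y. G ((fun_upd \<omega> n y)) \<partial>M)"
      unfolding G_def Hupd unfolding H_def
      by (simp add: dot_add_left dot_diff_left dot_scale_left algebra_simps)
    finally show "(\<integral>\<^sup>+y. ennreal (exp (Max ((\<lambda>d. (dot p v d + ?S d \<omega>) + (expectation (g d) - g d y)) ` F))) \<partial>M)
      \<le> (\<integral>\<^sup>+y. G ((fun_upd \<omega> n y)) \<partial>M)" .
  qed
  also have "\<dots> = (\<integral>\<^sup>+\<omega>. G \<omega> \<partial>PiM (insert n {..<n}) (\<lambda>_. M))"
    by (rule P.product_nn_integral_insert[symmetric]) (use Gm in auto)
  \<comment> \<open>Symmetrization needed observation \<open>n\<close> innermost, with the others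
    frozen. The order is now exchanged so that the induction hypothesis applies with
    \<open>y\<close> fixed.\<close>
  also have "\<dots> = (\<integral>\<^sup>+y. (\<integral>\<^sup>+\<omega>. G ((fun_upd \<omega> n y)) \<partial>PiM {..<n} (\<lambda>_. M)) \<partial>M)"
    by (rule P.product_nn_integral_insert_rev) (use Gm in auto)
  also have "\<dots> \<le> (\<integral>\<^sup>+y. (\<Sum>j<p. ennreal (c ^ n * (2 * cosh (B * v j))) * ennreal (cosh (2 * B * x j y))) \<partial>M)"
  proof (rule nn_integral_mono)
    fix y
    have "(\<integral>\<^sup>+\<omega>. G ((fun_upd \<omega> n y)) \<partial>PiM {..<n} (\<lambda>_. M))
      = ennreal (1/2) * ((\<integral>\<^sup>+\<omega>. H (\<lambda>j. v j + 2 * x j y) \<omega> \<partial>PiM {..<n} (\<lambda>_. M))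
        + (\<integral>\<^sup>+\<omega>. H (\<lambda>j. v j - 2 * x j y) \<omega> \<partial>PiM {..<n} (\<lambda>_. M)))"
      unfolding G_def Hupd using Hm by (simp add: nn_integral_cmult nn_integral_add)
    also have "\<dots> \<le> ennreal (1/2) * (ennreal (c ^ n * (\<Sum>j<p. 2 * cosh (B * (v j + 2 * x j y))))
        + ennreal (c ^ n * (\<Sum>j<p. 2 * cosh (B * (v j - 2 * x j y)))))"
      unfolding H_def using Suc.IH by (intro mult_left_mono add_mono) auto
    also have "\<dots> = ennreal (1/2 * (c ^ n * (\<Sum>j<p. 2 * cosh (B * (v j + 2 * x j y)))
        + c ^ n * (\<Sum>j<p. 2 * cosh (B * (v j - 2 * x j y)))))"
      using c(2)
      by (subst ennreal_mult', simp, subst ennreal_plus)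
        (auto intro!: mult_nonneg_nonneg sum_nonneg cosh_real_nonneg simp del: ennreal_half)
    also have "1/2 * (c ^ n * (\<Sum>j<p. 2 * cosh (B * (v j + 2 * x j y)))
        + c ^ n * (\<Sum>j<p. 2 * cosh (B * (v j - 2 * x j y))))
      = (\<Sum>j<p. c ^ n * (2 * cosh (B * v j)) * cosh (2 * B * x j y))"
    proof -
      have "cosh (B * (v j + 2 * x j y)) + cosh (B * (v j - 2 * x j y)) = 2 * cosh (B * v j) * cosh (2 * B * x j y)" for j
        using cosh_add[of "B * v j" "2 * B * x j y"] cosh_diff[of "B * v j" "2 * B * x j y"]
        by (simp add: algebra_simps)
      then have "c ^ n * (2 * cosh (B * v j)) * cosh (2 * B * x j y)
          = c ^ n * (cosh (B * (v j + 2 * x j y)) + cosh (B * (v j - 2 * x j y)))" for j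
        by (metis mult.assoc)
      then show ?thesis
        by (simp add: sum_distrib_left sum.distrib distrib_left)
    qed
    also have "ennreal (\<Sum>j<p. c ^ n * (2 * cosh (B * v j)) * cosh (2 * B * x j y))
      = (\<Sum>j<p. ennreal (c ^ n * (2 * cosh (B * v j))) * ennreal (cosh (2 * B * x j y)))"
      using c(2) by (subst sum_ennreal[symmetric])
        (auto simp: ennreal_mult intro!: mult_nonneg_nonneg cosh_real_nonneg)
    finally show "(\<integral>\<^sup>+\<omega>. G ((fun_upd \<omega> n y)) \<partial>PiM {..<n} (\<lambda>_. M))
      \<le> (\<Sum>j<p. ennreal (c ^ n * (2 * cosh (B * v j))) * ennreal (cosh (2 * B * x j y)))" .
  qed
  also have "\<dots> = (\<Sum>j<p. ennreal (c ^ n * (2 * cosh (B * v j))) * (\<integral>\<^sup>+y. ennreal (cosh (2 * B * x j y)) \<partial>M))"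
    unfolding cosh_def by (subst nn_integral_sum) (auto simp: nn_integral_cmult)
  also have "\<dots> \<le> (\<Sum>j<p. ennreal (c ^ n * (2 * cosh (B * v j))) * ennreal c)"
    using c(1) by (intro sum_mono mult_left_mono) auto
  also have "\<dots> = ennreal (c ^ Suc n * (\<Sum>j<p. 2 * cosh (B * v j)))"
    using c(2)
    by (simp add: ennreal_mult[symmetric] sum_ennreal sum_distrib_left algebra_simps cosh_real_nonneg)
  finally show ?case unfolding J_def .
qed

text \<open>A Chernoff bound with exponent 1; any other exponent is obtained by rescaling
  \<open>x\<close> and \<open>g\<close>, as both applications do with \<open>\<mu>\<close>. Starting
  from \<open>v = 0\<close>, every coordinate contributes \<open>2 * cosh 0\<close>, hence the
  factor \<open>2 * real p\<close>.\<close>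

lemma deviation_finite:
  fixes x :: "nat \<Rightarrow> 'a \<Rightarrow> real" and g :: "(nat \<Rightarrow> real) \<Rightarrow> 'a \<Rightarrow> real"
  assumes F: "finite F" and p: "1 \<le> p"
    and B: "\<And>d. d \<in> F \<Longrightarrow> (\<Sum>j<p. \<bar>d j\<bar>) \<le> B"
    and x [measurable]: "\<And>j. j < p \<Longrightarrow> x j \<in> borel_measurable M"
    and g: "\<And>d. d \<in> F \<Longrightarrow> integrable M (g d)"
    and lip: "\<And>d d' w. d \<in> F \<Longrightarrow> d' \<in> F \<Longrightarrow> \<bar>g d w - g d' w\<bar> \<le> \<bar>dot p (\<lambda>j. x j w) d - dot p (\<lambda>j. x j w) d'\<bar>"
    and dom: "\<And>d w. d \<in> F \<Longrightarrow> \<bar>g d w\<bar> \<le> \<bar>dot p (\<lambda>j. x j w) d\<bar>"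
    and c: "\<And>j. j < p \<Longrightarrow> (\<integral>\<^sup>+w. ennreal (cosh (2 * B * x j w)) \<partial>M) \<le> ennreal c" "0 \<le> c"
  shows "measure (PiM {..<n} (\<lambda>_. M))
      {\<omega> \<in> space (PiM {..<n} (\<lambda>_. M)). \<exists>d\<in>F. t < (\<Sum>i<n. expectation (g d) - g d (\<omega> i))}
      \<le> exp (- t) * (2 * real p * c ^ n)"
proof (cases "F = {}")
  case True
  then show ?thesis using c(2) by simp
next
  case False
  interpret P: prob_space "PiM {..<n} (\<lambda>_. M)" by (rule prob_space_PiM) (rule prob_space_axioms)
  let ?M = "PiM {..<n} (\<lambda>_. M)"
  let ?S = "\<lambda>d \<omega>. \<Sum>i<n. expectation (g d) - g d (\<omega> i)"
  let ?X = "\<lambda>\<omega>. Max ((\<lambda>d. ?S d \<omega>) ` F)"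
  have gm': "(\<lambda>\<omega>. g d (\<omega> i)) \<in> borel_measurable (PiM I (\<lambda>_. M))" if "d \<in> F" "i \<in> I" for d i and I :: "nat set"
    using that g[OF that(1)] by (intro measurable_compose[OF measurable_component_singleton]) auto
  have Sm: "(\<lambda>\<omega>. ?S d \<omega>) \<in> borel_measurable ?M" if "d \<in> F" for d
    using that
    by (intro borel_measurable_sum borel_measurable_diff borel_measurable_const
         gm') auto
  have Xm [measurable]: "?X \<in> borel_measurable ?M"
    using F Sm by (intro borel_measurable_Max) auto
  have eq: "{\<omega> \<in> space ?M. \<exists>d\<in>F. t < ?S d \<omega>} = {\<omega> \<in> space ?M. t < ?X \<omega>}"
    using F False by (subst Max_gr_iff) auto
  have "emeasure ?M {\<omega> \<in> space ?M. t < ?X \<omega>}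
      \<le> emeasure ?M {\<omega> \<in> space ?M. 1 \<le> ennreal (exp (- t)) * ennreal (exp (?X \<omega>))}"
  proof (intro emeasure_mono)
    show "{\<omega> \<in> space ?M. t < ?X \<omega>} \<subseteq> {\<omega> \<in> space ?M. 1 \<le> ennreal (exp (- t)) * ennreal (exp (?X \<omega>))}"
    proof safe
      fix \<omega> assume "t < ?X \<omega>"
      then have "1 \<le> exp (- t) * exp (?X \<omega>)" by (simp add: exp_add[symmetric])
      then have "ennreal 1 \<le> ennreal (exp (- t) * exp (?X \<omega>))" by (rule ennreal_leI)
      then show "1 \<le> ennreal (exp (- t)) * ennreal (exp (?X \<omega>))"
        by (subst ennreal_mult'[symmetric]) auto
    qed
  qed auto
  also have "\<dots> \<le> ennreal (exp (- t)) * (\<integral>\<^sup>+\<omega>. ennreal (exp (?X \<omega>)) \<partial>?M)"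
  proof -
    have [measurable]: "(\<lambda>\<omega>. ennreal (exp (?X \<omega>))) \<in> borel_measurable ?M" using Xm by measurable
    have "emeasure ?M ({\<omega> \<in> space ?M. 1 \<le> ennreal (exp (- t)) * ennreal (exp (?X \<omega>))})
      \<le> ennreal (exp (- t)) * (\<integral>\<^sup>+\<omega>. ennreal (exp (?X \<omega>)) * indicator (space ?M) \<omega> \<partial>?M)"
      by (rule nn_integral_Markov_inequality) auto
    then show ?thesis by (simp cong: nn_integral_cong_simp)
  qed
  also have "\<dots> \<le> ennreal (exp (- t)) * ennreal (c ^ n * (\<Sum>j<p. 2 * cosh (B * 0)))"
    using exp_Max_sum_le[OF F False p B x g lip dom c, where v = "\<lambda>_. 0"]
    by (intro mult_left_mono) (auto simp: dot_def)
  also have "\<dots> = ennreal (exp (- t) * (2 * real p * c ^ n))"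
    using c(2) by (simp add: ennreal_mult'[symmetric] algebra_simps)
  finally show ?thesis
    unfolding eq P.emeasure_eq_measure using c(2) by (subst (asm) ennreal_le_iff) auto
qed

end

section \<open>Uniform deviations and moments from tail bounds\<close>

lemma continuous_on_dot_right [continuous_intros]:
  fixes u :: "nat \<Rightarrow> real"
  shows "continuous_on S (\<lambda>d. dot p u d)"
  unfolding dot_def
  by (intro continuous_on_sum continuous_on_mult continuous_on_const
      continuous_on_subset[OF continuous_on_product_coordinates]) auto

context prob_space
begin

text \<open>The bound depends on the index set only through its l1 radius, not its cardinality, so
  it survives an increasing union of finite sets.\<close>

lemma deviation_countable:
  fixes x :: "nat \<Rightarrow> 'a \<Rightarrow> real" and g :: "(nat \<Rightarrow> real) \<Rightarrow> 'a \<Rightarrow> real" and t :: real and n :: nat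
  assumes T: "countable T" and p: "1 \<le> p"
    and B: "\<And>d. d \<in> T \<Longrightarrow> (\<Sum>j<p. \<bar>d j\<bar>) \<le> B"
    and x: "\<And>j. j < p \<Longrightarrow> x j \<in> borel_measurable M"
    and g: "\<And>d. d \<in> T \<Longrightarrow> integrable M (g d)"
    and lip: "\<And>d d' w. d \<in> T \<Longrightarrow> d' \<in> T \<Longrightarrow> \<bar>g d w - g d' w\<bar> \<le> \<bar>dot p (\<lambda>j. x j w) d - dot p (\<lambda>j. x j w) d'\<bar>"
    and dom: "\<And>d w. d \<in> T \<Longrightarrow> \<bar>g d w\<bar> \<le> \<bar>dot p (\<lambda>j. x j w) d\<bar>"
    and c: "\<And>j. j < p \<Longrightarrow> (\<integral>\<^sup>+w. ennreal (cosh (2 * B * x j w)) \<partial>M) \<le> ennreal c" "0 \<le> c"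
  defines "E \<equiv> {\<omega> \<in> space (PiM {..<n} (\<lambda>_. M)). \<exists>d\<in>T. t < (\<Sum>i<n. expectation (g d) - g d (\<omega> i))}"
  shows "E \<in> sets (PiM {..<n} (\<lambda>_. M))"
    and "measure (PiM {..<n} (\<lambda>_. M)) E \<le> exp (- t) * (2 * real p * c ^ n)"
proof -
  let ?M = "PiM {..<n} (\<lambda>_. M)"
  interpret P: prob_space ?M by (rule prob_space_PiM) (rule prob_space_axioms)
  let ?S = "\<lambda>d \<omega>. \<Sum>i<n. expectation (g d) - g d (\<omega> i)"
  let ?A = "\<lambda>F. {\<omega> \<in> space ?M. \<exists>d\<in>F. t < ?S d \<omega>}"
  have gm: "(\<lambda>\<omega>. g d (\<omega> i)) \<in> borel_measurable ?M" if "d \<in> T" "i < n" for d i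
    using that g[OF that(1)] by (intro measurable_compose[OF measurable_component_singleton]) auto
  have [measurable]: "?S d \<in> borel_measurable ?M" if "d \<in> T" for d
    using that by (intro borel_measurable_sum borel_measurable_diff borel_measurable_const gm) auto
  have As: "?A F \<in> sets ?M" if "F \<subseteq> T" for F
  proof -
    have "?A F = (\<Union>d\<in>F. {\<omega> \<in> space ?M. t < ?S d \<omega>})" by auto
    also have "\<dots> \<in> sets ?M"
      using that T countable_subset by (intro sets.countable_UN') auto
    finally show ?thesis .
  qed
  show "E \<in> sets ?M" unfolding E_def by (rule As) simp
  show "measure ?M E \<le> exp (- t) * (2 * real p * c ^ n)"
  proof (cases "T = {}")
    case True
    then show ?thesis using c(2) by (simp add: E_def)
  next
    case False
    define F where "F = (\<lambda>k. from_nat_into T ` {..k::nat})"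
    have FT: "F k \<subseteq> T" for k using from_nat_into[OF False] by (auto simp: F_def)
    have UF: "(\<Union>k. F k) = T"
    proof -
      have "(\<Union>k. F k) = range (from_nat_into T)" unfolding F_def by auto
      then show ?thesis using range_from_nat_into[OF False T] by simp
    qed
    have mono: "F k \<subseteq> F l" if "k \<le> l" for k l using that unfolding F_def by (intro image_mono) simp
    have "(\<lambda>k. measure ?M (?A (F k))) \<longlonglongrightarrow> measure ?M (\<Union>k. ?A (F k))"
    proof (rule P.finite_Lim_measure_incseq)
      show "range (\<lambda>k. ?A (F k)) \<subseteq> sets ?M" using As[OF FT] by blast
      show "incseq (\<lambda>k. ?A (F k))" using mono unfolding incseq_def by blast
    qed
    moreover have "(\<Union>k. ?A (F k)) = E" unfolding E_def using UF by blast
    moreover have "measure ?M (?A (F k)) \<le> exp (- t) * (2 * real p * c ^ n)" for k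
    proof (rule deviation_finite[OF _ p _ x _ _ _ c])
      show "finite (F k)" by (simp add: F_def)
    qed (use FT[of k] in \<open>blast intro: B g lip dom\<close>)+
    ultimately have "(\<lambda>k. measure ?M (?A (F k))) \<longlonglongrightarrow> measure ?M E"
      "\<And>k. measure ?M (?A (F k)) \<le> exp (- t) * (2 * real p * c ^ n)" by simp_all
    then show ?thesis by (intro LIMSEQ_le_const2) blast+
  qed
qed

text \<open>For uncountable \<open>T\<close> the failure event need not be measurable. The event is
  therefore defined on a countable dense subset, and the inequality passes to all of
  \<open>T\<close> because it cuts out a closed set of directions.\<close>

lemma uniform_lower_bound:
  fixes x :: "nat \<Rightarrow> 'a \<Rightarrow> real" and g :: "(nat \<Rightarrow> real) \<Rightarrow> 'a \<Rightarrow> real"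
  assumes p: "1 \<le> p"
    and B: "\<And>d. d \<in> T \<Longrightarrow> (\<Sum>j<p. \<bar>d j\<bar>) \<le> B"
    and x: "\<And>j. j < p \<Longrightarrow> x j \<in> borel_measurable M"
    and g: "\<And>d. d \<in> T \<Longrightarrow> integrable M (g d)"
    and lip: "\<And>d d' w. d \<in> T \<Longrightarrow> d' \<in> T \<Longrightarrow> \<bar>g d w - g d' w\<bar> \<le> \<bar>dot p (\<lambda>j. x j w) d - dot p (\<lambda>j. x j w) d'\<bar>"
    and dom: "\<And>d w. d \<in> T \<Longrightarrow> \<bar>g d w\<bar> \<le> \<bar>dot p (\<lambda>j. x j w) d\<bar>"
    and c: "\<And>j. j < p \<Longrightarrow> (\<integral>\<^sup>+w. ennreal (cosh (2 * B * x j w)) \<partial>M) \<le> ennreal c" "0 \<le> c"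
    and cont: "\<And>w. continuous_on UNIV (\<lambda>d. g d w)"
    and m: "\<And>d. d \<in> T \<Longrightarrow> m \<le> expectation (g d)"
  obtains A where "A \<in> sets (PiM {..<n} (\<lambda>_. M))"
    and "measure (PiM {..<n} (\<lambda>_. M)) A \<ge> 1 - exp (- t) * (2 * real p * c ^ n)"
    and "\<And>\<omega> d. \<omega> \<in> A \<Longrightarrow> d \<in> T \<Longrightarrow> n * m - t \<le> (\<Sum>i<n. g d (\<omega> i))"
proof -
  let ?M = "PiM {..<n} (\<lambda>_. M)"
  interpret P: prob_space ?M by (rule prob_space_PiM) (rule prob_space_axioms)
  obtain T' where T': "countable T'" "T' \<subseteq> T" "T \<subseteq> closure T'"
    using separable[of T] by metis
  let ?E = "{\<omega> \<in> space ?M. \<exists>d\<in>T'. t < (\<Sum>i<n. expectation (g d) - g d (\<omega> i))}"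
  have E: "?E \<in> sets ?M" "measure ?M ?E \<le> exp (- t) * (2 * real p * c ^ n)"
    using T'(2) 
    by (intro deviation_countable(1)[OF T'(1) p B x g lip dom c]
         deviation_countable(2)[OF T'(1) p B x g lip dom c]; blast)+
  show thesis
  proof
    show "space ?M - ?E \<in> sets ?M" using E(1) by blast
    show "measure ?M (space ?M - ?E) \<ge> 1 - exp (- t) * (2 * real p * c ^ n)"
      using E by (subst P.prob_compl) auto
    fix \<omega> d assume \<omega>: "\<omega> \<in> space ?M - ?E" and d: "d \<in> T"
    let ?C = "{d. n * m - t \<le> (\<Sum>i<n. g d (\<omega> i))}"
    have "closed ?C" by (intro closed_Collect_le continuous_intros cont)
    moreover have "T' \<subseteq> ?C"
    proof
      fix d' assume d': "d' \<in> T'"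
      then have "(\<Sum>i<n. expectation (g d') - g d' (\<omega> i)) \<le> t" using \<omega> by force
      then have "n * expectation (g d') - t \<le> (\<Sum>i<n. g d' (\<omega> i))" by (simp add: sum_subtractf)
      moreover have "n * m \<le> n * expectation (g d')" using m d' T'(2) by (intro mult_left_mono) auto
      ultimately show "d' \<in> ?C" by simp
    qed
    ultimately have "closure T' \<subseteq> ?C" by (simp add: closure_minimal)
    then show "n * m - t \<le> (\<Sum>i<n. g d (\<omega> i))" using T'(3) d by blast
  qed
qed

text \<open>Slicing by the integer part of \<open>Y\<close> gives a geometric series, convergent
  because the exponent 1/2 is below the tail rate 1. With \<open>a = exp (1/2)\<close> its sum is
  \<open>2 * a\<^sup>2 / (a - 1)\<close>, and \<open>3/2 \<le> a\<close>,
  \<open>a\<^sup>2 \<le> 3\<close> give 12.\<close>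

lemma exp_moment_of_tail:
  assumes [measurable]: "Y \<in> borel_measurable M" and Y: "\<And>w. 0 \<le> Y w"
    and tail: "\<And>t. 0 \<le> t \<Longrightarrow> prob {w \<in> space M. t \<le> Y w} \<le> 2 * exp (- t)"
  shows "(\<integral>\<^sup>+w. ennreal (exp (Y w / 2)) \<partial>M) \<le> ennreal 12"
proof -
  let ?f = "\<lambda>k w. ennreal (exp ((real k + 1) / 2)) * indicator {w \<in> space M. real k \<le> Y w} w"
  let ?a = "exp (1/2 :: real)"
  have "(\<integral>\<^sup>+w. ennreal (exp (Y w / 2)) \<partial>M) \<le> (\<integral>\<^sup>+w. (\<Sum>k. ?f k w) \<partial>M)"
  proof (rule nn_integral_mono)
    fix w assume w: "w \<in> space M"
    define k where "k = nat \<lfloor>Y w\<rfloor>"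
    have k: "real k \<le> Y w" "Y w \<le> real k + 1" using Y[of w] unfolding k_def by linarith+
    have "ennreal (exp (Y w / 2)) \<le> ?f k w" using k w by (auto intro!: ennreal_leI)
    also have "\<dots> = sum (\<lambda>k. ?f k w) {k}" by (simp only: sum.insert finite.emptyI empty_iff not_False_eq_True sum.empty add_0_right)
    also have "\<dots> \<le> (\<Sum>k. ?f k w)" by (rule sum_le_suminf) auto
    finally show "ennreal (exp (Y w / 2)) \<le> (\<Sum>k. ?f k w)" .
  qed
  also have "\<dots> = (\<Sum>k. \<integral>\<^sup>+w. ?f k w \<partial>M)" by (rule nn_integral_suminf) measurable
  also have "\<dots> \<le> (\<Sum>k. ennreal (2 * ?a * (exp (- (1/2))) ^ k))"
  proof (intro suminf_le summableI)
    fix k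
    have "(\<integral>\<^sup>+w. ?f k w \<partial>M) = ennreal (exp ((real k + 1) / 2)) * emeasure M {w \<in> space M. real k \<le> Y w}"
      by (subst nn_integral_cmult_indicator) auto
    also have "\<dots> \<le> ennreal (exp ((real k + 1) / 2)) * ennreal (2 * exp (- real k))"
      using tail[of "real k"] by (intro mult_left_mono) (auto simp: emeasure_eq_measure intro!: ennreal_leI)
    also have "\<dots> = ennreal (exp ((real k + 1) / 2) * (2 * exp (- real k)))" by (simp add: ennreal_mult)
    also have "exp ((real k + 1) / 2) * (2 * exp (- real k)) = 2 * ?a * (exp (- (1/2))) ^ k"
      by (simp add: exp_of_nat_mult[symmetric] exp_add[symmetric] field_simps flip: exp_minus)
    finally show "(\<integral>\<^sup>+w. ?f k w \<partial>M) \<le> ennreal (2 * ?a * (exp (- (1/2))) ^ k)" .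
  qed
  also have "\<dots> = ennreal (2 * ?a * (1 / (1 - exp (- (1/2)))))"
    by (intro suminf_ennreal_eq sums_mult geometric_sums) auto
  also have "\<dots> \<le> ennreal 12"
  proof (rule ennreal_leI)
    have a: "3/2 \<le> ?a" using exp_ge_add_one_self[of "1/2"] by simp
    have a2: "?a * ?a \<le> 3" using exp_le by (simp add: exp_add[symmetric])
    have "2 * ?a * (1 / (1 - exp (- (1/2)))) = 2 * (?a * ?a) / (?a - 1)"
      using a by (simp add: exp_minus field_simps)
    also have "\<dots> \<le> 12" using a a2 by (simp add: divide_le_eq)
    finally show "2 * ?a * (1 / (1 - exp (- (1/2)))) \<le> 12" .
  qed
  finally show ?thesis .
qed

end

text \<open>The remainder must be quadratic in \<open>a\<close> for the n-th power of the moment to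
  stay under control. In the power series every even term of order at least 2 has
  \<open>(2 * a) ^ n \<le> (2 * a) ^ 2\<close>, which extracts \<open>4 * a\<^sup>2\<close> and
  leaves the series at the fixed argument \<open>y / 2\<close>.\<close>

lemma cosh_scale_le:
  fixes y a :: real
  assumes "0 \<le> a" "a \<le> 1/2" "0 \<le> y"
  shows "cosh (a * y) \<le> 1 + 4 * a\<^sup>2 * exp (y / 2)"
proof -
  let ?c = "\<lambda>z n. if even n then z ^ n /\<^sub>R fact n else (0::real)"
  have "cosh (a * y) \<le> 1 + 4 * a\<^sup>2 * cosh (y / 2)"
  proof (rule sums_le)
    show "?c (a * y) sums cosh (a * y)" by (rule cosh_converges)
    show "(\<lambda>n. (if n = 0 then 1 else 0) + 4 * a\<^sup>2 * ?c (y / 2) n) sums (1 + 4 * a\<^sup>2 * cosh (y / 2))"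
      by (intro sums_add sums_mult cosh_converges) (use sums_single[of 0 "\<lambda>_. 1::real"] in simp)
    fix n :: nat
    show "?c (a * y) n \<le> (if n = 0 then 1 else 0) + 4 * a\<^sup>2 * ?c (y / 2) n"
    proof (cases "even n \<and> n \<noteq> 0")
      case True
      then have "2 \<le> n" by (cases n; cases "n - 1") auto
      then have "(2 * a) ^ n \<le> (2 * a) ^ 2" using assms by (intro power_decreasing) auto
      then have "(2 * a) ^ n * (y / 2) ^ n \<le> 4 * a\<^sup>2 * (y / 2) ^ n"
        using assms by (intro mult_right_mono) (auto simp: power2_eq_square)
      moreover have "(2 * a) ^ n * (y / 2) ^ n = (a * y) ^ n"
        by (subst power_mult_distrib[symmetric]) simp
      ultimately have "(a * y) ^ n \<le> 4 * a\<^sup>2 * (y / 2) ^ n" by simp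
      then have "(a * y) ^ n / fact n \<le> 4 * a\<^sup>2 * (y / 2) ^ n / fact n"
        by (intro divide_right_mono) auto
      moreover have "?c z n = z ^ n / fact n" for z
        using True by (simp add: divide_inverse mult.commute)
      ultimately show ?thesis using True by simp
    qed auto
  qed
  also have "cosh (y / 2) \<le> exp (y / 2)" using assms(3) by (simp add: cosh_def)
  finally show ?thesis by (simp add: mult_left_mono)
qed

text \<open>The square of the quadratic Taylor bound for \<open>exp (y / 4)\<close>; the constant is
  \<open>(2 * 4\<^sup>2)\<^sup>2\<close>.\<close>

lemma power4_le_exp:
  fixes y :: real
  assumes "0 \<le> y"
  shows "y ^ 4 \<le> 1024 * exp (y / 2)"
proof -
  have "(y / 4)\<^sup>2 / 2 \<le> exp (y / 4)"
    using exp_lower_Taylor_quadratic[of "y / 4"] assms by simp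
  then have "((y / 4)\<^sup>2 / 2)\<^sup>2 \<le> (exp (y / 4))\<^sup>2" by (intro power_mono) auto
  moreover have "(exp (y / 4))\<^sup>2 = exp (y / 2)" using exp_double[of "y / 4"] by simp
  moreover have "((y / 4)\<^sup>2 / 2)\<^sup>2 = y ^ 4 / 1024" by (simp add: field_simps power2_eq_square power4_eq_xxxx)
  ultimately show ?thesis by simp
qed

text \<open>\<open>trunc_sq R z\<close> agrees with \<open>z\<^sup>2\<close> for \<open>\<bar>z\<bar> \<le> R / 2\<close>, vanishes for \<open>\<bar>z\<bar> \<ge> R\<close>, and is Lipschitz, as
  the contraction principle requires.\<close>

definition trunc_sq :: "real \<Rightarrow> real \<Rightarrow> real" where
  "trunc_sq R z = (min \<bar>z\<bar> (max (R - \<bar>z\<bar>) 0))\<^sup>2"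

lemma trunc_sq_nonneg: "0 \<le> trunc_sq R z"
  and trunc_sq_le: "trunc_sq R z \<le> z\<^sup>2"
  and trunc_sq_eq_0: "R \<le> \<bar>z\<bar> \<Longrightarrow> trunc_sq R z = 0"
proof -
  show "trunc_sq R z \<le> z\<^sup>2"
    unfolding trunc_sq_def by (subst power2_abs[of z, symmetric], rule power_mono) auto
qed (auto simp: trunc_sq_def)

lemma trunc_sq_zero [simp]: "trunc_sq R 0 = 0"
  by (simp add: trunc_sq_def)

text \<open>The base of the square is a 1-Lipschitz tent of height \<open>R / 2\<close>, so
  factoring the difference of squares gives the constant \<open>R\<close>.\<close>

lemma trunc_sq_lipschitz:
  assumes "0 \<le> R"
  shows "\<bar>trunc_sq R u - trunc_sq R v\<bar> \<le> R * \<bar>u - v\<bar>"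
proof -
  define m where "m = (\<lambda>z::real. min \<bar>z\<bar> (max (R - \<bar>z\<bar>) 0))"
  have m: "0 \<le> m z" "m z \<le> R / 2" for z using assms by (auto simp: m_def min_def max_def)
  have lip: "\<bar>m u - m v\<bar> \<le> \<bar>u - v\<bar>" by (auto simp: m_def min_def max_def)
  have "trunc_sq R u - trunc_sq R v = (m u - m v) * (m u + m v)"
    by (simp add: trunc_sq_def m_def power2_eq_square algebra_simps)
  then have "\<bar>trunc_sq R u - trunc_sq R v\<bar> = \<bar>m u - m v\<bar> * (m u + m v)"
    using m(1)[of u] m(1)[of v] by (simp add: abs_mult)
  also have "\<dots> \<le> \<bar>u - v\<bar> * R"
    using m[of u] m[of v] lip by (intro mult_mono) auto
  finally show ?thesis by (simp add: mult.commute)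
qed

text \<open>The cost of truncation is charged to the fourth moment: where truncation acts,
  \<open>\<bar>z\<bar> > R / 2\<close> and the left-hand side is not positive.\<close>

lemma trunc_sq_ge:
  assumes "0 < R"
  shows "z\<^sup>2 - 4 / R\<^sup>2 * z ^ 4 \<le> trunc_sq R z"
proof (cases "\<bar>z\<bar> \<le> R / 2")
  case True
  then have "min \<bar>z\<bar> (max (R - \<bar>z\<bar>) 0) = \<bar>z\<bar>" by auto
  then show ?thesis by (simp add: trunc_sq_def)
next
  case False
  then have "(R / 2)\<^sup>2 \<le> \<bar>z\<bar>\<^sup>2" using assms by (intro power_mono) auto
  then have "1 \<le> 4 / R\<^sup>2 * z\<^sup>2" using assms by (simp add: field_simps)
  then have "1 * z\<^sup>2 \<le> 4 / R\<^sup>2 * z\<^sup>2 * z\<^sup>2" by (rule mult_right_mono) simp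
  then have "z\<^sup>2 - 4 / R\<^sup>2 * z ^ 4 \<le> 0" by (simp add: power2_eq_square power4_eq_xxxx mult_ac)
  then show ?thesis using trunc_sq_nonneg order_trans by blast
qed

lemma trunc_sq_measurable [measurable]: "trunc_sq R \<in> borel_measurable borel"
  unfolding trunc_sq_def by measurable

lemma continuous_on_trunc_sq [continuous_intros]:
  "continuous_on S f \<Longrightarrow> continuous_on S (\<lambda>x. trunc_sq R (f x))"
  unfolding trunc_sq_def
  by (intro continuous_on_power continuous_on_min continuous_on_max continuous_on_rabs
        continuous_on_diff continuous_on_const)

section \<open>Moments of sub-exponential variables\<close>

context prob_space
begin

lemma cosh_moment_of_tail:
  assumes [measurable]: "Z \<in> borel_measurable M" and "0 < b"
    and tail: "\<And>t. 0 \<le> t \<Longrightarrow> prob {w \<in> space M. b * t \<le> \<bar>Z w\<bar>} \<le> 2 * exp (- t)"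
    and \<nu>: "\<bar>\<nu>\<bar> * b \<le> a" "a \<le> 1/2"
  shows "(\<integral>\<^sup>+w. ennreal (cosh (\<nu> * Z w)) \<partial>M) \<le> ennreal (exp (48 * a\<^sup>2))"
proof -
  define Y where "Y = (\<lambda>w. \<bar>Z w\<bar> / b)"
  have [measurable]: "Y \<in> borel_measurable M" unfolding Y_def by measurable
  have Y0: "0 \<le> Y w" for w using \<open>0 < b\<close> by (simp add: Y_def)
  have a0: "0 \<le> a" using \<nu>(1) \<open>0 < b\<close> by (meson abs_ge_zero less_imp_le mult_nonneg_nonneg order_trans)
  have tY: "prob {w \<in> space M. t \<le> Y w} \<le> 2 * exp (- t)" if "0 \<le> t" for t
    using tail[OF that] \<open>0 < b\<close> by (simp add: Y_def field_simps)
  have "(\<integral>\<^sup>+w. ennreal (cosh (\<nu> * Z w)) \<partial>M) \<le> (\<integral>\<^sup>+w. 1 + ennreal (4 * a\<^sup>2) * ennreal (exp (Y w / 2)) \<partial>M)"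
  proof (rule nn_integral_mono)
    fix w
    have "\<bar>\<nu> * Z w\<bar> = \<bar>\<nu>\<bar> * b * Y w" using \<open>0 < b\<close> by (simp add: Y_def abs_mult)
    also have "\<dots> \<le> a * Y w" using \<nu>(1) Y0 by (rule mult_right_mono)
    finally have "cosh \<bar>\<nu> * Z w\<bar> \<le> cosh (a * Y w)"
      by (subst cosh_real_nonneg_le_iff) (auto simp: a0 Y0)
    moreover have "cosh \<bar>\<nu> * Z w\<bar> = cosh (\<nu> * Z w)" by (simp add: abs_if)
    ultimately have "cosh (\<nu> * Z w) \<le> 1 + 4 * a\<^sup>2 * exp (Y w / 2)"
      using cosh_scale_le[OF a0 \<nu>(2) Y0[of w]] by simp
    then have "ennreal (cosh (\<nu> * Z w)) \<le> ennreal (1 + 4 * a\<^sup>2 * exp (Y w / 2))" by (rule ennreal_leI)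
    then show "ennreal (cosh (\<nu> * Z w)) \<le> 1 + ennreal (4 * a\<^sup>2) * ennreal (exp (Y w / 2))"
      by (simp add: ennreal_mult)
  qed
  also have "\<dots> = 1 + ennreal (4 * a\<^sup>2) * (\<integral>\<^sup>+w. ennreal (exp (Y w / 2)) \<partial>M)"
    by (subst nn_integral_add) (auto simp: nn_integral_cmult emeasure_space_1)
  also have "\<dots> \<le> 1 + ennreal (4 * a\<^sup>2) * ennreal 12"
    using exp_moment_of_tail[of Y] Y0 tY by (intro add_mono mult_left_mono) auto
  \<comment> \<open>The 48 is the 4 of \<open>cosh_scale_le\<close> times the 12 of
    \<open>exp_moment_of_tail\<close>.\<close>
  also have "\<dots> = ennreal (1 + 48 * a\<^sup>2)" by (subst ennreal_plus) (auto simp: ennreal_mult''[symmetric] simp del: ennreal_numeral)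
  also have "\<dots> \<le> ennreal (exp (48 * a\<^sup>2))" by (intro ennreal_leI exp_ge_add_one_self)
  finally show ?thesis .
qed

text \<open>The truncation level is chosen so that at most half of the second moment is lost. The
  loss is of order \<open>(v * r) ^ 4 / R\<^sup>2\<close>, which dictates a level proportional to
  \<open>v\<^sup>2 * r\<close>.\<close>

lemma trunc_sq_expectation_ge:
  assumes [measurable]: "Z \<in> borel_measurable M" and Z2: "integrable M (\<lambda>w. (Z w)\<^sup>2)" "expectation (\<lambda>w. (Z w)\<^sup>2) = r\<^sup>2"
    and r: "0 < r" and v: "1 \<le> v"
    and tail: "\<And>t. 0 \<le> t \<Longrightarrow> prob {w \<in> space M. v * r * t \<le> \<bar>Z w\<bar>} \<le> 2 * exp (- t)"
  shows "r\<^sup>2 / 2 \<le> expectation (\<lambda>w. trunc_sq (400 * v\<^sup>2 * r) (Z w))"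
proof -
  define b where "b = v * r"
  have b: "0 < b" using r v by (simp add: b_def)
  define R where "R = 400 * v\<^sup>2 * r"
  have R: "0 < R" using r v by (simp add: R_def)
  define Y where "Y = (\<lambda>w. \<bar>Z w\<bar> / b)"
  have [measurable]: "Y \<in> borel_measurable M" unfolding Y_def by measurable
  have Y0: "0 \<le> Y w" for w using b by (simp add: Y_def)
  have "(\<integral>\<^sup>+w. ennreal ((Y w) ^ 4) \<partial>M) \<le> (\<integral>\<^sup>+w. ennreal 1024 * ennreal (exp (Y w / 2)) \<partial>M)"
  proof (rule nn_integral_mono)
    fix w
    have "ennreal (Y w ^ 4) \<le> ennreal (1024 * exp (Y w / 2))"
      by (intro ennreal_leI power4_le_exp Y0)
    then show "ennreal (Y w ^ 4) \<le> ennreal 1024 * ennreal (exp (Y w / 2))"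
      by (simp add: ennreal_mult')
  qed
  also have "\<dots> = ennreal 1024 * (\<integral>\<^sup>+w. ennreal (exp (Y w / 2)) \<partial>M)"
    by (rule nn_integral_cmult) measurable
  also have "\<dots> \<le> ennreal 1024 * ennreal 12"
    using tail b Y0 by (intro mult_left_mono exp_moment_of_tail) (auto simp: Y_def b_def field_simps)
  also have "\<dots> = ennreal 12288" by (simp add: ennreal_mult'[symmetric])
  finally have Y4: "(\<integral>\<^sup>+w. ennreal ((Y w) ^ 4) \<partial>M) \<le> ennreal 12288" .
  then have Yi: "integrable M (\<lambda>w. (Y w) ^ 4)"
    by (intro integrableI_nonneg) (auto simp: order_le_less_trans)
  have EY: "expectation (\<lambda>w. (Y w) ^ 4) \<le> 12288"
  proof -
    have "ennreal (expectation (\<lambda>w. (Y w) ^ 4)) \<le> ennreal 12288"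
      using Y4 Yi by (subst (asm) nn_integral_eq_integral) auto
    then show ?thesis by (subst (asm) ennreal_le_iff) auto
  qed
  have ZY: "(Z w) ^ 4 = b ^ 4 * (Y w) ^ 4" for w
    using b by (simp add: Y_def power_divide)
  have Zi: "integrable M (\<lambda>w. (Z w) ^ 4)" unfolding ZY using Yi by simp
  have EZ: "expectation (\<lambda>w. (Z w) ^ 4) \<le> b ^ 4 * 12288"
    unfolding ZY using EY by (simp add: mult_left_mono)
  have Ti: "integrable M (\<lambda>w. trunc_sq R (Z w))"
    using Z2(1) trunc_sq_le trunc_sq_nonneg by (rule_tac Bochner_Integration.integrable_bound[OF Z2(1)]) auto
  \<comment> \<open>With \<open>12288 = 1024 * 12\<close> and
    \<open>R\<^sup>2 = 160000 * v ^ 4 * r\<^sup>2\<close>, the left-hand side is about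
    \<open>0.31 * r\<^sup>2\<close>.\<close>
  have "4 / R\<^sup>2 * (b ^ 4 * 12288) \<le> r\<^sup>2 / 2"
    using r v by (simp add: R_def b_def field_simps power2_eq_square power4_eq_xxxx)
  moreover have "4 / R\<^sup>2 * expectation (\<lambda>w. (Z w) ^ 4) \<le> 4 / R\<^sup>2 * (b ^ 4 * 12288)"
    using EZ by (rule mult_left_mono) simp
  moreover have "r\<^sup>2 - 4 / R\<^sup>2 * expectation (\<lambda>w. (Z w) ^ 4) = expectation (\<lambda>w. (Z w)\<^sup>2 - 4 / R\<^sup>2 * (Z w) ^ 4)"
    using Z2 Zi by simp
  moreover have "\<dots> \<le> expectation (\<lambda>w. trunc_sq R (Z w))"
    using Z2(1) Zi Ti trunc_sq_ge[OF R] by (intro integral_mono) auto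
  ultimately show ?thesis unfolding R_def by linarith
qed

end

section \<open>The smoothed check loss\<close>

lemma check_loss_eq_max:
  assumes "0 < \<tau>" "\<tau> < 1"
  shows "check_loss \<tau> v = max (\<tau> * v) ((\<tau> - 1) * v)"
proof (cases "v < 0")
  case True
  have "max (\<tau> * v) ((\<tau> - 1) * v) = (\<tau> - 1) * v"
    using True by (intro max_absorb2) (simp add: algebra_simps)
  then show ?thesis using True by (simp add: check_loss_def mult.commute)
next
  case False
  have "max (\<tau> * v) ((\<tau> - 1) * v) = \<tau> * v"
    using False by (intro max_absorb1) (simp add: algebra_simps)
  then show ?thesis using False by (simp add: check_loss_def mult.commute)
qed

lemma abs_check_loss_le:
  assumes "0 < \<tau>" "\<tau> < 1"
  shows "\<bar>check_loss \<tau> v\<bar> \<le> \<bar>v\<bar>"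
  using assms by (auto simp: check_loss_def abs_mult indicator_def intro!: mult_left_le)

lemma check_loss_convex:
  assumes "0 < \<tau>" "\<tau> < 1" "0 \<le> \<eta>" "\<eta> \<le> 1"
  shows "check_loss \<tau> ((1 - \<eta>) * u + \<eta> * v) \<le> (1 - \<eta>) * check_loss \<tau> u + \<eta> * check_loss \<tau> v"
proof -
  have *: "a * ((1 - \<eta>) * u + \<eta> * v) \<le> (1 - \<eta>) * check_loss \<tau> u + \<eta> * check_loss \<tau> v"
    if "\<And>w. a * w \<le> check_loss \<tau> w" for a
  proof -
    have "(1 - \<eta>) * (a * u) + \<eta> * (a * v) \<le> (1 - \<eta>) * check_loss \<tau> u + \<eta> * check_loss \<tau> v"
      using that assms by (intro add_mono mult_left_mono) auto
    then show ?thesis by (simp add: algebra_simps)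
  qed
  show ?thesis
    using *[of \<tau>] *[of "\<tau> - 1"] assms(1,2) by (simp add: check_loss_eq_max)
qed

lemma check_loss_measurable [measurable]: "check_loss \<tau> \<in> borel_measurable borel"
  unfolding check_loss_def by measurable

lemma check_loss_diff_ge:
  "check_loss \<tau> v - t * (\<tau> - indicator {..<0} v) \<le> check_loss \<tau> (v - t)"
  by (auto simp: check_loss_def indicator_def algebra_simps)

text \<open>When the kink at 0 separates \<open>v\<close> from \<open>v - t\<close>, the loss
  exceeds its subgradient line by exactly \<open>\<bar>v - t\<bar>\<close>. If moreover
  \<open>v\<close> lies in the half of the segment next to the kink, this is at least
  \<open>\<bar>t\<bar> / 2\<close>.\<close>

lemma check_loss_diff_ge_strict:
  assumes "0 \<le> v \<and> 2 * v \<le> t \<and> 0 < t \<or> t \<le> 2 * v \<and> v < 0"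
  shows "check_loss \<tau> v - t * (\<tau> - indicator {..<0} v) + \<bar>t\<bar> / 2 \<le> check_loss \<tau> (v - t)"
  using assms by (auto simp: check_loss_def indicator_def algebra_simps)

locale kernel =
  fixes K :: "real \<Rightarrow> real" and h \<tau> :: real
  assumes B2: "cond_B2 K" and h: "0 < h" and \<tau>: "0 < \<tau>" "\<tau> < 1"
begin

lemma K_measurable [measurable]: "K \<in> borel_measurable borel"
  and K_nonneg: "0 \<le> K u"
  and K_even: "K (- u) = K u"
  and K_integrable: "integrable lborel K"
  and K_integral: "(\<integral>u. K u \<partial>lborel) = 1"
  and K_sq_integrable: "integrable lborel (\<lambda>u. u\<^sup>2 * K u)"
  using B2 by (auto simp: cond_B2_def)

lemma smoothed_loss_eq: "smoothed_loss \<tau> K h u = (\<integral>w. check_loss \<tau> (u + h * w) * K w \<partial>lborel)"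
  unfolding smoothed_loss_def
  using h by (subst lborel_integral_real_affine[where c = h and t = u]) auto

lemma loss_integrable: "integrable lborel (\<lambda>w. check_loss \<tau> (u + h * w) * K w)"
proof (rule Bochner_Integration.integrable_bound)
  show "integrable lborel (\<lambda>w. (\<bar>u\<bar> + h) * K w + h * (w\<^sup>2 * K w))"
    using K_integrable K_sq_integrable by simp
  show "AE w in lborel. norm (check_loss \<tau> (u + h * w) * K w) \<le> norm ((\<bar>u\<bar> + h) * K w + h * (w\<^sup>2 * K w))"
  proof (intro AE_I2)
    fix w :: real
    have "\<bar>w\<bar> \<le> 1 + w\<^sup>2"
      using zero_le_power2[of "\<bar>w\<bar> - 1"] zero_le_power2[of w] unfolding power2_diff by simp
    have "\<bar>check_loss \<tau> (u + h * w)\<bar> \<le> \<bar>u\<bar> + h * \<bar>w\<bar>"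
      using abs_check_loss_le[OF \<tau>, of "u + h * w"] abs_triangle_ineq[of u "h * w"] h
      by (simp add: abs_mult)
    also have "\<dots> \<le> \<bar>u\<bar> + h * (1 + w\<^sup>2)"
      using \<open>\<bar>w\<bar> \<le> 1 + w\<^sup>2\<close> h by simp
    finally have "\<bar>check_loss \<tau> (u + h * w)\<bar> * K w \<le> (\<bar>u\<bar> + h * (1 + w\<^sup>2)) * K w"
      by (rule mult_right_mono) (rule K_nonneg)
    moreover have "0 \<le> (\<bar>u\<bar> + h) * K w + h * (w\<^sup>2 * K w)"
      using K_nonneg[of w] h by simp
    ultimately show "norm (check_loss \<tau> (u + h * w) * K w) \<le> norm ((\<bar>u\<bar> + h) * K w + h * (w\<^sup>2 * K w))"
      using K_nonneg[of w] by (simp add: abs_mult algebra_simps)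
  qed
qed measurable

lemma smoothed_loss_convex:
  assumes "0 \<le> \<eta>" "\<eta> \<le> 1"
  shows "smoothed_loss \<tau> K h ((1 - \<eta>) * u + \<eta> * v)
    \<le> (1 - \<eta>) * smoothed_loss \<tau> K h u + \<eta> * smoothed_loss \<tau> K h v"
proof -
  have "smoothed_loss \<tau> K h ((1 - \<eta>) * u + \<eta> * v)
     \<le> (\<integral>w. (1 - \<eta>) * (check_loss \<tau> (u + h * w) * K w) + \<eta> * (check_loss \<tau> (v + h * w) * K w) \<partial>lborel)"
    unfolding smoothed_loss_eq
  proof (rule integral_mono)
    fix w
    have "(1 - \<eta>) * u + \<eta> * v + h * w = (1 - \<eta>) * (u + h * w) + \<eta> * (v + h * w)"
      by (simp add: algebra_simps)
    then have "check_loss \<tau> ((1 - \<eta>) * u + \<eta> * v + h * w) * K w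
        \<le> ((1 - \<eta>) * check_loss \<tau> (u + h * w) + \<eta> * check_loss \<tau> (v + h * w)) * K w"
      using check_loss_convex[OF \<tau> assms] K_nonneg[of w] by (simp add: mult_right_mono)
    then show "check_loss \<tau> ((1 - \<eta>) * u + \<eta> * v + h * w) * K w
        \<le> (1 - \<eta>) * (check_loss \<tau> (u + h * w) * K w) + \<eta> * (check_loss \<tau> (v + h * w) * K w)"
      by (simp add: algebra_simps)
  qed (use loss_integrable in auto)
  then show ?thesis unfolding smoothed_loss_eq using loss_integrable by simp
qed

text \<open>The average over the kernel of the subgradients of the check loss at
  \<open>e + h * w\<close>. It serves as a subgradient of the smoothed loss at \<open>e\<close>, so
  nothing is differentiated under the integral.\<close>

definition score :: "real \<Rightarrow> real" where
  "score e = \<tau> - (\<integral>w. indicator {..<0} (e + h * w) * K w \<partial>lborel)"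

lemma indicator_integrable: "integrable lborel (\<lambda>w. indicator {..<0} (e + h * w) * K w)"
  by (rule Bochner_Integration.integrable_bound[OF K_integrable])
    (auto simp: indicator_def K_nonneg)

lemma abs_score_le: "\<bar>score e\<bar> \<le> 1"
proof -
  have "0 \<le> (\<integral>w. indicator {..<0} (e + h * w) * K w \<partial>lborel)"
    by (rule integral_nonneg_AE) (auto simp: K_nonneg)
  moreover have "(\<integral>w. indicator {..<0} (e + h * w) * K w \<partial>lborel) \<le> (\<integral>w. K w \<partial>lborel)"
    by (rule integral_mono[OF indicator_integrable K_integrable]) (auto simp: indicator_def K_nonneg)
  ultimately show ?thesis using \<tau> K_integral by (simp add: score_def abs_le_iff)
qed

lemma score_measurable [measurable]: "score \<in> borel_measurable borel"
  unfolding score_def by measurable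

text \<open>The subgradient inequality is integrated against \<open>K\<close>; the shifts in
  \<open>J\<close>, for which the kink is crossed, add their strict gain with weight at least
  \<open>m\<close>.\<close>

lemma smoothed_loss_ge_aux:
  assumes J: "J \<in> sets lborel" "emeasure lborel J < \<infinity>" and m: "0 \<le> m"
    and K: "\<And>w. w \<in> J \<Longrightarrow> m \<le> K w"
    and strict: "\<And>w. w \<in> J \<Longrightarrow> 0 \<le> e + h * w \<and> 2 * (e + h * w) \<le> t \<and> 0 < t \<or> t \<le> 2 * (e + h * w) \<and> e + h * w < 0"
  shows "smoothed_loss \<tau> K h e - t * score e + m * (\<bar>t\<bar> / 2) * measure lborel J
    \<le> smoothed_loss \<tau> K h (e - t)"
proof -
  let ?R = "\<lambda>w. check_loss \<tau> (e + h * w) * K w - t * (\<tau> * K w - indicator {..<0} (e + h * w) * K w)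
    + m * (\<bar>t\<bar> / 2) * indicator J w"
  have Ji: "integrable lborel (indicator J :: real \<Rightarrow> real)" using J by simp
  have "(\<integral>w. ?R w \<partial>lborel) \<le> (\<integral>w. check_loss \<tau> (e - t + h * w) * K w \<partial>lborel)"
  proof (rule integral_mono)
    show "integrable lborel ?R"
      using loss_integrable indicator_integrable K_integrable Ji by simp
    fix w
    have eq: "e - t + h * w = (e + h * w) - t" by simp
    show "?R w \<le> check_loss \<tau> (e - t + h * w) * K w"
    proof (cases "w \<in> J")
      case True
      have "(check_loss \<tau> (e + h * w) - t * (\<tau> - indicator {..<0} (e + h * w)) + \<bar>t\<bar> / 2) * K w
          \<le> check_loss \<tau> (e - t + h * w) * K w"
        unfolding eq by (intro mult_right_mono check_loss_diff_ge_strict strict True K_nonneg)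
      moreover have "m * (\<bar>t\<bar> / 2) \<le> K w * (\<bar>t\<bar> / 2)" using K[OF True] by (rule mult_right_mono) simp
      ultimately show ?thesis using True by (simp add: algebra_simps)
    next
      case False
      have "(check_loss \<tau> (e + h * w) - t * (\<tau> - indicator {..<0} (e + h * w))) * K w
          \<le> check_loss \<tau> (e - t + h * w) * K w"
        unfolding eq by (intro mult_right_mono check_loss_diff_ge K_nonneg)
      then show ?thesis using False by (simp add: algebra_simps)
    qed
  qed (rule loss_integrable)
  moreover have "(\<integral>w. ?R w \<partial>lborel) = smoothed_loss \<tau> K h e - t * score e + m * (\<bar>t\<bar> / 2) * measure lborel J"
    unfolding smoothed_loss_eq score_def
    using loss_integrable indicator_integrable K_integrable Ji K_integral J by simp
  ultimately show ?thesis by (simp add: smoothed_loss_eq)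
qed

text \<open>Local strong convexity by counting shifts: those placing \<open>e + h * w\<close>
  between 0 and \<open>t / 2\<close> form an interval of length
  \<open>\<bar>t\<bar> / (2 * h)\<close>, and each gains at least
  \<open>m * \<bar>t\<bar> / 2\<close>. The window of radius \<open>h / 2\<close> for
  \<open>e\<close> and \<open>t\<close> forces \<open>\<bar>w\<bar> \<le> 1\<close>, the range in
  which \<open>m\<close> bounds the kernel from below.\<close>

lemma smoothed_loss_ge:
  assumes m: "0 \<le> m" "\<And>u. \<bar>u\<bar> \<le> 1 \<Longrightarrow> m \<le> K u"
  shows "smoothed_loss \<tau> K h e - t * score e
      + m / (4 * h) * (t\<^sup>2 * of_bool (\<bar>e\<bar> \<le> h / 2 \<and> \<bar>t\<bar> \<le> h / 2)) \<le> smoothed_loss \<tau> K h (e - t)"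
proof (cases "\<bar>e\<bar> \<le> h / 2 \<and> \<bar>t\<bar> \<le> h / 2 \<and> t \<noteq> 0")
  case False
  \<comment> \<open>With no strict shifts only the subgradient inequality is left, and the quadratic
    term is 0.\<close>
  then show ?thesis using smoothed_loss_ge_aux[of "{}" m e t] m(1) by auto
next
  case True
  have small: "m \<le> K w" if "\<bar>e + h * w\<bar> \<le> h / 2" for w
  proof (rule m(2))
    have "\<bar>h * w\<bar> \<le> h * 1" using that True by linarith
    then show "\<bar>w\<bar> \<le> 1" using h by (simp add: abs_mult)
  qed
  show ?thesis
  proof (cases "0 < t")
    case t: True
    let ?J = "{- e / h .. (t / 2 - e) / h}"
    have J: "0 \<le> e + h * w \<and> 2 * (e + h * w) \<le> t" if "w \<in> ?J" for w
      using that h by (simp add: field_simps)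
    have "smoothed_loss \<tau> K h e - t * score e + m * (\<bar>t\<bar> / 2) * measure lborel ?J
        \<le> smoothed_loss \<tau> K h (e - t)"
    proof (rule smoothed_loss_ge_aux)
      show "m \<le> K w" if "w \<in> ?J" for w using J[OF that] True by (intro small) auto
      show "emeasure lborel ?J < \<infinity>" by (intro emeasure_bounded_finite bounded_closed_interval)
    qed (use J t m in auto)
    moreover have "measure lborel ?J = t / (2 * h)"
      using h t by (subst measure_lborel_Icc) (auto simp: field_simps)
    ultimately show ?thesis using True t h by (simp add: power2_eq_square field_simps)
  next
    case t: False
    \<comment> \<open>The right end is left out because the gain for negative \<open>t\<close>
      requires \<open>e + h * w < 0\<close>.\<close>
    let ?J = "{(t / 2 - e) / h ..< - e / h}"
    have J: "t \<le> 2 * (e + h * w) \<and> e + h * w < 0" if "w \<in> ?J" for w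
      using that h by (simp add: field_simps)
    have "smoothed_loss \<tau> K h e - t * score e + m * (\<bar>t\<bar> / 2) * measure lborel ?J
        \<le> smoothed_loss \<tau> K h (e - t)"
    proof (rule smoothed_loss_ge_aux)
      show "m \<le> K w" if "w \<in> ?J" for w using J[OF that] True by (intro small) auto
      show "emeasure lborel ?J < \<infinity>"
        by (rule emeasure_bounded_finite)
          (rule bounded_subset[OF bounded_closed_interval[of "(t / 2 - e) / h" "- e / h"]], auto)
    qed (use J t True m in auto)
    moreover have L: "measure lborel ?J = - t / (2 * h)"
      using h t by (subst measure_lborel_Ico) (auto simp: field_simps mult_nonneg_nonpos)
    moreover have "m * (\<bar>t\<bar> / 2) * (- t / (2 * h)) = m / (4 * h) * t\<^sup>2"
      using t by (simp add: power2_eq_square)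
    ultimately show ?thesis using True by (simp only: L) simp
  qed
qed

text \<open>The linear term of \<open>a \<mapsto> P(e \<le> a | x)\<close> at 0 cancels because \<open>K\<close> is even; this is why the second
  difference, which is of order \<open>a\<^sup>2\<close>, controls the smoothing bias.\<close>

lemma score_bias:
  assumes M: "prob_space M"
    and e [measurable]: "e \<in> borel_measurable M" and Y: "integrable M Y"
    and quantile: "(\<integral>x. indicator {..0} (e x) * Y x \<partial>M) = \<tau> * (\<integral>x. Y x \<partial>M)"
    and second_diff: "\<And>a. 0 < a \<Longrightarrow> \<bar>\<integral>x. (2 * indicator {..0} (e x) - indicator {..<-a} (e x) - indicator {..<a} (e x)) * Y x \<partial>M\<bar>
        \<le> 2 * l * a\<^sup>2 * (\<integral>x. \<bar>Y x\<bar> \<partial>M)"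
  shows "\<bar>\<integral>x. score (e x) * Y x \<partial>M\<bar> \<le> l * h\<^sup>2 * kernel_moment K 2 * (\<integral>x. \<bar>Y x\<bar> \<partial>M)"
proof -
  interpret M: prob_space M by fact
  interpret P: pair_sigma_finite lborel M by standard
  have [measurable]: "Y \<in> borel_measurable M" using Y by simp
  let ?I = "\<lambda>w x. (indicator {..0} (e x) - indicator {..<0} (e x + h * w)) :: real"
  let ?G = "\<lambda>(w, x). K w * (?I w x * Y x)"
  define m where "m = (\<lambda>w. \<integral>x. ?I w x * Y x \<partial>M)"
  have bi: "integrable M (\<lambda>x. f x * Y x)" if [measurable]: "f \<in> borel_measurable M" and "\<And>x. \<bar>f x\<bar> \<le> b"
    for f :: "_ \<Rightarrow> real" and b
  proof (rule Bochner_Integration.integrable_bound)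
    show "integrable M (\<lambda>x. b * Y x)" using Y by simp
    show "AE x in M. norm (f x * Y x) \<le> norm (b * Y x)"
    proof (intro AE_I2)
      fix x
      have "\<bar>f x\<bar> \<le> \<bar>b\<bar>" using that(2) abs_ge_self order_trans by blast
      then show "norm (f x * Y x) \<le> norm (b * Y x)" by (simp add: abs_mult mult_right_mono)
    qed
  qed measurable
  have Ib: "\<bar>?I w x\<bar> \<le> 1" for w x by (auto simp: indicator_def)
  have Im: "(\<lambda>x. ?I w x) \<in> borel_measurable M" for w by measurable
  have Gi: "integrable (lborel \<Otimes>\<^sub>M M) ?G"
  proof (rule P.Fubini_integrable)
    show "?G \<in> borel_measurable (lborel \<Otimes>\<^sub>M M)" by measurable
    show "AE w in lborel. integrable M (\<lambda>x. ?G (w, x))"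
      using bi[OF Im Ib] by simp
    show "integrable lborel (\<lambda>w. \<integral>x. norm (?G (w, x)) \<partial>M)"
    proof (rule Bochner_Integration.integrable_bound)
      show "integrable lborel (\<lambda>w. (\<integral>x. \<bar>Y x\<bar> \<partial>M) * K w)" using K_integrable by simp
      show "AE w in lborel. norm (\<integral>x. norm (?G (w, x)) \<partial>M) \<le> norm ((\<integral>x. \<bar>Y x\<bar> \<partial>M) * K w)"
      proof (intro AE_I2)
        fix w
        have "(\<integral>x. norm (?G (w, x)) \<partial>M) \<le> (\<integral>x. K w * \<bar>Y x\<bar> \<partial>M)"
        proof (rule integral_mono)
          show "norm (?G (w, x)) \<le> K w * \<bar>Y x\<bar>" for x
            using Ib[of x w] K_nonneg[of w] by (simp add: abs_mult mult_left_mono mult_left_le_one_le)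
        qed (use bi[OF Im Ib] Y in auto)
        moreover have "0 \<le> (\<integral>x. norm (?G (w, x)) \<partial>M)" by simp
        ultimately show "norm (\<integral>x. norm (?G (w, x)) \<partial>M) \<le> norm ((\<integral>x. \<bar>Y x\<bar> \<partial>M) * K w)"
          using K_nonneg[of w] by (simp add: abs_mult mult.commute)
      qed
    qed measurable
  qed
  have mi: "integrable lborel (\<lambda>w. K w * m w)"
    using P.integrable_fst'[OF Gi] by (simp add: m_def)
  \<comment> \<open>The quantile condition trades the constant \<open>\<tau>\<close> for the
    indicator of \<open>e x \<le> 0\<close>, so the bias becomes a kernel average of differences of
    indicators.\<close>
  have "(\<integral>x. score (e x) * Y x \<partial>M) = (\<integral>x. indicator {..0} (e x) * Y x - (\<integral>w. indicator {..<0} (e x + h * w) * K w \<partial>lborel) * Y x \<partial>M)"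
  proof -
    have s: "(\<lambda>x. \<integral>w. indicator {..<0} (e x + h * w) * K w \<partial>lborel) = (\<lambda>x. \<tau> - score (e x))"
      by (simp add: score_def)
    have si: "integrable M (\<lambda>x. score (e x) * Y x)" using abs_score_le by (intro bi[of _ 1]) auto
    have ii: "integrable M (\<lambda>x. indicator {..0} (e x) * Y x)" by (intro bi[of _ 1]) (auto simp: indicator_def)
    show ?thesis
      unfolding s[THEN fun_cong] using quantile si ii Y by (simp add: left_diff_distrib)
  qed
  also have "\<dots> = (\<integral>x. (\<integral>w. ?G (w, x) \<partial>lborel) \<partial>M)"
  proof (rule Bochner_Integration.integral_cong[OF refl])
    fix x
    have "(\<integral>w. ?G (w, x) \<partial>lborel) = (\<integral>w. (indicator {..0} (e x) * Y x) * K w - (indicator {..<0} (e x + h * w) * K w) * Y x \<partial>lborel)"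
      by (simp add: algebra_simps)
    also have "\<dots> = indicator {..0} (e x) * Y x - (\<integral>w. indicator {..<0} (e x + h * w) * K w \<partial>lborel) * Y x"
      using K_integrable indicator_integrable K_integral by (subst Bochner_Integration.integral_diff) auto
    finally show "indicator {..0} (e x) * Y x - (\<integral>w. indicator {..<0} (e x + h * w) * K w \<partial>lborel) * Y x
      = (\<integral>w. ?G (w, x) \<partial>lborel)" ..
  qed
  also have "\<dots> = (\<integral>w. (\<integral>x. ?G (w, x) \<partial>M) \<partial>lborel)"
    using P.Fubini_integral[of "\<lambda>w x. ?G (w, x)"] Gi by simp
  also have "\<dots> = (\<integral>w. K w * m w \<partial>lborel)" by (simp add: m_def)
  finally have E: "(\<integral>x. score (e x) * Y x \<partial>M) = (\<integral>w. K w * m w \<partial>lborel)" .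
  \<comment> \<open>Twice the bias is thereby the average of \<open>m w + m (- w)\<close>, which is
    the second difference of \<open>second_diff\<close> at \<open>a = \<bar>h * w\<bar>\<close>. The
    point \<open>w = 0\<close>, where \<open>a\<close> would vanish, is a null set.\<close>
  have E': "(\<integral>w. K w * m w \<partial>lborel) = (\<integral>w. K w * m (- w) \<partial>lborel)"
    using lborel_integral_real_affine[of "-1" "\<lambda>w. K w * m w" 0] K_even by simp
  have mi': "integrable lborel (\<lambda>w. K w * m (- w))"
    using lborel_integrable_real_affine[OF mi, of "-1" 0] K_even by simp
  have bound: "\<bar>m w + m (- w)\<bar> \<le> 2 * l * (h * w)\<^sup>2 * (\<integral>x. \<bar>Y x\<bar> \<partial>M)" if "w \<noteq> 0" for w
  proof -
    have *: "m w + m (- w) = (\<integral>x. (2 * indicator {..0} (e x) - indicator {..<-a} (e x) - indicator {..<a} (e x)) * Y x \<partial>M)"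
      if "a = h * w \<or> a = - h * w" for a
    proof -
      have "m w + m (- w) = (\<integral>x. ?I w x * Y x + ?I (- w) x * Y x \<partial>M)"
        unfolding m_def by (rule Bochner_Integration.integral_add[symmetric]) (rule bi[OF Im Ib])+
      also have "\<dots> = (\<integral>x. (2 * indicator {..0} (e x) - indicator {..<-a} (e x) - indicator {..<a} (e x)) * Y x \<partial>M)"
        using that by (intro Bochner_Integration.integral_cong refl) (auto simp: indicator_def)
      finally show ?thesis .
    qed
    have "0 < \<bar>h * w\<bar>" using that h by simp
    from second_diff[OF this] show ?thesis
      using *[of "\<bar>h * w\<bar>"] h by (auto simp: abs_if split: if_splits)
  qed
  have "\<bar>2 * (\<integral>x. score (e x) * Y x \<partial>M)\<bar> = \<bar>\<integral>w. K w * m w + K w * m (- w) \<partial>lborel\<bar>"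
    using mi mi' E E' by simp
  also have "\<dots> \<le> (\<integral>w. \<bar>K w * m w + K w * m (- w)\<bar> \<partial>lborel)" by (rule integral_abs_bound)
  also have "\<dots> \<le> (\<integral>w. 2 * l * h\<^sup>2 * (\<integral>x. \<bar>Y x\<bar> \<partial>M) * (w\<^sup>2 * K w) \<partial>lborel)"
  proof (rule integral_mono_AE)
    have "AE w in lborel. w \<noteq> (0::real)" by (rule AE_lborel_singleton)
    then show "AE w in lborel. \<bar>K w * m w + K w * m (- w)\<bar> \<le> 2 * l * h\<^sup>2 * (\<integral>x. \<bar>Y x\<bar> \<partial>M) * (w\<^sup>2 * K w)"
    proof eventually_elim
      case (elim w)
      have "\<bar>K w * m w + K w * m (- w)\<bar> = K w * \<bar>m w + m (- w)\<bar>"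
        using K_nonneg[of w] by (simp add: abs_mult distrib_left[symmetric])
      also have "\<dots> \<le> K w * (2 * l * (h * w)\<^sup>2 * (\<integral>x. \<bar>Y x\<bar> \<partial>M))"
        by (intro mult_left_mono bound elim K_nonneg)
      finally show ?case by (simp add: power_mult_distrib mult_ac)
    qed
  qed (use mi mi' K_sq_integrable in auto)
  also have "\<dots> = 2 * (l * h\<^sup>2 * kernel_moment K 2 * (\<integral>x. \<bar>Y x\<bar> \<partial>M))"
    by (simp add: kernel_moment_def)
  finally show ?thesis by (simp add: abs_mult)
qed

lemma kernel_moment_nonneg: "0 \<le> kernel_moment K 2"
  unfolding kernel_moment_def by (rule integral_nonneg_AE) (auto simp: K_nonneg)

end

section \<open>The smallest eigenvalue as a lower bound of the quadratic form\<close>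

lemma scalar_prod_eq_dot: "d \<in> carrier_vec p \<Longrightarrow> scalar_prod v d = dot p (($) v) (($) d)"
  by (auto simp: scalar_prod_def dot_def lessThan_atLeast0)

text \<open>The squared Frobenius norm works by Cauchy-Schwarz in each row; adding 1 makes the
  constant positive also for the zero matrix.\<close>

lemma mult_mat_vec_bounded:
  fixes B :: "real mat"
  assumes "B \<in> carrier_mat p p"
  shows "\<exists>c>0. \<forall>w\<in>carrier_vec p. scalar_prod (B *\<^sub>v w) (B *\<^sub>v w) \<le> c * scalar_prod w w"
proof (intro exI conjI ballI)
  let ?c = "1 + (\<Sum>i<p. \<Sum>j<p. (B $$ (i, j))\<^sup>2)"
  have nn: "0 \<le> (\<Sum>i<p. \<Sum>j<p. (B $$ (i, j))\<^sup>2)" by (intro sum_nonneg) auto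
  then show "0 < ?c" by linarith
  fix w :: "real Matrix.vec" assume w: "w \<in> carrier_vec p"
  have ww: "scalar_prod w w = (\<Sum>j<p. (w $ j)\<^sup>2)"
    using w by (auto simp: scalar_prod_eq_dot dot_def power2_eq_square)
  have Bw: "(B *\<^sub>v w) $ i = (\<Sum>j<p. B $$ (i, j) * w $ j)" if "i < p" for i
    using that assms w by (auto simp: scalar_prod_def lessThan_atLeast0)
  have "scalar_prod (B *\<^sub>v w) (B *\<^sub>v w) = (\<Sum>i<p. ((B *\<^sub>v w) $ i)\<^sup>2)"
    using mult_mat_vec_carrier[OF assms w]
    by (subst scalar_prod_eq_dot[where p = p]) (auto simp: dot_def power2_eq_square)
  also have "\<dots> = (\<Sum>i<p. (\<Sum>j<p. B $$ (i, j) * w $ j)\<^sup>2)" using Bw by simp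
  also have "\<dots> \<le> (\<Sum>i<p. (\<Sum>j<p. (B $$ (i, j))\<^sup>2) * (\<Sum>j<p. (w $ j)\<^sup>2))"
    by (intro sum_mono Cauchy_Schwarz_ineq_sum)
  also have "\<dots> = (\<Sum>i<p. \<Sum>j<p. (B $$ (i, j))\<^sup>2) * scalar_prod w w"
    by (simp add: ww sum_distrib_right)
  also have "\<dots> \<le> ?c * scalar_prod w w"
    by (intro mult_right_mono) (auto simp: ww sum_nonneg)
  finally show "scalar_prod (B *\<^sub>v w) (B *\<^sub>v w) \<le> ?c * scalar_prod w w" .
qed

text \<open>Let \<open>m\<close> be the infimum of the Rayleigh quotient and \<open>P = A - m I\<close>, which is positive
  semidefinite. If \<open>P\<close> were invertible, then \<open>v \<bullet> P v\<close> would dominate \<open>\<parallel>P v\<parallel>\<^sup>2\<close> and hence \<open>\<parallel>v\<parallel>\<^sup>2\<close> up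
  to constants, against the choice of \<open>m\<close>. So \<open>m\<close> is an eigenvalue.\<close>

lemma smallest_eigenvalue_le_quadratic_form:
  assumes A: "pos_def_mat p A" and g: "is_smallest_eigenvalue A g" and v: "v \<in> carrier_vec p"
  shows "g * scalar_prod v v \<le> scalar_prod v (A *\<^sub>v v)"
proof (cases "v = 0\<^sub>v p")
  case True
  then have "A *\<^sub>v v \<in> carrier_vec p"
    using A v by (intro mult_mat_vec_carrier[of _ p p]) (auto simp: pos_def_mat_def)
  then show ?thesis using True by simp
next
  case v0: False
  have Ac [simp]: "A \<in> carrier_mat p p" and At: "transpose_mat A = A"
    and pos: "\<And>v. v \<in> carrier_vec p \<Longrightarrow> v \<noteq> 0\<^sub>v p \<Longrightarrow> 0 < scalar_prod v (A *\<^sub>v v)"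
    using A by (auto simp: pos_def_mat_def)
  have vv: "0 < scalar_prod v v" if that_vec: "v \<in> carrier_vec p" and that_ne: "v \<noteq> 0\<^sub>v p" for v :: "real Matrix.vec"
  proof -
    obtain i where i: "i < p" "v $ i \<noteq> 0"
    proof (rule ccontr)
      assume "\<not> thesis"
      then have "\<forall>i<p. v $ i = 0" using that by blast
      then have "v = 0\<^sub>v p" using that_vec by (intro eq_vecI) auto
      then show False using that_ne by blast
    qed
    have "0 < (\<Sum>j<p. v $ j * v $ j)"
      using i by (intro sum_pos2[of _ i]) (auto simp: zero_less_mult_iff linorder_neq_iff)
    then show ?thesis using that_vec by (simp add: scalar_prod_eq_dot dot_def)
  qed
  define S where "S = (\<lambda>v. scalar_prod v (A *\<^sub>v v) / scalar_prod v v) ` {v \<in> carrier_vec p. v \<noteq> 0\<^sub>v p}"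
  define m where "m = Inf S"
  have Sne: "S \<noteq> {}" using v v0 by (auto simp: S_def)
  have Sb: "bdd_below S"
    unfolding S_def using vv pos by (intro bdd_belowI2[of _ 0]) (auto intro!: divide_nonneg_nonneg less_imp_le)
  have m_le: "m * scalar_prod v v \<le> scalar_prod v (A *\<^sub>v v)" if "v \<in> carrier_vec p" for v
  proof (cases "v = 0\<^sub>v p")
    case False
    then have "m \<le> scalar_prod v (A *\<^sub>v v) / scalar_prod v v"
      unfolding m_def using that Sb by (intro cInf_lower) (auto simp: S_def)
    then show ?thesis using vv[OF that False] by (simp add: field_simps)
  next
    case True
    then show ?thesis using mult_mat_vec_carrier[OF Ac that] by simp
  qed
  have "g \<le> m"
  proof (rule ccontr)
    assume "\<not> g \<le> m"
    then have "\<not> eigenvalue A m" using g by (auto simp: is_smallest_eigenvalue_def)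
    define P where "P = char_matrix A m"
    have P [simp]: "P \<in> carrier_mat p p" by (simp add: P_def)
    have Pt: "transpose_mat P = P"
    proof (rule eq_matI)
      show "transpose_mat P $$ (i, j) = P $$ (i, j)" if "i < dim_row P" "j < dim_col P" for i j
        using that arg_cong[OF At, of "\<lambda>B. B $$ (i, j)"] carrier_matD[OF Ac]
        by (auto simp: P_def char_matrix_def)
    qed (use carrier_matD[OF P] in auto)
    have Pv: "P *\<^sub>v v = A *\<^sub>v v - m \<cdot>\<^sub>v v" if "v \<in> carrier_vec p" for v
    proof (rule eq_vecI)
      fix i assume "i < dim_vec (A *\<^sub>v v - m \<cdot>\<^sub>v v)"
      then have i: "i < p" using that by simp
      have "(P *\<^sub>v v) $ i = (\<Sum>j<p. (A $$ (i, j) - (if i = j then m else 0)) * v $ j)"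
        using i that carrier_matD[OF Ac] carrier_matD[OF P]
        by (auto simp: scalar_prod_def lessThan_atLeast0 P_def char_matrix_def intro!: sum.cong)
      also have "\<dots> = (\<Sum>j<p. A $$ (i, j) * v $ j) - (\<Sum>j<p. if i = j then m * v $ j else 0)"
        by (subst sum_subtractf[symmetric]) (auto intro!: sum.cong simp: algebra_simps)
      also have "\<dots> = (A *\<^sub>v v - m \<cdot>\<^sub>v v) $ i"
        using i that carrier_matD[OF Ac] by (auto simp: scalar_prod_def lessThan_atLeast0)
      finally show "(P *\<^sub>v v) $ i = (A *\<^sub>v v - m \<cdot>\<^sub>v v) $ i" .
    qed (use that carrier_matD[OF P] in auto)
    have qP: "scalar_prod v (P *\<^sub>v v) = scalar_prod v (A *\<^sub>v v) - m * scalar_prod v v" if "v \<in> carrier_vec p" for v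
      using that mult_mat_vec_carrier[OF Ac that] unfolding Pv[OF that] by (subst scalar_prod_minus_distrib[where n = p]) auto
    have psd: "0 \<le> scalar_prod v (P *\<^sub>v v)" if "v \<in> carrier_vec p" for v
      using m_le[OF that] qP[OF that] by simp
    have "det P \<noteq> 0" using \<open>\<not> eigenvalue A m\<close> by (simp add: eigenvalue_det[OF Ac] P_def)
    from det_non_zero_imp_unit[OF P this, of undefined]
    obtain Q where Q [simp]: "Q \<in> carrier_mat p p" and QP: "Q * P = 1\<^sub>m p"
      by (auto simp: Units_def ring_mat_def)
    obtain c where c: "0 < c" "\<And>w. w \<in> carrier_vec p \<Longrightarrow> scalar_prod (P *\<^sub>v w) (P *\<^sub>v w) \<le> c * scalar_prod w w"
      using mult_mat_vec_bounded[OF P] by blast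
    obtain c' where c': "0 < c'" "\<And>w. w \<in> carrier_vec p \<Longrightarrow> scalar_prod (Q *\<^sub>v w) (Q *\<^sub>v w) \<le> c' * scalar_prod w w"
      using mult_mat_vec_bounded[OF Q] by blast
    define k where "k = 1 + c"
    have k: "0 < k" using c(1) by (simp add: k_def)
    \<comment> \<open>Expanding the square of \<open>w - P w\<close> bounds twice the form by
      \<open>(1 + c)\<close> times the squared norm; one copy is dropped because the form is
      nonnegative.\<close>
    have upper: "scalar_prod w (P *\<^sub>v w) \<le> k * scalar_prod w w" if w: "w \<in> carrier_vec p" for w
    proof -
      define x where "x = P *\<^sub>v w"
      have x: "x \<in> carrier_vec p" using mult_mat_vec_carrier[OF P w] by (simp add: x_def)
      have "0 \<le> (\<Sum>j<p. (w $ j - x $ j)\<^sup>2)" by (intro sum_nonneg) auto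
      also have "\<dots> = (\<Sum>j<p. w $ j * w $ j - 2 * (w $ j * x $ j) + x $ j * x $ j)"
        by (intro sum.cong) (auto simp: power2_eq_square algebra_simps)
      also have "\<dots> = scalar_prod w w - 2 * scalar_prod w x + scalar_prod x x"
        using w x by (simp add: scalar_prod_eq_dot[where p = p] dot_def sum.distrib sum_subtractf sum_distrib_left)
      finally have "2 * scalar_prod w (P *\<^sub>v w) \<le> k * scalar_prod w w"
        using c(2)[OF w] by (simp add: k_def x_def algebra_simps)
      moreover have "0 \<le> scalar_prod w (P *\<^sub>v w)" by (rule psd[OF w])
      ultimately show ?thesis by linarith
    qed
    have lower: "scalar_prod w w \<le> c' * k * scalar_prod w (P *\<^sub>v w)" if w: "w \<in> carrier_vec p" for w
    proof -
      define u where "u = P *\<^sub>v w"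
      have u: "u \<in> carrier_vec p" using w by (simp add: u_def mult_mat_vec_carrier[OF P])
      have Pu: "P *\<^sub>v u \<in> carrier_vec p" using u by (simp add: mult_mat_vec_carrier[OF P])
      \<comment> \<open>A gradient step of length \<open>1 / k\<close>: nonnegativity of the form at
        \<open>w - s P w\<close>, together with \<open>upper\<close>, bounds the squared norm of
        \<open>P w\<close> by \<open>k\<close> times the form at \<open>w\<close>.\<close>
      define s where "s = 1 / k"
      let ?z = "w - s \<cdot>\<^sub>v u"
      have z: "?z \<in> carrier_vec p" using w u by simp
      have wPu: "scalar_prod w (P *\<^sub>v u) = scalar_prod u u"
        using transpose_vec_mult_scalar[OF P u w] by (simp add: Pt u_def)
      have Pz: "P *\<^sub>v ?z = u - s \<cdot>\<^sub>v (P *\<^sub>v u)"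
        using w u by (simp add: mult_minus_distrib_mat_vec[OF P] mult_mat_vec[OF P] u_def)
      have "0 \<le> scalar_prod ?z (P *\<^sub>v ?z)" by (rule psd[OF z])
      also have "\<dots> = scalar_prod w u - s * scalar_prod w (P *\<^sub>v u) - s * scalar_prod u u + s * s * scalar_prod u (P *\<^sub>v u)"
      proof -
        define y where "y = P *\<^sub>v u"
        have y: "y \<in> carrier_vec p" using Pu by (simp add: y_def)
        have "scalar_prod ?z (u - s \<cdot>\<^sub>v y) = (\<Sum>j<p. (w $ j - s * u $ j) * (u $ j - s * y $ j))"
          using w u y by (subst scalar_prod_eq_dot[where p = p]) (auto simp: dot_def)
        also have "\<dots> = (\<Sum>j<p. w $ j * u $ j - s * (w $ j * y $ j) - s * (u $ j * u $ j) + s * s * (u $ j * y $ j))"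
          by (intro sum.cong) (auto simp: algebra_simps)
        also have "\<dots> = scalar_prod w u - s * scalar_prod w y - s * scalar_prod u u + s * s * scalar_prod u y"
          using u y by (simp add: scalar_prod_eq_dot[where p = p] dot_def sum.distrib sum_subtractf sum_distrib_left)
        finally show ?thesis unfolding Pz y_def .
      qed
      also have "\<dots> \<le> scalar_prod w u - 2 * s * scalar_prod u u + s * s * (k * scalar_prod u u)"
        using upper[OF u] by (simp add: wPu mult_left_mono)
      also have "s * s * (k * scalar_prod u u) = s * scalar_prod u u"
        using k by (simp add: s_def field_simps)
      finally have "scalar_prod u u \<le> k * scalar_prod w u"
        using k by (simp add: s_def field_simps)
      moreover have "w = Q *\<^sub>v u"
        using w by (simp add: u_def QP flip: assoc_mult_mat_vec[OF Q P w])
      then have "scalar_prod w w \<le> c' * scalar_prod u u" using c'(2)[OF u] by simp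
      ultimately have "scalar_prod w w \<le> c' * (k * scalar_prod w u)"
        using c'(1) by (meson mult_left_mono less_imp_le order_trans)
      then show ?thesis by (simp add: u_def mult.assoc)
    qed
    \<comment> \<open>The lower bound on the form of \<open>P\<close> raises every Rayleigh quotient
      above the infimum by a fixed amount.\<close>
    have "m + 1 / (c' * k) \<le> m"
      unfolding m_def
    proof (rule cInf_greatest[OF Sne])
      fix y assume "y \<in> S"
      then obtain w where w: "w \<in> carrier_vec p" "w \<noteq> 0\<^sub>v p" and y: "y = scalar_prod w (A *\<^sub>v w) / scalar_prod w w"
        by (auto simp: S_def)
      have "scalar_prod w w \<le> c' * k * (scalar_prod w (A *\<^sub>v w) - m * scalar_prod w w)"
        using lower[OF w(1)] qP[OF w(1)] by simp
      then have "(1 / (c' * k)) * scalar_prod w w \<le> scalar_prod w (A *\<^sub>v w) - m * scalar_prod w w"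
        using c'(1) k by (simp add: field_simps)
      then have "(m + 1 / (c' * k)) * scalar_prod w w \<le> scalar_prod w (A *\<^sub>v w)"
        by (simp add: algebra_simps)
      then show "Inf S + 1 / (c' * k) \<le> y"
        using vv[OF w] unfolding y m_def by (simp add: field_simps)
    qed
    then show False using c'(1) k by (simp add: field_simps)
  qed
  then have "g * scalar_prod v v \<le> m * scalar_prod v v"
    using vv[OF v v0] by (intro mult_right_mono) auto
  also have "\<dots> \<le> scalar_prod v (A *\<^sub>v v)" by (rule m_le[OF v])
  finally show ?thesis .
qed

section \<open>The quantile regression model\<close>

lemma lipschitz_set_integral:
  fixes f :: "real \<Rightarrow> real"
  assumes lip: "\<And>u v. \<bar>f u - f v\<bar> \<le> l * \<bar>u - v\<bar>"
    and B: "B \<in> sets borel" "B \<subseteq> {- a..a}"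
  shows "\<bar>(LINT u:B|lborel. f u) - measure lborel B * f 0\<bar> \<le> measure lborel B * (l * a)"
proof -
  have l: "0 \<le> l" using lip[of 1 0] by (simp add: order_trans[OF abs_ge_zero])
  have "continuous_on UNIV f"
    using lip l by (intro lipschitz_on_continuous_on[of l] lipschitz_onI) (auto simp: dist_real_def)
  then have "set_integrable lborel {- a..a} f"
    unfolding set_integrable_def
    by (intro borel_integrable_compact) (auto intro: continuous_on_subset)
  then have fi: "set_integrable lborel B f"
    using B by (auto intro: set_integrable_subset)
  have fin: "emeasure lborel B < \<infinity>"
    using B(2) bounded_closed_interval bounded_subset by (intro emeasure_bounded_finite) blast
  have ci: "set_integrable lborel B (\<lambda>_. c)" for c :: real
    using B fin by (simp add: set_integrable_def)
  have cv: "(LINT u:B|lborel. c) = measure lborel B * c" for c :: real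
    using B fin by (simp add: set_lebesgue_integral_def)
  have "\<bar>(LINT u:B|lborel. f u) - measure lborel B * f 0\<bar> = \<bar>LINT u:B|lborel. f u - f 0\<bar>"
    using fi ci by (simp add: set_integral_diff cv)
  also have "\<dots> \<le> (LINT u:B|lborel. \<bar>f u - f 0\<bar>)"
    using set_integral_norm_bound[of lborel B "\<lambda>u. f u - f 0"] fi ci by simp
  also have "\<dots> \<le> (LINT u:B|lborel. l * a)"
  proof (rule set_integral_mono)
    show "set_integrable lborel B (\<lambda>u. \<bar>f u - f 0\<bar>)"
      using set_integrable_abs[OF set_integral_diff(1)[OF fi ci]] .
    show "\<bar>f u - f 0\<bar> \<le> l * a" if "u \<in> B" for u
    proof -
      have "\<bar>u - 0\<bar> \<le> a" using subsetD[OF B(2) that] by (auto simp: abs_le_iff)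
      then have "l * \<bar>u - 0\<bar> \<le> l * a" using l by (rule mult_left_mono)
      with lip[of u 0] show ?thesis by simp
    qed
  qed (rule ci)
  also have "\<dots> = measure lborel B * (l * a)" by (rule cv)
  finally show ?thesis .
qed

locale quantile_regression =
  fixes p :: nat and \<tau> :: real and D :: "obs measure" and \<beta> :: "real Matrix.vec"
    and f\<^sub>l f\<^sub>u l\<^sub>0 \<upsilon> \<gamma> :: real
  assumes p: "1 \<le> p" and model: "quantile_model p \<tau> D \<beta>"
    and B1: "cond_B1 p D \<beta> f\<^sub>l f\<^sub>u l\<^sub>0" and B3: "cond_B3 p D \<upsilon>"
    and eig: "is_smallest_eigenvalue (Sigma_mat p D) \<gamma>" "0 < \<gamma>"
begin

sublocale D: prob_space D
  using model by (simp add: quantile_model_def)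

abbreviation X :: "obs \<Rightarrow> nat \<Rightarrow> real" where
  "X w \<equiv> ($) (fst w)"

definition q :: "(nat \<Rightarrow> real) \<Rightarrow> real" where
  "q d = (\<integral>w. (dot p (X w) d)\<^sup>2 \<partial>D)"

lemma sets_D [measurable_cong]: "sets D = sets (vec_borel p \<Otimes>\<^sub>M borel)"
  using model by (simp add: quantile_model_def)

lemma space_vec_borel: "space (vec_borel p) = carrier_vec p"
  by (simp add: vec_borel_def)

lemma space_D: "space D = carrier_vec p \<times> UNIV"
  using sets_eq_imp_space_eq[OF sets_D] by (simp add: space_pair_measure space_vec_borel)

lemma index_measurable: "j < p \<Longrightarrow> (\<lambda>v. v $ j) \<in> borel_measurable (vec_borel p)"
proof -
  assume j: "j < p"
  have "(\<lambda>v. \<lambda>j\<in>{..<p}. v $ j) \<in> vec_borel p \<rightarrow>\<^sub>M PiM {..<p} (\<lambda>_. borel)"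
    unfolding vec_borel_def by (rule measurable_vimage_algebra1) (auto simp: space_PiM)
  from measurable_compose[OF this measurable_component_singleton[of j]] j
  show ?thesis by simp
qed

lemma fst_measurable: "fst \<in> D \<rightarrow>\<^sub>M vec_borel p"
  using measurable_fst measurable_cong_sets[OF sets_D refl] by blast

lemma X_measurable [measurable]: "j < p \<Longrightarrow> (\<lambda>w. X w j) \<in> borel_measurable D"
  using measurable_compose[OF fst_measurable index_measurable] .

lemma dot_index_measurable: "(\<lambda>v. dot p (($) v) d) \<in> borel_measurable (vec_borel p)"
  by (rule dot_measurable) (rule index_measurable)

lemma dot_X_measurable [measurable]: "(\<lambda>w. dot p (X w) d) \<in> borel_measurable D"
  by (rule dot_measurable) (rule X_measurable)

lemma beta_carrier: "\<beta> \<in> carrier_vec p"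
  using model by (simp add: quantile_model_def)

lemma err_measurable [measurable]: "err \<beta> \<in> borel_measurable D"
proof -
  have "snd \<in> D \<rightarrow>\<^sub>M borel"
    using measurable_snd measurable_cong_sets[OF sets_D refl] by blast
  then have "(\<lambda>w. snd w - dot p (X w) (($) \<beta>)) \<in> borel_measurable D" by measurable
  then show ?thesis
    unfolding err_def[abs_def] by (simp add: scalar_prod_eq_dot[OF beta_carrier])
qed

lemma X_X_integrable: "j < p \<Longrightarrow> k < p \<Longrightarrow> integrable D (\<lambda>w. X w j * X w k)"
  using model by (simp add: quantile_model_def)

lemma X_0: "AE w in D. X w 0 = 1"
  using model by (simp add: quantile_model_def)

text \<open>The intercept is 1 almost everywhere, so first moments are among the second
  moments.\<close>

lemma X_integrable: "j < p \<Longrightarrow> integrable D (\<lambda>w. X w j)"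
  using p by (intro integrable_cong_AE_imp[OF X_X_integrable[of 0 j]]) (auto intro: AE_mp[OF X_0])

lemma dot_integrable: "integrable D (\<lambda>w. dot p (X w) d)"
  unfolding dot_def using X_integrable by (intro Bochner_Integration.integrable_sum) auto

lemma dot_sq: "(dot p u d)\<^sup>2 = (\<Sum>j<p. \<Sum>k<p. d j * d k * (u j * u k))"
  unfolding dot_def power2_eq_square sum_product by (intro sum.cong) auto

lemma dot_sq_integrable: "integrable D (\<lambda>w. (dot p (X w) d)\<^sup>2)"
  unfolding dot_sq using X_X_integrable
  by (intro Bochner_Integration.integrable_sum integrable_mult_right) auto

lemma q_nonneg: "0 \<le> q d"
  unfolding q_def by simp

lemma q_scale: "q (\<lambda>j. c * d j) = c\<^sup>2 * q d"
  unfolding q_def dot_scale_right by (simp add: power_mult_distrib)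

lemma Sigma_carrier: "Sigma_mat p D \<in> carrier_mat p p"
  by (simp add: Sigma_mat_def)

lemma q_eq: "q d = scalar_prod (vec p d) (Sigma_mat p D *\<^sub>v vec p d)"
proof -
  have "q d = (\<Sum>j<p. \<Sum>k<p. d j * d k * (\<integral>w. X w j * X w k \<partial>D))"
    unfolding q_def dot_sq using X_X_integrable
    by (subst Bochner_Integration.integral_sum)
      (auto intro!: Bochner_Integration.integrable_sum integrable_mult_right)
  also have "\<dots> = (\<Sum>j<p. d j * (Sigma_mat p D *\<^sub>v vec p d) $ j)"
    unfolding sum_distrib_left
    by (intro sum.cong refl)
      (auto simp: Sigma_mat_def scalar_prod_def lessThan_atLeast0 sum_distrib_left mult_ac)
  also have "\<dots> = scalar_prod (vec p d) (Sigma_mat p D *\<^sub>v vec p d)"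
    using mult_mat_vec_carrier[OF Sigma_carrier vec_carrier]
    by (subst scalar_prod_eq_dot[where p = p]) (auto simp: dot_def)
  finally show ?thesis .
qed

lemma q_ge: "\<gamma> * (\<Sum>j<p. (d j)\<^sup>2) \<le> q d"
proof -
  have "\<gamma> * scalar_prod (vec p d) (vec p d) \<le> q d"
    unfolding q_eq using B3 eig by (intro smallest_eigenvalue_le_quadratic_form) (auto simp: cond_B3_def)
  then show ?thesis by (simp add: scalar_prod_eq_dot[where p = p] dot_def power2_eq_square)
qed

text \<open>The tail condition concerns \<open>z = W x\<close>. Taking
  \<open>u = W \<Sigma> d\<close>, the square root of \<open>\<Sigma>\<close> applied to
  \<open>d\<close>, gives \<open>W u = d\<close>; hence \<open>z \<bullet> u = x \<bullet> d\<close>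
  by symmetry of \<open>W\<close>, and the squared norm of \<open>u\<close> is
  \<open>q d\<close>.\<close>

lemma tail:
  assumes d: "0 < q d" and t: "0 \<le> t"
  shows "D.prob {w \<in> space D. \<upsilon> * sqrt (q d) * t \<le> \<bar>dot p (X w) d\<bar>} \<le> 2 * exp (- t)"
proof -
  let ?S = "Sigma_mat p D" and ?d = "vec p d"
  obtain W where W: "is_inv_sqrt_mat p ?S W"
    and Wt: "\<And>u t. u \<in> carrier_vec p \<Longrightarrow> 0 \<le> t \<Longrightarrow> u \<noteq> 0\<^sub>v p \<Longrightarrow>
      measure D {w \<in> space D. \<bar>scalar_prod (W *\<^sub>v fst w) u\<bar> \<ge> \<upsilon> * l2_norm u * t} \<le> 2 * exp (- t)"
    using B3 by (auto simp: cond_B3_def)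
  have Wc: "W \<in> carrier_mat p p" and Wsym: "transpose_mat W = W" and WWS: "W * W * ?S = 1\<^sub>m p"
    using W by (auto simp: is_inv_sqrt_mat_def pos_def_mat_def)
  note carrier = mult_mat_vec_carrier[OF Wc] mult_mat_vec_carrier[OF Sigma_carrier]
  define u where "u = W *\<^sub>v (?S *\<^sub>v ?d)"
  have Sd: "?S *\<^sub>v ?d \<in> carrier_vec p" by (intro carrier) simp
  have u: "u \<in> carrier_vec p" unfolding u_def by (intro carrier) simp
  have "?d = (W * W * ?S) *\<^sub>v ?d" by (simp add: WWS)
  also have "\<dots> = (W * W) *\<^sub>v (?S *\<^sub>v ?d)"
    by (rule assoc_mult_mat_vec[OF mult_carrier_mat[OF Wc Wc] Sigma_carrier]) simp
  also have "\<dots> = W *\<^sub>v u" unfolding u_def by (rule assoc_mult_mat_vec[OF Wc Wc Sd])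
  finally have Wu: "W *\<^sub>v u = ?d" ..
  have swap: "scalar_prod (W *\<^sub>v v) u = dot p (($) v) d" if "v \<in> carrier_vec p" for v
  proof -
    have "scalar_prod (W *\<^sub>v v) u = scalar_prod v (W *\<^sub>v u)"
      using transpose_vec_mult_scalar[OF Wc u that] by (simp add: Wsym)
    then show ?thesis by (simp add: Wu scalar_prod_eq_dot[where p = p] dot_def)
  qed
  have "q d = scalar_prod (?S *\<^sub>v ?d) ?d"
    unfolding q_eq using Sd by (intro comm_scalar_prod[where n = p]) auto
  also have "\<dots> = dot p (($) (?S *\<^sub>v ?d)) d"
    by (simp add: scalar_prod_eq_dot[where p = p] dot_def)
  also have "\<dots> = scalar_prod u u"
    using swap[OF Sd] by (simp add: u_def)
  also have "\<dots> = (l2_norm u)\<^sup>2"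
    using u by (simp add: l2_norm_def scalar_prod_eq_dot[where p = p] dot_def sum_nonneg power2_eq_square)
  finally have qd: "q d = (l2_norm u)\<^sup>2" .
  have norm: "l2_norm u = sqrt (q d)"
    unfolding qd by (simp add: l2_norm_def sum_nonneg)
  have "u \<noteq> 0\<^sub>v p"
  proof
    assume "u = 0\<^sub>v p"
    then have "l2_norm u = 0" by (simp add: l2_norm_def)
    then show False using d qd by simp
  qed
  from Wt[OF u t this]
  have "D.prob {w \<in> space D. \<upsilon> * sqrt (q d) * t \<le> \<bar>scalar_prod (W *\<^sub>v fst w) u\<bar>} \<le> 2 * exp (- t)"
    by (simp add: norm)
  also have "{w \<in> space D. \<upsilon> * sqrt (q d) * t \<le> \<bar>scalar_prod (W *\<^sub>v fst w) u\<bar>}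
      = {w \<in> space D. \<upsilon> * sqrt (q d) * t \<le> \<bar>dot p (X w) d\<bar>}"
    using swap by (auto simp: space_D)
  finally show ?thesis .
qed

text \<open>Nonnegativity of the variance of \<open>\<bar>dot p (X w) d\<bar>\<close>.\<close>

lemma abs_dot_expectation_le: "(\<integral>w. \<bar>dot p (X w) d\<bar> \<partial>D) \<le> sqrt (q d)"
proof -
  have "0 \<le> D.variance (\<lambda>w. \<bar>dot p (X w) d\<bar>)" by (rule D.variance_positive)
  also have "\<dots> = q d - (\<integral>w. \<bar>dot p (X w) d\<bar> \<partial>D)\<^sup>2"
    unfolding q_def using dot_integrable dot_sq_integrable by (subst D.variance_eq) auto
  finally show ?thesis by (intro real_le_rsqrt) simp
qed

definition unit_coord :: "nat \<Rightarrow> nat \<Rightarrow> real" where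
  "unit_coord j = (\<lambda>k. if k = j then 1 else 0)"

lemma dot_unit_coord: "j < p \<Longrightarrow> dot p u (unit_coord j) = u j"
  unfolding dot_def unit_coord_def by (simp add: if_distrib cong: if_cong)

lemma sum_abs_unit_coord: "j < p \<Longrightarrow> (\<Sum>k<p. \<bar>unit_coord j k\<bar>) = 1"
  unfolding unit_coord_def by (simp add: if_distrib cong: if_cong)

lemma q_unit_coord: 
  assumes "j < p"
  shows "0 < q (unit_coord j)" "q (unit_coord j) \<le> (sigma_x p D)\<^sup>2"
proof -
  have "(unit_coord j k)\<^sup>2 = (if k = j then 1 else 0)" for k by (simp add: unit_coord_def)
  then have "(\<Sum>k<p. (unit_coord j k)\<^sup>2) = 1" using assms by simp
  then show "0 < q (unit_coord j)" using q_ge[of "unit_coord j"] eig(2) by simp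
  let ?M = "Max ((\<lambda>j. \<integral>w. (X w j)\<^sup>2 \<partial>D) ` {..<p})"
  have "q (unit_coord j) = (\<integral>w. (X w j)\<^sup>2 \<partial>D)" unfolding q_def dot_unit_coord[OF assms] ..
  also have "\<dots> \<le> ?M" using assms by (intro Max_ge) auto
  finally have "q (unit_coord j) \<le> ?M" .
  moreover have "0 \<le> ?M" using q_nonneg calculation by (rule order_trans)
  ultimately show "q (unit_coord j) \<le> (sigma_x p D)\<^sup>2" by (simp add: sigma_x_def)
qed

text \<open>The intercept alone has second moment 1.\<close>

lemma sigma_x_ge_1: "1 \<le> sigma_x p D"
proof -
  have "(\<integral>w. (X w 0)\<^sup>2 \<partial>D) = (\<integral>w. 1 \<partial>D)"
    using p by (intro integral_cong_AE) (auto intro: AE_mp[OF X_0])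
  then have "1 = q (unit_coord 0)"
    using p by (simp add: q_def dot_unit_coord D.prob_space)
  also have "\<dots> \<le> (sigma_x p D)\<^sup>2" using p by (intro q_unit_coord) simp
  finally have "1 \<le> (sigma_x p D)\<^sup>2" .
  moreover have "0 \<le> sigma_x p D"
  proof -
    have "0 \<le> (\<integral>w. (X w 0)\<^sup>2 \<partial>D)" by simp
    also have "\<dots> \<le> Max ((\<lambda>j. \<integral>w. (X w j)\<^sup>2 \<partial>D) ` {..<p})" using p by (intro Max_ge) auto
    finally show ?thesis by (simp add: sigma_x_def)
  qed
  ultimately show ?thesis by (intro power2_le_imp_le[of 1]) auto
qed

lemma cosh_moment_X:
  assumes j: "j < p" and \<nu>: "\<bar>\<nu>\<bar> * (\<upsilon> * sigma_x p D) \<le> a" "a \<le> 1/2"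
  shows "(\<integral>\<^sup>+w. ennreal (cosh (\<nu> * X w j)) \<partial>D) \<le> ennreal (exp (48 * a\<^sup>2))"
proof (rule D.cosh_moment_of_tail)
  have \<upsilon>: "1 \<le> \<upsilon>" using B3 by (simp add: cond_B3_def)
  let ?b = "\<upsilon> * sqrt (q (unit_coord j))"
  show "0 < ?b" using \<upsilon> q_unit_coord(1)[OF j] by simp
  show "D.prob {w \<in> space D. ?b * t \<le> \<bar>X w j\<bar>} \<le> 2 * exp (- t)" if "0 \<le> t" for t
    using tail[OF q_unit_coord(1)[OF j] that] by (simp add: dot_unit_coord[OF j])
  have "sqrt (q (unit_coord j)) \<le> sigma_x p D"
    using q_unit_coord(2)[OF j] sigma_x_ge_1 by (intro real_le_lsqrt) auto
  then have "\<bar>\<nu>\<bar> * ?b \<le> \<bar>\<nu>\<bar> * (\<upsilon> * sigma_x p D)"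
    using \<upsilon> by (intro mult_left_mono) auto
  then show "\<bar>\<nu>\<bar> * ?b \<le> a" using \<nu>(1) by linarith
qed (use j \<nu> in auto)

text \<open>The defining property of conditional expectation, tested against functions of the
  covariates. It lets almost sure statements about conditional probabilities be integrated against
  powers or truncations of \<open>dot p x d\<close>.\<close>

lemma cond_prob_err_integral:
  assumes B: "B \<in> sets borel" and [measurable]: "\<Psi> \<in> borel_measurable (vec_borel p)"
    and \<Psi>: "integrable D (\<lambda>w. \<Psi> (fst w))"
  shows "integrable D (\<lambda>w. \<Psi> (fst w) * cond_prob_err p D \<beta> B w)"
    and "(\<integral>w. \<Psi> (fst w) * cond_prob_err p D \<beta> B w \<partial>D) = (\<integral>w. \<Psi> (fst w) * indicator B (err \<beta> w) \<partial>D)"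
    and "integrable D (\<lambda>w. \<Psi> (fst w) * indicator B (err \<beta> w))"
proof -
  let ?F = "vimage_algebra (space D) fst (vec_borel p)"
  let ?g = "indicator {w \<in> space D. err \<beta> w \<in> B} :: obs \<Rightarrow> real"
  have fst_in: "fst \<in> space D \<rightarrow> space (vec_borel p)" using measurable_space[OF fst_measurable] by blast
  have "subalgebra D ?F"
    unfolding subalgebra_def sets_vimage_algebra2[OF fst_in]
    using measurable_sets[OF fst_measurable] by auto
  then interpret F: finite_measure_subalgebra D ?F
    by unfold_locales
  have Bm: "{w \<in> space D. err \<beta> w \<in> B} \<in> sets D"
    using B by measurable
  have fF: "(\<lambda>w. \<Psi> (fst w)) \<in> borel_measurable ?F"
    by (rule measurable_compose[OF measurable_vimage_algebra1[OF fst_in]]) fact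
  have gi: "integrable D (\<lambda>w. \<Psi> (fst w) * ?g w)"
    using integrable_mult_indicator[OF Bm \<Psi>] by (simp add: mult.commute)
  have gm: "?g \<in> borel_measurable D" using Bm by measurable
  show "integrable D (\<lambda>w. \<Psi> (fst w) * cond_prob_err p D \<beta> B w)"
    unfolding cond_prob_err_def by (rule F.real_cond_exp_intg(1)[OF gi fF gm])
  have eq: "\<Psi> (fst w) * ?g w = \<Psi> (fst w) * indicator B (err \<beta> w)" if "w \<in> space D" for w
    using that by (simp add: indicator_def)
  show "(\<integral>w. \<Psi> (fst w) * cond_prob_err p D \<beta> B w \<partial>D) = (\<integral>w. \<Psi> (fst w) * indicator B (err \<beta> w) \<partial>D)"
    unfolding cond_prob_err_def F.real_cond_exp_intg(2)[OF gi fF gm]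
    by (intro Bochner_Integration.integral_cong eq refl)
  show "integrable D (\<lambda>w. \<Psi> (fst w) * indicator B (err \<beta> w))"
    using gi by (subst (asm) Bochner_Integration.integrable_cong[OF refl eq])
qed

text \<open>This isolates what is used of the conditional density: its value \<open>f0\<close> at 0
  and the Lipschitz error near 0. \<open>f0\<close> is chosen before \<open>B\<close>, so that two
  sets of equal length can be compared; the null set may depend on \<open>B\<close>.\<close>

lemma cond_density_bounds:
  "\<exists>f0 :: obs \<Rightarrow> real. (AE w in D. f\<^sub>l \<le> f0 w) \<and>
    (\<forall>B a. B \<in> sets borel \<longrightarrow> B \<subseteq> {- a..a} \<longrightarrow>
      (AE w in D. \<bar>cond_prob_err p D \<beta> B w - measure lborel B * f0 w\<bar> \<le> measure lborel B * (l\<^sub>0 * a)))"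
proof -
  obtain f where f: "is_cond_density p D \<beta> f" "AE w in D. f\<^sub>l \<le> f (fst w) 0 \<and> f (fst w) 0 \<le> f\<^sub>u"
    "AE w in D. \<forall>u v. \<bar>f (fst w) u - f (fst w) v\<bar> \<le> l\<^sub>0 * \<bar>u - v\<bar>"
    using B1 by (auto simp: cond_B1_def)
  show ?thesis
  proof (intro exI[of _ "\<lambda>w. f (fst w) 0"] conjI allI impI)
    show "AE w in D. f\<^sub>l \<le> f (fst w) 0" using f(2) by auto
    fix B and a :: real assume B: "B \<in> sets borel" "B \<subseteq> {- a..a::real}"
    have "AE w in D. cond_prob_err p D \<beta> B w = (LINT u:B|lborel. f (fst w) u)"
      using f(1) B(1) by (auto simp: is_cond_density_def)
    with f(3) show "AE w in D. \<bar>cond_prob_err p D \<beta> B w - measure lborel B * f (fst w) 0\<bar> \<le> measure lborel B * (l\<^sub>0 * a)"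
      by eventually_elim (use B in \<open>simp add: lipschitz_set_integral\<close>)
  qed
qed

text \<open>The combination of indicators is 1 on \<open>{- a..0}\<close>, -1 on
  \<open>{0<..<a}\<close> and 0 elsewhere. Both intervals have length \<open>a\<close>, so the
  leading terms \<open>a * f0\<close> cancel and only two Lipschitz errors
  \<open>l\<^sub>0 * a\<^sup>2\<close> remain.\<close>

lemma second_difference:
  assumes a: "0 < a" and \<Psi>m: "\<Psi> \<in> borel_measurable (vec_borel p)" and \<Psi>: "integrable D (\<lambda>w. \<Psi> (fst w))"
  shows "\<bar>\<integral>w. (2 * indicator {..0} (err \<beta> w) - indicator {..<-a} (err \<beta> w) - indicator {..<a} (err \<beta> w)) * \<Psi> (fst w) \<partial>D\<bar>
    \<le> 2 * l\<^sub>0 * a\<^sup>2 * (\<integral>w. \<bar>\<Psi> (fst w)\<bar> \<partial>D)"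
proof -
  obtain f0 where "AE w in D. f\<^sub>l \<le> f0 w" and f0: "\<And>B a. B \<in> sets borel \<Longrightarrow> B \<subseteq> {- a..a} \<Longrightarrow>
      AE w in D. \<bar>cond_prob_err p D \<beta> B w - measure lborel B * f0 w\<bar> \<le> measure lborel B * (l\<^sub>0 * a)"
    using cond_density_bounds by auto
  let ?c1 = "cond_prob_err p D \<beta> {- a..0}" and ?c2 = "cond_prob_err p D \<beta> {0<..<a}"
  note i1 = cond_prob_err_integral[of "{- a..0}", OF _ \<Psi>m \<Psi>]
  note i2 = cond_prob_err_integral[of "{0<..<a}", OF _ \<Psi>m \<Psi>]
  have "(\<integral>w. (2 * indicator {..0} (err \<beta> w) - indicator {..<-a} (err \<beta> w) - indicator {..<a} (err \<beta> w)) * \<Psi> (fst w) \<partial>D)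
     = (\<integral>w. \<Psi> (fst w) * indicator {- a..0} (err \<beta> w) - \<Psi> (fst w) * indicator {0<..<a} (err \<beta> w) \<partial>D)"
    using a by (intro Bochner_Integration.integral_cong refl) (auto simp: indicator_def)
  also have "\<dots> = (\<integral>w. \<Psi> (fst w) * ?c1 w - \<Psi> (fst w) * ?c2 w \<partial>D)"
    using i1 i2 by simp
  finally have eq: "(\<integral>w. (2 * indicator {..0} (err \<beta> w) - indicator {..<-a} (err \<beta> w) - indicator {..<a} (err \<beta> w)) * \<Psi> (fst w) \<partial>D)
    = (\<integral>w. \<Psi> (fst w) * ?c1 w - \<Psi> (fst w) * ?c2 w \<partial>D)" .
  have "\<bar>\<integral>w. \<Psi> (fst w) * ?c1 w - \<Psi> (fst w) * ?c2 w \<partial>D\<bar> \<le> (\<integral>w. \<bar>\<Psi> (fst w) * ?c1 w - \<Psi> (fst w) * ?c2 w\<bar> \<partial>D)"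
    by (rule integral_abs_bound)
  also have "\<dots> \<le> (\<integral>w. 2 * l\<^sub>0 * a\<^sup>2 * \<bar>\<Psi> (fst w)\<bar> \<partial>D)"
  proof (rule integral_mono_AE)
    have m: "measure lborel {- a..0} = a" "measure lborel {0<..<a} = a" using a by auto
    have "AE w in D. \<bar>?c1 w - a * f0 w\<bar> \<le> a * (l\<^sub>0 * a)" "AE w in D. \<bar>?c2 w - a * f0 w\<bar> \<le> a * (l\<^sub>0 * a)"
    proof -
      have sub: "{- a..0} \<subseteq> {- a..a}" "{0<..<a} \<subseteq> {- a..a}" using a by auto
      show "AE w in D. \<bar>?c1 w - a * f0 w\<bar> \<le> a * (l\<^sub>0 * a)"
        using f0[OF _ sub(1)] unfolding m by simp
      show "AE w in D. \<bar>?c2 w - a * f0 w\<bar> \<le> a * (l\<^sub>0 * a)"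
        using f0[OF _ sub(2)] unfolding m by simp
    qed
    then show "AE w in D. \<bar>\<Psi> (fst w) * ?c1 w - \<Psi> (fst w) * ?c2 w\<bar> \<le> 2 * l\<^sub>0 * a\<^sup>2 * \<bar>\<Psi> (fst w)\<bar>"
    proof eventually_elim
      case (elim w)
      have "\<bar>?c1 w - ?c2 w\<bar> \<le> 2 * (a * (l\<^sub>0 * a))" using elim by linarith
      then have "\<bar>\<Psi> (fst w)\<bar> * \<bar>?c1 w - ?c2 w\<bar> \<le> \<bar>\<Psi> (fst w)\<bar> * (2 * (a * (l\<^sub>0 * a)))"
        by (rule mult_left_mono) simp
      then show ?case by (simp add: abs_mult[symmetric] right_diff_distrib power2_eq_square mult_ac)
    qed
  qed (use i1 i2 \<Psi> in auto)
  also have "\<dots> = 2 * l\<^sub>0 * a\<^sup>2 * (\<integral>w. \<bar>\<Psi> (fst w)\<bar> \<partial>D)" by simp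
  finally show ?thesis unfolding eq .
qed

text \<open>The bound \<open>h \<le> f\<^sub>l / (2 * l\<^sub>0)\<close> keeps the Lipschitz error
  on the window of radius \<open>h / 2\<close> below \<open>f\<^sub>l / 4\<close>, which leaves
  three quarters of the density.\<close>

lemma central_mass_ge:
  assumes h: "0 < h" "h \<le> f\<^sub>l / (2 * l\<^sub>0)" and \<Psi>m: "\<Psi> \<in> borel_measurable (vec_borel p)"
    and \<Psi>: "integrable D (\<lambda>w. \<Psi> (fst w))" and nn: "\<And>v. 0 \<le> \<Psi> v"
  shows "3/4 * h * f\<^sub>l * (\<integral>w. \<Psi> (fst w) \<partial>D) \<le> (\<integral>w. \<Psi> (fst w) * indicator {- h/2..h/2} (err \<beta> w) \<partial>D)"
proof -
  have l0: "0 < l\<^sub>0" using B1 by (simp add: cond_B1_def)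
  let ?c = "cond_prob_err p D \<beta> {- h/2..h/2}"
  note i = cond_prob_err_integral[of "{- h/2..h/2}", OF _ \<Psi>m \<Psi>]
  obtain f0 where f0: "AE w in D. f\<^sub>l \<le> f0 w" and f0': "\<And>B a. B \<in> sets borel \<Longrightarrow> B \<subseteq> {- a..a} \<Longrightarrow>
      AE w in D. \<bar>cond_prob_err p D \<beta> B w - measure lborel B * f0 w\<bar> \<le> measure lborel B * (l\<^sub>0 * a)"
    using cond_density_bounds by auto
  have "3/4 * h * f\<^sub>l * (\<integral>w. \<Psi> (fst w) \<partial>D) = (\<integral>w. \<Psi> (fst w) * (3/4 * h * f\<^sub>l) \<partial>D)" by simp
  also have "\<dots> \<le> (\<integral>w. \<Psi> (fst w) * ?c w \<partial>D)"
  proof (rule integral_mono_AE)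
    have m: "measure lborel {- h/2..h/2} = h" using h by simp
    have "AE w in D. \<bar>?c w - h * f0 w\<bar> \<le> h * (l\<^sub>0 * (h/2))"
      using f0'[of "{- h/2..h/2}" "h/2"] unfolding m by simp
    with f0 show "AE w in D. \<Psi> (fst w) * (3/4 * h * f\<^sub>l) \<le> \<Psi> (fst w) * ?c w"
    proof eventually_elim
      case (elim w)
      have "l\<^sub>0 * (h/2) \<le> f\<^sub>l / 4" using h(2) l0 by (simp add: field_simps)
      then have "h * (l\<^sub>0 * (h/2)) \<le> h * (f\<^sub>l / 4)" using h(1) by (intro mult_left_mono) auto
      moreover have "h * f\<^sub>l \<le> h * f0 w" using elim(1) h(1) by (intro mult_left_mono) auto
      moreover have "3/4 * h * f\<^sub>l = h * f\<^sub>l - h * (f\<^sub>l / 4)" by simp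
      ultimately have "3/4 * h * f\<^sub>l \<le> ?c w" using elim(2) unfolding abs_le_iff by linarith
      then show ?case by (intro mult_left_mono nn)
    qed
  qed (use i \<Psi> in auto)
  also have "\<dots> = (\<integral>w. \<Psi> (fst w) * indicator {- h/2..h/2} (err \<beta> w) \<partial>D)" by (rule i(2)) simp
  finally show ?thesis .
qed

lemma quantile_orthogonality:
  "(\<integral>w. indicator {..0} (err \<beta> w) * dot p (X w) d \<partial>D) = \<tau> * (\<integral>w. dot p (X w) d \<partial>D)"
proof -
  note i = cond_prob_err_integral[of "{..0}", OF _ dot_index_measurable dot_integrable]
  have "(\<integral>w. indicator {..0} (err \<beta> w) * dot p (X w) d \<partial>D) = (\<integral>w. dot p (X w) d * cond_prob_err p D \<beta> {..0} w \<partial>D)"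
    by (subst i(2)) (auto simp: mult.commute)
  also have "\<dots> = (\<integral>w. dot p (X w) d * \<tau> \<partial>D)"
  proof (rule integral_cong_AE)
    have "AE w in D. cond_prob_err p D \<beta> {..0} w = \<tau>" using model by (simp add: quantile_model_def)
    then show "AE w in D. dot p (X w) d * cond_prob_err p D \<beta> {..0} w = dot p (X w) d * \<tau>"
      by eventually_elim simp
  qed (use i(1) in auto)
  finally show ?thesis by (simp add: mult.commute)
qed

end

locale smoothed_quantile_regression = quantile_regression + kernel K h \<tau> for K h
begin

lemma score_bias_dot:
  "\<bar>\<integral>w. score (err \<beta> w) * dot p (X w) d \<partial>D\<bar> \<le> l\<^sub>0 * h\<^sup>2 * kernel_moment K 2 * sqrt (q d)"
proof -
  have l0: "0 < l\<^sub>0" using B1 by (simp add: cond_B1_def)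
  have "\<bar>\<integral>w. score (err \<beta> w) * dot p (X w) d \<partial>D\<bar> \<le> l\<^sub>0 * h\<^sup>2 * kernel_moment K 2 * (\<integral>w. \<bar>dot p (X w) d\<bar> \<partial>D)"
    by (rule score_bias[OF D.prob_space_axioms err_measurable dot_integrable quantile_orthogonality])
      (rule second_difference[OF _ dot_index_measurable dot_integrable])
  also have "\<dots> \<le> l\<^sub>0 * h\<^sup>2 * kernel_moment K 2 * sqrt (q d)"
    using l0 kernel_moment_nonneg by (intro mult_left_mono abs_dot_expectation_le mult_nonneg_nonneg) auto
  finally show ?thesis .
qed

end

section \<open>The two events\<close>

text \<open>Here \<open>exp (k * ln p)\<close> is the n-fold \<open>cosh\<close> moment, and
  \<open>k * ln p\<close> of the threshold cancels it. The remaining \<open>4 * ln p\<close> turns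
  \<open>2 * p\<close> into \<open>2 / p ^ 3\<close>. Each of the two events may use half of the
  failure probability \<open>1 / p\<close>.\<close>

lemma failure_prob_le:
  fixes p :: nat
  assumes p: "2 \<le> p" and t: "(k + 4) * ln p \<le> t"
  shows "exp (- t) * (2 * real p * exp (k * ln p)) \<le> 1 / (2 * p)"
proof -
  have "exp (- t) * (2 * real p * exp (k * ln p)) = 2 * real p * exp (k * ln p - t)"
    by (simp add: exp_diff exp_minus field_simps)
  also have "\<dots> \<le> 2 * real p * exp (- (4 * ln p))"
    using t by (intro mult_left_mono) (auto simp: algebra_simps)
  also have "exp (- (4 * ln p)) = 1 / real p ^ 4"
    using p exp_of_nat_mult[of 4 "ln (real p)"] by (simp add: exp_minus inverse_eq_divide)
  also have "2 * real p * (1 / real p ^ 4) \<le> 1 / (2 * p)"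
  proof -
    have "(2::real)\<^sup>2 \<le> (real p)\<^sup>2" using p by (intro power_mono) auto
    then have "4 * (real p)\<^sup>2 \<le> (real p)\<^sup>2 * (real p)\<^sup>2" by (intro mult_right_mono) auto
    then show ?thesis using p by (simp add: field_simps power2_eq_square power4_eq_xxxx)
  qed
  finally show ?thesis .
qed

context smoothed_quantile_regression
begin

abbreviation \<sigma> :: real where "\<sigma> \<equiv> sigma_x p D"

lemma upsilon_ge_1: "1 \<le> \<upsilon>"
  using B3 by (simp add: cond_B3_def)

lemma score_dot_integrable: "integrable D (\<lambda>w. score (err \<beta> w) * dot p (X w) d)"
proof (rule Bochner_Integration.integrable_bound[OF dot_integrable[of d]])
  show "AE w in D. norm (score (err \<beta> w) * dot p (X w) d) \<le> norm (dot p (X w) d)"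
    using abs_score_le by (intro AE_I2) (simp add: abs_mult mult_left_le_one_le)
qed measurable

lemma score_deviation:
  fixes n :: nat and lam :: real
  defines "\<rho> \<equiv> sqrt (ln p / n)"
  assumes p2: "2 \<le> p" and n: "1 \<le> n" and small: "\<upsilon> * \<rho> \<le> 1/2"
    and lam: "4 * (48 * \<upsilon>\<^sup>2 + 4) * (\<sigma> * \<rho>) \<le> lam"
  obtains A where "A \<in> sets (PiM {..<n} (\<lambda>_. D))"
    and "1 - 1 / (2 * p) \<le> measure (PiM {..<n} (\<lambda>_. D)) A"
    and "\<And>\<omega> j. \<omega> \<in> A \<Longrightarrow> j < p \<Longrightarrow>
      \<bar>(\<Sum>i<n. score (err \<beta> (\<omega> i)) * X (\<omega> i) j - (\<integral>w. score (err \<beta> w) * X w j \<partial>D))\<bar> \<le> n * lam / 2"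
proof -
  let ?M = "PiM {..<n} (\<lambda>_. D)"
  interpret P: prob_space ?M by (rule prob_space_PiM) (rule D.prob_space_axioms)
  have \<rho>: "0 < \<rho>" and \<rho>2: "n * \<rho>\<^sup>2 = ln p" using p2 n by (auto simp: \<rho>_def)
  \<comment> \<open>The 2 cancels the one from symmetrization, so the coordinates enter
    \<open>cosh\<close> with factor \<open>\<rho> / \<sigma>\<close> and their moment is governed by
    \<open>a = \<upsilon> * \<rho>\<close>.\<close>
  define \<mu> where "\<mu> = \<rho> / (2 * \<sigma>)"
  have \<mu>: "0 < \<mu>" using \<rho> sigma_x_ge_1 by (simp add: \<mu>_def)
  \<comment> \<open>Both signs occur because the deviation inequality is one-sided.\<close>
  define F where "F = unit_coord ` {..<p} \<union> (\<lambda>j k. - unit_coord j k) ` {..<p}"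
  define g where "g = (\<lambda>d w. \<mu> * (score (err \<beta> w) * dot p (X w) d))"
  define a where "a = \<upsilon> * \<rho>"
  define t where "t = \<mu> * (n * lam / 2)"
  let ?E = "{\<omega> \<in> space ?M. \<exists>d\<in>F. t < (\<Sum>i<n. D.expectation (g d) - g d (\<omega> i))}"
  have "?E \<in> sets ?M \<and> measure ?M ?E \<le> exp (- t) * (2 * real p * exp (48 * a\<^sup>2) ^ n)"
  proof (rule conjI)
    note dev = D.deviation_countable[of F p 1 "\<lambda>j w. \<mu> * X w j" g "exp (48 * a\<^sup>2)"]
    have F: "countable F" by (simp add: F_def countable_finite)
    have B: "(\<Sum>j<p. \<bar>d j\<bar>) \<le> 1" if "d \<in> F" for d
      using that sum_abs_unit_coord by (auto simp: F_def)
    have x: "(\<lambda>w. \<mu> * X w j) \<in> borel_measurable D" if "j < p" for j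
      using X_measurable[OF that] by measurable
    have g: "integrable D (g d)" for d
      unfolding g_def using score_dot_integrable by simp
    have le: "\<bar>\<mu> * (score e * z)\<bar> \<le> \<bar>\<mu> * z\<bar>" for e z
    proof -
      have "\<bar>score e\<bar> * \<bar>z\<bar> \<le> \<bar>z\<bar>" using abs_score_le[of e] by (simp add: mult_left_le_one_le)
      then show ?thesis using \<mu> by (simp add: abs_mult)
    qed
    have lip: "\<bar>g d w - g d' w\<bar> \<le> \<bar>dot p (\<lambda>j. \<mu> * X w j) d - dot p (\<lambda>j. \<mu> * X w j) d'\<bar>" for d d' w
      using le[of "err \<beta> w" "dot p (X w) d - dot p (X w) d'"]
      by (simp add: g_def dot_scale_left algebra_simps)
    have dom: "\<bar>g d w\<bar> \<le> \<bar>dot p (\<lambda>j. \<mu> * X w j) d\<bar>" for d w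
      using le by (simp add: g_def dot_scale_left)
    have c: "(\<integral>\<^sup>+w. ennreal (cosh (2 * 1 * (\<mu> * X w j))) \<partial>D) \<le> ennreal (exp (48 * a\<^sup>2))" if "j < p" for j
    proof -
      have "(\<integral>\<^sup>+w. ennreal (cosh ((2 * \<mu>) * X w j)) \<partial>D) \<le> ennreal (exp (48 * a\<^sup>2))"
        using that small \<rho> \<mu> sigma_x_ge_1
        by (intro cosh_moment_X) (auto simp: a_def \<mu>_def)
      then show ?thesis by (simp add: mult.assoc)
    qed
    show "?E \<in> sets ?M" by (intro dev(1) F p B x g lip dom c) auto
    show "measure ?M ?E \<le> exp (- t) * (2 * real p * exp (48 * a\<^sup>2) ^ n)"
      by (intro dev(2) F p B x g lip dom c) auto
  qed
  then have E: "?E \<in> sets ?M" "measure ?M ?E \<le> exp (- t) * (2 * real p * exp (48 * a\<^sup>2) ^ n)" by auto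
  have "exp (48 * a\<^sup>2) ^ n = exp (48 * \<upsilon>\<^sup>2 * ln p)"
    unfolding \<rho>2[symmetric] by (simp add: exp_of_nat_mult[symmetric] a_def power_mult_distrib mult_ac)
  moreover have "(48 * \<upsilon>\<^sup>2 + 4) * ln p \<le> t"
  proof -
    have "(48 * \<upsilon>\<^sup>2 + 4) * ln p = \<mu> * (n * (4 * (48 * \<upsilon>\<^sup>2 + 4) * (\<sigma> * \<rho>)) / 2)"
      unfolding \<rho>2[symmetric] \<mu>_def using sigma_x_ge_1 by (simp add: field_simps power2_eq_square)
    also have "\<dots> \<le> t"
      unfolding t_def using lam \<mu> by (intro mult_left_mono divide_right_mono) auto
    finally show ?thesis .
  qed
  ultimately have Eb: "measure ?M ?E \<le> 1 / (2 * p)"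
    using E(2) failure_prob_le[OF p2, of "48 * \<upsilon>\<^sup>2" t] by simp
  show thesis
  proof
    show "space ?M - ?E \<in> sets ?M" using E(1) by blast
    show "1 - 1 / (2 * p) \<le> measure ?M (space ?M - ?E)"
      using E(1) Eb by (subst P.prob_compl) auto
    fix \<omega> j assume \<omega>: "\<omega> \<in> space ?M - ?E" and j: "j < p"
    have le: "(\<Sum>i<n. D.expectation (g d) - g d (\<omega> i)) \<le> t" if "d \<in> F" for d
      using \<omega> that by force
    let ?S = "\<Sum>i<n. score (err \<beta> (\<omega> i)) * X (\<omega> i) j - (\<integral>w. score (err \<beta> w) * X w j \<partial>D)"
    have "(\<Sum>i<n. D.expectation (g (unit_coord j)) - g (unit_coord j) (\<omega> i)) = - (\<mu> * ?S)"
      by (simp add: g_def dot_unit_coord[OF j] sum_distrib_left sum_negf[symmetric] algebra_simps)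
    moreover have "(\<Sum>i<n. D.expectation (g (\<lambda>k. - unit_coord j k)) - g (\<lambda>k. - unit_coord j k) (\<omega> i)) = \<mu> * ?S"
    proof -
      have "dot p u (\<lambda>k. - unit_coord j k) = - u j" for u
        using dot_scale_right[of p u "-1" "unit_coord j"] by (simp add: dot_unit_coord[OF j])
      then show ?thesis by (simp add: g_def sum_distrib_left algebra_simps)
    qed
    ultimately have "\<mu> * \<bar>?S\<bar> \<le> \<mu> * (n * lam / 2)"
    proof -
      assume eq: "(\<Sum>i<n. D.expectation (g (unit_coord j)) - g (unit_coord j) (\<omega> i)) = - (\<mu> * ?S)"
        "(\<Sum>i<n. D.expectation (g (\<lambda>k. - unit_coord j k)) - g (\<lambda>k. - unit_coord j k) (\<omega> i)) = \<mu> * ?S"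
      have "unit_coord j \<in> F" "(\<lambda>k. - unit_coord j k) \<in> F" using j by (auto simp: F_def)
      from le[OF this(1)] le[OF this(2)] have "\<bar>\<mu> * ?S\<bar> \<le> t"
        unfolding eq by (simp only: abs_le_iff)
      then show ?thesis using \<mu> by (simp add: abs_mult t_def)
    qed
    then show "\<bar>?S\<bar> \<le> n * lam / 2" using \<mu> by simp
  qed
qed

text \<open>The weight involves only the error and lies in \<open>{0, 1}\<close>, so the truncated
  square remains \<open>R\<close>-Lipschitz in \<open>dot p x d\<close> and the contraction bound
  applies. Its mean is at least \<open>3/8 * h * f\<^sub>l * r\<^sup>2\<close>: 3/4 from
  \<open>central_mass_ge\<close>, 1/2 from truncation. Half of it is given up to the deviation,
  hence 3/16.\<close>

lemma restricted_curvature: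
  fixes n :: nat and r L :: real
  defines "\<rho> \<equiv> sqrt (ln p / n)"
  defines "R \<equiv> 400 * \<upsilon>\<^sup>2 * r"
  assumes p2: "2 \<le> p" and n: "1 \<le> n" and r: "0 < r" and L: "0 < L" and small: "\<upsilon> * \<rho> \<le> 1/2"
    and hf: "h \<le> f\<^sub>l / (2 * l\<^sub>0)"
    and hl: "5000 * L * \<upsilon>\<^sup>2 * (48 * \<upsilon>\<^sup>2 + 4) * \<sigma> * \<rho> \<le> h * f\<^sub>l"
  obtains A where "A \<in> sets (PiM {..<n} (\<lambda>_. D))"
    and "1 - 1 / (2 * p) \<le> measure (PiM {..<n} (\<lambda>_. D)) A"
    and "\<And>\<omega> d. \<omega> \<in> A \<Longrightarrow> q d = r\<^sup>2 \<Longrightarrow> (\<Sum>j<p. \<bar>d j\<bar>) \<le> L * r \<Longrightarrow>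
      n * (3/16 * h * f\<^sub>l * r\<^sup>2) \<le> (\<Sum>i<n. indicator {- h/2..h/2} (err \<beta> (\<omega> i)) * trunc_sq R (dot p (X (\<omega> i)) d))"
proof -
  let ?M = "PiM {..<n} (\<lambda>_. D)"
  have \<rho>: "0 < \<rho>" and \<rho>2: "n * \<rho>\<^sup>2 = ln p" using p2 n by (auto simp: \<rho>_def)
  have R: "0 < R" using r upsilon_ge_1 by (simp add: R_def)
  have fl: "0 < f\<^sub>l" using B1 by (simp add: cond_B1_def)
  have \<sigma>1: "1 \<le> \<sigma>" by (rule sigma_x_ge_1)
  \<comment> \<open>The l1 radius \<open>L * r\<close>, the Lipschitz constant \<open>R\<close> and
    the factor 2 cancel in the argument of \<open>cosh\<close>, which leaves
    \<open>\<rho> / \<sigma>\<close> as for the score.\<close>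
  define \<mu> where "\<mu> = \<rho> / (2 * L * r * R * \<sigma>)"
  have \<mu>: "0 < \<mu>" using \<rho> L r R \<sigma>1 by (simp add: \<mu>_def)
  define T where "T = {d. q d = r\<^sup>2 \<and> (\<Sum>j<p. \<bar>d j\<bar>) \<le> L * r}"
  define g where "g = (\<lambda>d w. \<mu> * (indicator {- h/2..h/2} (err \<beta> w) * trunc_sq R (dot p (X w) d)))"
  define a where "a = \<upsilon> * \<rho>"
  define m where "m = \<mu> * (3/8 * h * f\<^sub>l * r\<^sup>2)"
  define t where "t = n * m / 2"
  have Ti: "integrable D (\<lambda>w. trunc_sq R (dot p (X w) d))" for d
    using trunc_sq_le trunc_sq_nonneg
    by (intro Bochner_Integration.integrable_bound[OF dot_sq_integrable[of d]]) auto
  have Tm: "(\<lambda>v. trunc_sq R (dot p (($) v) d)) \<in> borel_measurable (vec_borel p)" for d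
    using dot_index_measurable by measurable
  have gi: "integrable D (g d)" for d
    unfolding g_def using cond_prob_err_integral(3)[of "{- h/2..h/2}", OF _ Tm Ti]
    by (simp add: mult.commute)
  have gE: "m \<le> D.expectation (g d)" if "d \<in> T" for d
  proof -
    have qd: "q d = r\<^sup>2" using that by (simp add: T_def)
    have "r\<^sup>2 / 2 \<le> D.expectation (\<lambda>w. trunc_sq R (dot p (X w) d))"
      unfolding R_def
    proof (rule D.trunc_sq_expectation_ge)
      show "D.expectation (\<lambda>w. (dot p (X w) d)\<^sup>2) = r\<^sup>2" using qd by (simp add: q_def)
      show "D.prob {w \<in> space D. \<upsilon> * r * t \<le> \<bar>dot p (X w) d\<bar>} \<le> 2 * exp (- t)" if "0 \<le> t" for t
        using tail[of d t] that qd r by simp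
    qed (use dot_sq_integrable r upsilon_ge_1 in auto)
    then have "3/4 * h * f\<^sub>l * (r\<^sup>2 / 2) \<le> 3/4 * h * f\<^sub>l * D.expectation (\<lambda>w. trunc_sq R (dot p (X w) d))"
      using h fl by (intro mult_left_mono) auto
    also have "\<dots> \<le> D.expectation (\<lambda>w. trunc_sq R (dot p (X w) d) * indicator {- h/2..h/2} (err \<beta> w))"
      by (rule central_mass_ge[OF h hf Tm Ti trunc_sq_nonneg])
    finally have "m \<le> \<mu> * D.expectation (\<lambda>w. trunc_sq R (dot p (X w) d) * indicator {- h/2..h/2} (err \<beta> w))"
      unfolding m_def using \<mu> by (intro mult_left_mono) auto
    then show ?thesis by (simp add: g_def mult.commute)
  qed
  have le: "\<bar>\<mu> * (indicator S e * z)\<bar> \<le> \<bar>\<mu> * z'\<bar>" if "\<bar>z\<bar> \<le> \<bar>z'\<bar>" for S and e :: real and z z'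
    using that \<mu> by (auto simp: abs_mult indicator_def intro!: mult_left_mono)
  have lip: "\<bar>g d w - g d' w\<bar> \<le> \<bar>dot p (\<lambda>j. \<mu> * R * X w j) d - dot p (\<lambda>j. \<mu> * R * X w j) d'\<bar>" for d d' w
  proof -
    have "\<bar>trunc_sq R (dot p (X w) d) - trunc_sq R (dot p (X w) d')\<bar> \<le> \<bar>R * (dot p (X w) d - dot p (X w) d')\<bar>"
      using trunc_sq_lipschitz[of R] R by (simp add: abs_mult)
    from le[OF this, of "{- h/2..h/2}" "err \<beta> w"]
    show ?thesis by (simp add: g_def dot_scale_left right_diff_distrib mult.assoc)
  qed
  have dom: "\<bar>g d w\<bar> \<le> \<bar>dot p (\<lambda>j. \<mu> * R * X w j) d\<bar>" for d w
    using lip[of d w "\<lambda>_. 0"] by (simp add: g_def dot_def)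
  have c: "(\<integral>\<^sup>+w. ennreal (cosh (2 * (L * r) * (\<mu> * R * X w j))) \<partial>D) \<le> ennreal (exp (48 * a\<^sup>2))" if "j < p" for j
  proof -
    have "\<bar>\<rho> / \<sigma>\<bar> * (\<upsilon> * \<sigma>) \<le> a" using \<rho> \<sigma>1 by (simp add: a_def)
    moreover have "2 * (L * r) * (\<mu> * R * x) = \<rho> / \<sigma> * x" for x
      using L r R \<sigma>1 by (simp add: \<mu>_def field_simps)
    ultimately show ?thesis using cosh_moment_X[OF that, of "\<rho> / \<sigma>" a] small by (simp add: a_def)
  qed
  have cont: "continuous_on UNIV (\<lambda>d. g d w)" for w
    unfolding g_def by (intro continuous_on_mult continuous_on_const continuous_on_trunc_sq continuous_on_dot_right)
  have x: "(\<lambda>w. \<mu> * R * X w j) \<in> borel_measurable D" if "j < p" for j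
    using X_measurable[OF that] by measurable
  have T: "(\<Sum>j<p. \<bar>d j\<bar>) \<le> L * r" if "d \<in> T" for d using that by (simp add: T_def)
  obtain A where A: "A \<in> sets ?M" "measure ?M A \<ge> 1 - exp (- t) * (2 * real p * exp (48 * a\<^sup>2) ^ n)"
    "\<And>\<omega> d. \<omega> \<in> A \<Longrightarrow> d \<in> T \<Longrightarrow> n * m - t \<le> (\<Sum>i<n. g d (\<omega> i))"
    using D.uniform_lower_bound[of p T "L * r" "\<lambda>j w. \<mu> * R * X w j" g "exp (48 * a\<^sup>2)" m n t,
        OF p T x gi lip dom c _ cont gE] by auto
  show thesis
  proof
    show "A \<in> sets ?M" by fact
    have "exp (48 * a\<^sup>2) ^ n = exp (48 * \<upsilon>\<^sup>2 * ln p)"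
      unfolding \<rho>2[symmetric] by (simp add: exp_of_nat_mult[symmetric] a_def power_mult_distrib mult_ac)
    moreover have "(48 * \<upsilon>\<^sup>2 + 4) * ln p \<le> t"
    proof -
      \<comment> \<open>The fraction is \<open>3/16 * 5000 / 800\<close>, where
        \<open>800 = 2 * 400\<close> comes from \<open>\<mu>\<close> and \<open>R\<close>. So 5000
        is chosen just to make it exceed 1.\<close>
      have "(48 * \<upsilon>\<^sup>2 + 4) * ln p \<le> 15000/12800 * ((48 * \<upsilon>\<^sup>2 + 4) * ln p)"
        using p2 by simp
      also have "\<dots> = n * (3/16 * r\<^sup>2 * \<mu> * (5000 * L * \<upsilon>\<^sup>2 * (48 * \<upsilon>\<^sup>2 + 4) * \<sigma> * \<rho>))"
        unfolding \<rho>2[symmetric] \<mu>_def R_def using \<sigma>1 L r upsilon_ge_1 by (simp add: field_simps power2_eq_square)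
      also have "\<dots> \<le> n * (3/16 * r\<^sup>2 * \<mu> * (h * f\<^sub>l))"
        using hl \<mu> by (intro mult_left_mono) auto
      also have "\<dots> = t" by (simp add: t_def m_def)
      finally show ?thesis .
    qed
    ultimately show "1 - 1 / (2 * p) \<le> measure ?M A"
      using A(2) failure_prob_le[OF p2, of "48 * \<upsilon>\<^sup>2" t] by simp
    fix \<omega> d assume \<omega>: "\<omega> \<in> A" and d: "q d = r\<^sup>2" "(\<Sum>j<p. \<bar>d j\<bar>) \<le> L * r"
    have "d \<in> T" using d by (simp add: T_def)
    from A(3)[OF \<omega> this] have "n * m / 2 \<le> (\<Sum>i<n. g d (\<omega> i))"
      unfolding t_def by linarith
    also have "\<dots> = \<mu> * (\<Sum>i<n. indicator {- h/2..h/2} (err \<beta> (\<omega> i)) * trunc_sq R (dot p (X (\<omega> i)) d))"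
      unfolding g_def by (simp only: sum_distrib_left)
    also have "n * m / 2 = \<mu> * (n * (3/16 * h * f\<^sub>l * r\<^sup>2))" by (simp add: m_def)
    finally show "n * (3/16 * h * f\<^sub>l * r\<^sup>2) \<le> (\<Sum>i<n. indicator {- h/2..h/2} (err \<beta> (\<omega> i)) * trunc_sq R (dot p (X (\<omega> i)) d))"
      using \<mu> by simp
  qed
qed

end

section \<open>The penalized estimator\<close>

context smoothed_quantile_regression
begin

text \<open>The objective is recentred at \<open>\<beta>\<close>, so that shrinking the error along
  a ray moves towards the truth at 0.\<close>

definition penalized_loss :: "nat \<Rightarrow> real \<Rightarrow> (nat \<Rightarrow> obs) \<Rightarrow> (nat \<Rightarrow> real) \<Rightarrow> real" where
  "penalized_loss n lam \<omega> d =
     (\<Sum>i<n. smoothed_loss \<tau> K h (err \<beta> (\<omega> i) - dot p (X (\<omega> i)) d)) / n + lam * (\<Sum>j<p. \<bar>\<beta> $ j + d j\<bar>)"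

lemma penalized_loss_eq:
  assumes "\<beta>' \<in> carrier_vec p"
  shows "emp_loss \<tau> K h n \<omega> \<beta>' + lam * l1_norm \<beta>' = penalized_loss n lam \<omega> (\<lambda>j. \<beta>' $ j - \<beta> $ j)"
proof -
  have "err \<beta>' w = err \<beta> w - dot p (X w) (\<lambda>j. \<beta>' $ j - \<beta> $ j)" for w
    using assms beta_carrier by (simp add: err_def scalar_prod_eq_dot[where p = p] dot_diff_right)
  then show ?thesis using assms by (simp add: emp_loss_def l1_norm_def penalized_loss_def)
qed

lemma penalized_loss_convex:
  assumes \<eta>: "0 \<le> \<eta>" "\<eta> \<le> 1" and lam: "0 \<le> lam"
  shows "penalized_loss n lam \<omega> (\<lambda>j. \<eta> * d j) \<le> (1 - \<eta>) * penalized_loss n lam \<omega> (\<lambda>_. 0) + \<eta> * penalized_loss n lam \<omega> d"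
proof -
  let ?l = "\<lambda>i d. smoothed_loss \<tau> K h (err \<beta> (\<omega> i) - dot p (X (\<omega> i)) d)"
  have dot0: "dot p u (\<lambda>_. 0) = 0" for u by (simp add: dot_def)
  have "?l i (\<lambda>j. \<eta> * d j) \<le> (1 - \<eta>) * ?l i (\<lambda>_. 0) + \<eta> * ?l i d" for i
    using smoothed_loss_convex[OF \<eta>, of "err \<beta> (\<omega> i)" "err \<beta> (\<omega> i) - dot p (X (\<omega> i)) d"]
    by (simp add: dot_scale_right dot0 algebra_simps)
  then have "(\<Sum>i<n. ?l i (\<lambda>j. \<eta> * d j)) \<le> (\<Sum>i<n. (1 - \<eta>) * ?l i (\<lambda>_. 0) + \<eta> * ?l i d)"
    by (intro sum_mono)
  also have "\<dots> = (1 - \<eta>) * (\<Sum>i<n. ?l i (\<lambda>_. 0)) + \<eta> * (\<Sum>i<n. ?l i d)"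
    by (simp only: sum.distrib sum_distrib_left)
  finally have A: "(\<Sum>i<n. ?l i (\<lambda>j. \<eta> * d j)) / n
      \<le> (1 - \<eta>) * ((\<Sum>i<n. ?l i (\<lambda>_. 0)) / n) + \<eta> * ((\<Sum>i<n. ?l i d) / n)"
    by (simp add: divide_right_mono add_divide_distrib[symmetric])
  have "\<bar>b + \<eta> * x\<bar> \<le> (1 - \<eta>) * \<bar>b\<bar> + \<eta> * \<bar>b + x\<bar>" for b x :: real
  proof -
    have "\<bar>b + \<eta> * x\<bar> = \<bar>(1 - \<eta>) * b + \<eta> * (b + x)\<bar>" by (simp add: algebra_simps)
    also have "\<dots> \<le> \<bar>(1 - \<eta>) * b\<bar> + \<bar>\<eta> * (b + x)\<bar>" by (rule abs_triangle_ineq)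
    finally show ?thesis using \<eta> by (simp add: abs_mult)
  qed
  then have "(\<Sum>j<p. \<bar>\<beta> $ j + \<eta> * d j\<bar>) \<le> (\<Sum>j<p. (1 - \<eta>) * \<bar>\<beta> $ j\<bar> + \<eta> * \<bar>\<beta> $ j + d j\<bar>)"
    by (intro sum_mono)
  also have "\<dots> = (1 - \<eta>) * (\<Sum>j<p. \<bar>\<beta> $ j\<bar>) + \<eta> * (\<Sum>j<p. \<bar>\<beta> $ j + d j\<bar>)"
    by (simp only: sum.distrib sum_distrib_left)
  finally have "lam * (\<Sum>j<p. \<bar>\<beta> $ j + \<eta> * d j\<bar>)
      \<le> lam * ((1 - \<eta>) * (\<Sum>j<p. \<bar>\<beta> $ j\<bar>) + \<eta> * (\<Sum>j<p. \<bar>\<beta> $ j + d j\<bar>))"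
    using lam by (rule mult_left_mono)
  then show ?thesis using A unfolding penalized_loss_def by (simp add: algebra_simps)
qed

abbreviation s :: real where "s \<equiv> real (card (support \<beta>))"

definition bias :: real where "bias = l\<^sub>0 * kernel_moment K 2"

lemma bias_nonneg: "0 \<le> bias"
  using B1 kernel_moment_nonneg by (simp add: bias_def cond_B1_def)

text \<open>The first term is four times the l1 mass on the support, converted to
  \<open>sqrt (q d)\<close>; the second is the contribution of the smoothing bias.\<close>

definition cone_const :: real where "cone_const = 4 / sqrt \<gamma> + 2 * bias"

lemma cone_const_pos: "0 < cone_const"
  using eig(2) bias_nonneg by (simp add: cone_const_def add_pos_nonneg)

section \<open>Deterministic analysis of a sample with bounded centred score\<close>

context
  fixes n :: nat and lam \<kappa>\<^sub>l :: real and \<omega> :: "nat \<Rightarrow> obs"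
  assumes n: "1 \<le> n" and lam: "0 < lam" and \<kappa>\<^sub>l: "0 < \<kappa>\<^sub>l" "\<And>u. \<bar>u\<bar> \<le> 1 \<Longrightarrow> \<kappa>\<^sub>l \<le> K u"
    and h2: "h\<^sup>2 \<le> sqrt (card (support \<beta>)) * lam"
    and score: "\<And>j. j < p \<Longrightarrow>
      \<bar>(\<Sum>i<n. score (err \<beta> (\<omega> i)) * X (\<omega> i) j - (\<integral>w. score (err \<beta> w) * X w j \<partial>D))\<bar> \<le> n * lam / 2"
begin

definition curvature :: "(nat \<Rightarrow> real) \<Rightarrow> real" where
  "curvature d = \<kappa>\<^sub>l / (4 * h) * (\<Sum>i<n. (dot p (X (\<omega> i)) d)\<^sup>2
     * of_bool (\<bar>err \<beta> (\<omega> i)\<bar> \<le> h / 2 \<and> \<bar>dot p (X (\<omega> i)) d\<bar> \<le> h / 2)) / n"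

lemma curvature_nonneg: "0 \<le> curvature d"
  using h \<kappa>\<^sub>l(1) by (auto simp: curvature_def intro!: mult_nonneg_nonneg divide_nonneg_nonneg sum_nonneg)

text \<open>The linear term of \<open>smoothed_loss_ge\<close> splits in two. The centred score is
  paired with \<open>d\<close> by l1 and sup norm duality; its expectation is the smoothing bias,
  where \<open>h2\<close> replaces \<open>h\<^sup>2\<close> by the order of the penalty.\<close>

lemma basic_inequality:
  "curvature d - lam / 2 * (\<Sum>j<p. \<bar>d j\<bar>) - bias * sqrt s * lam * sqrt (q d)
     + lam * (\<Sum>j<p. \<bar>\<beta> $ j + d j\<bar> - \<bar>\<beta> $ j\<bar>)
   \<le> penalized_loss n lam \<omega> d - penalized_loss n lam \<omega> (\<lambda>_. 0)"
proof -
  let ?e = "\<lambda>i. err \<beta> (\<omega> i)" and ?t = "\<lambda>i. dot p (X (\<omega> i)) d"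
  let ?E = "\<lambda>j. \<integral>w. score (err \<beta> w) * X w j \<partial>D"
  let ?G = "\<lambda>j. \<Sum>i<n. score (?e i) * X (\<omega> i) j - ?E j"
  have n0: "0 < real n" using n by simp
  have dot0: "dot p u (\<lambda>_. 0) = 0" for u by (simp add: dot_def)
  have "(\<Sum>i<n. smoothed_loss \<tau> K h (?e i) - ?t i * score (?e i)
        + \<kappa>\<^sub>l / (4 * h) * ((?t i)\<^sup>2 * of_bool (\<bar>?e i\<bar> \<le> h / 2 \<and> \<bar>?t i\<bar> \<le> h / 2)))
      \<le> (\<Sum>i<n. smoothed_loss \<tau> K h (?e i - ?t i))"
    using \<kappa>\<^sub>l by (intro sum_mono smoothed_loss_ge) auto
  then have "((\<Sum>i<n. smoothed_loss \<tau> K h (?e i)) - (\<Sum>i<n. ?t i * score (?e i))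
        + \<kappa>\<^sub>l / (4 * h) * (\<Sum>i<n. (?t i)\<^sup>2 * of_bool (\<bar>?e i\<bar> \<le> h / 2 \<and> \<bar>?t i\<bar> \<le> h / 2))) / n
      \<le> (\<Sum>i<n. smoothed_loss \<tau> K h (?e i - ?t i)) / n"
    by (intro divide_right_mono) (simp_all only: sum.distrib sum_subtractf sum_distrib_left of_nat_0_le_iff)
  then have loss: "curvature d - (\<Sum>i<n. ?t i * score (?e i)) / n
      \<le> (\<Sum>i<n. smoothed_loss \<tau> K h (?e i - ?t i)) / n - (\<Sum>i<n. smoothed_loss \<tau> K h (?e i)) / n"
    unfolding curvature_def add_divide_distrib diff_divide_distrib by linarith
  have "(\<Sum>i<n. ?t i * score (?e i)) = (\<Sum>j<p. d j * (\<Sum>i<n. score (?e i) * X (\<omega> i) j))"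
    unfolding dot_def sum_distrib_left sum_distrib_right
    by (subst sum.swap) (intro sum.cong refl, simp add: mult_ac)
  also have "\<dots> = (\<Sum>j<p. d j * ?G j) + n * (\<Sum>j<p. d j * ?E j)"
    by (simp add: sum_subtractf right_diff_distrib sum_distrib_left mult_ac)
  also have "(\<Sum>j<p. d j * ?E j) = (\<integral>w. score (err \<beta> w) * dot p (X w) d \<partial>D)"
  proof -
    have int: "integrable D (\<lambda>w. score (err \<beta> w) * X w j)" if "j < p" for j
      using score_dot_integrable[of "unit_coord j"] by (simp add: dot_unit_coord[OF that])
    have "(\<integral>w. score (err \<beta> w) * dot p (X w) d \<partial>D) = (\<integral>w. (\<Sum>j<p. d j * (score (err \<beta> w) * X w j)) \<partial>D)"
      by (simp add: dot_def sum_distrib_left mult_ac)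
    also have "\<dots> = (\<Sum>j<p. d j * ?E j)"
      using int by (subst Bochner_Integration.integral_sum) auto
    finally show ?thesis ..
  qed
  also have "(\<Sum>j<p. d j * ?G j) \<le> (\<Sum>j<p. \<bar>d j\<bar> * (n * lam / 2))"
  proof (rule sum_mono)
    fix j assume "j \<in> {..<p}"
    have "d j * ?G j \<le> \<bar>d j\<bar> * \<bar>?G j\<bar>" using abs_ge_self[of "d j * ?G j"] by (simp add: abs_mult)
    also have "\<dots> \<le> \<bar>d j\<bar> * (n * lam / 2)" using score \<open>j \<in> {..<p}\<close> by (intro mult_left_mono) auto
    finally show "d j * ?G j \<le> \<bar>d j\<bar> * (n * lam / 2)" .
  qed
  also have "(\<Sum>j<p. \<bar>d j\<bar> * (n * lam / 2)) = n * (lam / 2 * (\<Sum>j<p. \<bar>d j\<bar>))"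
    by (simp add: sum_distrib_left mult_ac)
  also have "(\<integral>w. score (err \<beta> w) * dot p (X w) d \<partial>D) \<le> bias * sqrt s * lam * sqrt (q d)"
  proof -
    have "(\<integral>w. score (err \<beta> w) * dot p (X w) d \<partial>D) \<le> bias * h\<^sup>2 * sqrt (q d)"
      using score_bias_dot[of d] by (simp add: bias_def mult_ac abs_le_iff)
    also have "\<dots> \<le> bias * (sqrt s * lam) * sqrt (q d)"
      using h2 bias_nonneg q_nonneg by (intro mult_right_mono mult_left_mono) auto
    finally show ?thesis by (simp add: mult.assoc)
  qed
  finally have "(\<Sum>i<n. ?t i * score (?e i)) / n \<le> lam / 2 * (\<Sum>j<p. \<bar>d j\<bar>) + bias * sqrt s * lam * sqrt (q d)"
    using n0 by (simp add: divide_le_eq algebra_simps)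
  then show ?thesis
    using loss unfolding penalized_loss_def by (simp add: dot0 sum_subtractf right_diff_distrib)
qed

text \<open>Without the curvature, the penalty off the support is bounded by three times the mass
  \<open>a\<close> on it plus twice the bias term. The bias does not scale with \<open>a\<close>, so
  the cone is expressed through \<open>sqrt (q d)\<close>, into which Cauchy-Schwarz and
  \<open>q_ge\<close> convert \<open>a\<close> as well.\<close>

lemma cone:
  assumes d: "penalized_loss n lam \<omega> d \<le> penalized_loss n lam \<omega> (\<lambda>_. 0)"
  shows "(\<Sum>j<p. \<bar>d j\<bar>) \<le> sqrt s * cone_const * sqrt (q d)"
proof -
  have supp: "support \<beta> \<subseteq> {..<p}" using beta_carrier by (auto simp: support_def)
  let ?S = "support \<beta>"
  define a where "a = (\<Sum>j\<in>?S. \<bar>d j\<bar>)"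
  define b where "b = (\<Sum>j\<in>{..<p} - ?S. \<bar>d j\<bar>)"
  have ab: "(\<Sum>j<p. \<bar>d j\<bar>) = b + a"
    unfolding a_def b_def using supp by (intro sum.subset_diff) auto
  have "b - a \<le> (\<Sum>j<p. \<bar>\<beta> $ j + d j\<bar> - \<bar>\<beta> $ j\<bar>)"
  proof -
    have "(\<Sum>j<p. \<bar>\<beta> $ j + d j\<bar> - \<bar>\<beta> $ j\<bar>)
      = (\<Sum>j\<in>{..<p} - ?S. \<bar>\<beta> $ j + d j\<bar> - \<bar>\<beta> $ j\<bar>) + (\<Sum>j\<in>?S. \<bar>\<beta> $ j + d j\<bar> - \<bar>\<beta> $ j\<bar>)"
      using supp by (intro sum.subset_diff) auto
    moreover have "(\<Sum>j\<in>{..<p} - ?S. \<bar>\<beta> $ j + d j\<bar> - \<bar>\<beta> $ j\<bar>) = b"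
      unfolding b_def using beta_carrier by (intro sum.cong) (auto simp: support_def)
    moreover have "(\<Sum>j\<in>?S. - \<bar>d j\<bar>) \<le> (\<Sum>j\<in>?S. \<bar>\<beta> $ j + d j\<bar> - \<bar>\<beta> $ j\<bar>)"
      by (intro sum_mono) (auto simp: abs_if)
    ultimately show ?thesis by (simp add: a_def sum_negf)
  qed
  then have pen: "lam * (b - a) \<le> lam * (\<Sum>j<p. \<bar>\<beta> $ j + d j\<bar> - \<bar>\<beta> $ j\<bar>)"
    using lam by simp
  have "lam * (b - a) - lam / 2 * (b + a) - bias * sqrt s * lam * sqrt (q d) \<le> 0"
    using basic_inequality[of d] curvature_nonneg[of d] d pen unfolding ab by linarith
  then have "lam * ((b - a) - 1/2 * (b + a) - bias * sqrt s * sqrt (q d)) \<le> lam * 0"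
    by (simp add: algebra_simps)
  then have "(b - a) - 1/2 * (b + a) - bias * sqrt s * sqrt (q d) \<le> 0"
    using lam by (simp only: mult_le_cancel_left_pos)
  moreover have "b + a \<le> 4 * a + 2 * z" if "(b - a) - 1/2 * (b + a) - z \<le> 0" for z
    using that by (simp add: field_simps)
  ultimately have "b + a \<le> 4 * a + 2 * (bias * sqrt s * sqrt (q d))" by blast
  moreover have "a \<le> sqrt s * (sqrt (q d) / sqrt \<gamma>)"
  proof -
    have "a\<^sup>2 \<le> (\<Sum>j\<in>?S. 1\<^sup>2) * (\<Sum>j\<in>?S. \<bar>d j\<bar>\<^sup>2)"
      unfolding a_def using Cauchy_Schwarz_ineq_sum[of "\<lambda>_. 1" "\<lambda>j. \<bar>d j\<bar>" ?S] by simp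
    also have "\<dots> \<le> s * (\<Sum>j<p. (d j)\<^sup>2)"
      using supp by (auto intro!: mult_left_mono sum_mono2)
    also have "\<dots> \<le> s * (q d / \<gamma>)"
      using q_ge[of d] eig(2) by (intro mult_left_mono) (auto simp: field_simps)
    finally have "a \<le> sqrt (s * (q d / \<gamma>))" by (rule real_le_rsqrt)
    then show ?thesis by (simp add: real_sqrt_mult real_sqrt_divide)
  qed
  ultimately show ?thesis unfolding ab cone_const_def by (simp add: algebra_simps)
qed

text \<open>On the sphere \<open>q d = r\<^sup>2\<close> the excess loss is at least quadratic in
  \<open>r\<close> minus terms linear in \<open>r\<close>, so a large radius is impossible for a
  point no worse than the truth. By convexity a point outside the ball would produce one on the
  sphere.\<close>

lemma localization:
  assumes r: "0 < r" and R: "0 \<le> R" "R \<le> h / 2"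
    and rsc: "\<And>d. q d = r\<^sup>2 \<Longrightarrow> (\<Sum>j<p. \<bar>d j\<bar>) \<le> sqrt s * cone_const * r \<Longrightarrow>
      n * (3/16 * h * f\<^sub>l * r\<^sup>2) \<le> (\<Sum>i<n. indicator {- h/2..h/2} (err \<beta> (\<omega> i)) * trunc_sq R (dot p (X (\<omega> i)) d))"
    and large: "2 * lam * (sqrt s * cone_const) < 3/64 * \<kappa>\<^sub>l * f\<^sub>l * r"
    and d: "penalized_loss n lam \<omega> d \<le> penalized_loss n lam \<omega> (\<lambda>_. 0)"
  shows "q d < r\<^sup>2"
proof (rule ccontr)
  assume "\<not> q d < r\<^sup>2"
  then have qd: "r\<^sup>2 \<le> q d" by simp
  then have sq: "r \<le> sqrt (q d)" "0 < sqrt (q d)" using r real_le_rsqrt order_less_le_trans by (blast, fastforce)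
  define \<eta> where "\<eta> = r / sqrt (q d)"
  have \<eta>: "0 \<le> \<eta>" "\<eta> \<le> 1" using r sq by (auto simp: \<eta>_def)
  let ?d = "\<lambda>j. \<eta> * d j"
  let ?N = "penalized_loss n lam \<omega>"
  have "?N ?d \<le> (1 - \<eta>) * ?N (\<lambda>_. 0) + \<eta> * ?N d"
    using lam by (intro penalized_loss_convex \<eta>) simp
  also have "\<dots> \<le> (1 - \<eta>) * ?N (\<lambda>_. 0) + \<eta> * ?N (\<lambda>_. 0)"
    using d \<eta> by (intro add_left_mono mult_left_mono)
  finally have N: "?N ?d \<le> ?N (\<lambda>_. 0)" by (simp add: algebra_simps)
  have q': "q ?d = r\<^sup>2"
    unfolding q_scale using sq q_nonneg[of d] by (simp add: \<eta>_def power_divide)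
  then have sq': "sqrt (q ?d) = r" using r by simp
  have c: "(\<Sum>j<p. \<bar>?d j\<bar>) \<le> sqrt s * cone_const * r"
    using cone[OF N] unfolding sq' .
  have "3/64 * \<kappa>\<^sub>l * f\<^sub>l * r\<^sup>2 = \<kappa>\<^sub>l / (4 * h) * (n * (3/16 * h * f\<^sub>l * r\<^sup>2)) / n"
    using n h by simp
  also have "\<dots> \<le> curvature ?d"
    unfolding curvature_def
  proof (intro divide_right_mono mult_left_mono)
    have "n * (3/16 * h * f\<^sub>l * r\<^sup>2) \<le> (\<Sum>i<n. indicator {- h/2..h/2} (err \<beta> (\<omega> i)) * trunc_sq R (dot p (X (\<omega> i)) ?d))"
      by (rule rsc[OF q' c])
    \<comment> \<open>Since \<open>R \<le> h / 2\<close>, the truncated square vanishes outside the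
      window in which the smoothed loss is known to curve.\<close>
    also have "\<dots> \<le> (\<Sum>i<n. (dot p (X (\<omega> i)) ?d)\<^sup>2
        * of_bool (\<bar>err \<beta> (\<omega> i)\<bar> \<le> h / 2 \<and> \<bar>dot p (X (\<omega> i)) ?d\<bar> \<le> h / 2))"
    proof (rule sum_mono)
      fix i
      show "indicator {- h/2..h/2} (err \<beta> (\<omega> i)) * trunc_sq R (dot p (X (\<omega> i)) ?d)
        \<le> (dot p (X (\<omega> i)) ?d)\<^sup>2 * of_bool (\<bar>err \<beta> (\<omega> i)\<bar> \<le> h / 2 \<and> \<bar>dot p (X (\<omega> i)) ?d\<bar> \<le> h / 2)"
        using trunc_sq_eq_0[of R "dot p (X (\<omega> i)) ?d"] trunc_sq_le[of R "dot p (X (\<omega> i)) ?d"] R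
        by (cases "\<bar>dot p (X (\<omega> i)) ?d\<bar> \<le> h / 2") (auto simp: indicator_def abs_le_iff)
    qed
    finally show "n * (3/16 * h * f\<^sub>l * r\<^sup>2) \<le> \<dots>" .
  qed (use h \<kappa>\<^sub>l n in auto)
  finally have cur: "3/64 * \<kappa>\<^sub>l * f\<^sub>l * r\<^sup>2 \<le> curvature ?d" .
  have "- (\<Sum>j<p. \<bar>?d j\<bar>) \<le> (\<Sum>j<p. \<bar>\<beta> $ j + ?d j\<bar> - \<bar>\<beta> $ j\<bar>)"
    unfolding sum_negf[symmetric] by (intro sum_mono) (auto simp: abs_if)
  then have "lam * (- (\<Sum>j<p. \<bar>?d j\<bar>)) \<le> lam * (\<Sum>j<p. \<bar>\<beta> $ j + ?d j\<bar> - \<bar>\<beta> $ j\<bar>)"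
    using lam by (intro mult_left_mono) auto
  \<comment> \<open>The 3/2 is 1/2 from the score and 1 from the penalty. The bias is at most half
    of \<open>cone_const\<close>, for a total factor of 2.\<close>
  then have "curvature ?d \<le> 3/2 * (lam * (\<Sum>j<p. \<bar>?d j\<bar>)) + bias * sqrt s * lam * r"
    using basic_inequality[of ?d] N unfolding sq' by (simp add: algebra_simps)
  moreover have "lam * (\<Sum>j<p. \<bar>?d j\<bar>) \<le> lam * (sqrt s * cone_const * r)"
    using c lam by (intro mult_left_mono) auto
  moreover have "bias * sqrt s * lam * r \<le> 1/2 * (lam * (sqrt s * cone_const * r))"
  proof -
    have "bias \<le> 1/2 * cone_const" using eig(2) by (simp add: cone_const_def)
    then have "bias * (sqrt s * lam * r) \<le> 1/2 * cone_const * (sqrt s * lam * r)"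
      using lam r by (intro mult_right_mono) auto
    then show ?thesis by (simp add: mult_ac)
  qed
  ultimately have "3/64 * \<kappa>\<^sub>l * f\<^sub>l * r\<^sup>2 \<le> 2 * lam * (sqrt s * cone_const * r)"
    using cur by linarith
  then have "(3/64 * \<kappa>\<^sub>l * f\<^sub>l * r) * r \<le> (2 * lam * (sqrt s * cone_const)) * r"
    by (simp add: power2_eq_square mult_ac)
  then show False using large r by simp
qed

end

text \<open>On the intersection of the two events the error satisfies
  \<open>q d < r\<^sup>2\<close>. The Euclidean bound divides by the smallest eigenvalue, and the l1
  bound evaluates the cone inequality at this radius.\<close>

lemma oracle_inequality:
  fixes n :: nat and lam \<kappa>\<^sub>l :: real
  defines "\<rho> \<equiv> sqrt (ln p / n)"
  defines "r \<equiv> 64 * cone_const / \<kappa>\<^sub>l * (sqrt s * lam / f\<^sub>l)"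
  assumes p2: "2 \<le> p" and n: "1 \<le> n" and s: "0 < s" and lam0: "0 < lam"
    and \<kappa>\<^sub>l: "0 < \<kappa>\<^sub>l" "\<And>u. \<bar>u\<bar> \<le> 1 \<Longrightarrow> \<kappa>\<^sub>l \<le> K u"
    and h2: "h\<^sup>2 \<le> sqrt s * lam" and hf: "h \<le> f\<^sub>l / (2 * l\<^sub>0)"
    and small: "\<upsilon> * \<rho> \<le> 1/2"
    and lam: "4 * (48 * \<upsilon>\<^sup>2 + 4) * (\<sigma> * \<rho>) \<le> lam"
    and hl: "5000 * (sqrt s * cone_const) * \<upsilon>\<^sup>2 * (48 * \<upsilon>\<^sup>2 + 4) * \<sigma> * \<rho> \<le> h * f\<^sub>l"
    and R: "400 * \<upsilon>\<^sup>2 * r \<le> h / 2"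
  shows "with_prob_at_least (PiM {..<n} (\<lambda>_. D)) (1 - 1 / p)
    (\<lambda>\<omega>. \<forall>\<beta>'. l1_sqr_solution p \<tau> K h lam n \<omega> \<beta>' \<longrightarrow>
      l2_norm (\<beta>' - \<beta>) \<le> r / sqrt \<gamma> \<and> l1_norm (\<beta>' - \<beta>) \<le> sqrt s * cone_const * r)"
proof -
  let ?M = "PiM {..<n} (\<lambda>_. D)"
  interpret P: prob_space ?M by (rule prob_space_PiM) (rule D.prob_space_axioms)
  have fl: "0 < f\<^sub>l" using B1 by (simp add: cond_B1_def)
  have r: "0 < r" using cone_const_pos \<kappa>\<^sub>l(1) s lam0 fl by (simp add: r_def)
  have L: "0 < sqrt s * cone_const" using s cone_const_pos by simp
  obtain A1 where A1: "A1 \<in> sets ?M" "1 - 1 / (2 * p) \<le> measure ?M A1"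
    "\<And>\<omega> j. \<omega> \<in> A1 \<Longrightarrow> j < p \<Longrightarrow>
      \<bar>(\<Sum>i<n. score (err \<beta> (\<omega> i)) * X (\<omega> i) j - (\<integral>w. score (err \<beta> w) * X w j \<partial>D))\<bar> \<le> n * lam / 2"
    using score_deviation[OF p2 n small[unfolded \<rho>_def] lam[unfolded \<rho>_def]] by blast
  obtain A2 where A2: "A2 \<in> sets ?M" "1 - 1 / (2 * p) \<le> measure ?M A2"
    "\<And>\<omega> d. \<omega> \<in> A2 \<Longrightarrow> q d = r\<^sup>2 \<Longrightarrow> (\<Sum>j<p. \<bar>d j\<bar>) \<le> sqrt s * cone_const * r \<Longrightarrow>
      n * (3/16 * h * f\<^sub>l * r\<^sup>2) \<le> (\<Sum>i<n. indicator {- h/2..h/2} (err \<beta> (\<omega> i))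
        * trunc_sq (400 * \<upsilon>\<^sup>2 * r) (dot p (X (\<omega> i)) d))"
    using restricted_curvature[OF p2 n r L small[unfolded \<rho>_def] hf hl[unfolded \<rho>_def]] by blast
  show ?thesis
    unfolding with_prob_at_least_def
  proof (intro bexI[of _ "A1 \<inter> A2"] conjI ballI allI impI)
    show "A1 \<inter> A2 \<in> sets ?M" using A1(1) A2(1) by simp
    have "measure ?M (A1 \<union> A2) = measure ?M A1 + measure ?M A2 - measure ?M (A1 \<inter> A2)"
      using A1(1) A2(1) by (intro measure_Un3) (auto simp: fmeasurable_def P.emeasure_eq_measure)
    moreover have "1 / p = 1 / (2 * p) + 1 / (2 * p)" using p2 by simp
    ultimately show "1 - 1 / p \<le> measure ?M (A1 \<inter> A2)"
      using A1(2) A2(2) P.prob_le_1[of "A1 \<union> A2"] by linarith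
    fix \<omega> \<beta>' assume \<omega>: "\<omega> \<in> A1 \<inter> A2" and sol: "l1_sqr_solution p \<tau> K h lam n \<omega> \<beta>'"
    have \<beta>': "\<beta>' \<in> carrier_vec p"
      and opt: "emp_loss \<tau> K h n \<omega> \<beta>' + lam * l1_norm \<beta>' \<le> emp_loss \<tau> K h n \<omega> \<beta> + lam * l1_norm \<beta>"
      using sol beta_carrier by (auto simp: l1_sqr_solution_def is_arg_min_def not_less)
    let ?d = "\<lambda>j. \<beta>' $ j - \<beta> $ j"
    have N: "penalized_loss n lam \<omega> ?d \<le> penalized_loss n lam \<omega> (\<lambda>_. 0)"
      using opt by (simp add: penalized_loss_eq \<beta>' beta_carrier)
    have sc: "\<bar>(\<Sum>i<n. score (err \<beta> (\<omega> i)) * X (\<omega> i) j - (\<integral>w. score (err \<beta> w) * X w j \<partial>D))\<bar> \<le> n * lam / 2"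
      if "j < p" for j using A1(3) \<omega> that by blast
    have c: "(\<Sum>j<p. \<bar>?d j\<bar>) \<le> sqrt s * cone_const * sqrt (q ?d)"
      by (rule cone[OF n lam0 \<kappa>\<^sub>l h2 sc N])
    have "q ?d < r\<^sup>2"
    proof (rule localization[OF n lam0 \<kappa>\<^sub>l h2 sc r _ R])
      show "0 \<le> 400 * \<upsilon>\<^sup>2 * r" using r by simp
      \<comment> \<open>With the factor 64 in \<open>r\<close>, the right-hand side equals
        \<open>3 * lam * (sqrt s * cone_const)\<close>.\<close>
      show "2 * lam * (sqrt s * cone_const) < 3/64 * \<kappa>\<^sub>l * f\<^sub>l * r"
        using mult_pos_pos[OF lam0 L] \<kappa>\<^sub>l(1) fl by (simp add: r_def mult_ac)
    qed (use A2(3) \<omega> N in blast)+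
    then have sq: "sqrt (q ?d) \<le> r" using r by (intro real_le_lsqrt) (auto simp: q_nonneg)
    have "(\<Sum>j<p. (?d j)\<^sup>2) \<le> q ?d / \<gamma>"
      using q_ge[of ?d] eig(2) by (simp add: field_simps)
    then have "sqrt (\<Sum>j<p. (?d j)\<^sup>2) \<le> sqrt (q ?d) / sqrt \<gamma>"
      unfolding real_sqrt_divide[symmetric] by (rule real_sqrt_le_mono)
    also have "\<dots> \<le> r / sqrt \<gamma>" using sq eig(2) by (intro divide_right_mono) auto
    finally show "l2_norm (\<beta>' - \<beta>) \<le> r / sqrt \<gamma>"
      using \<beta>' beta_carrier by (simp add: l2_norm_def)
    have "sqrt s * cone_const * sqrt (q ?d) \<le> sqrt s * cone_const * r"
      using sq L by (intro mult_left_mono) auto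
    then show "l1_norm (\<beta>' - \<beta>) \<le> sqrt s * cone_const * r"
      using c \<beta>' beta_carrier by (simp add: l1_norm_def)
  qed
qed

end

theorem theorem4p1:
  shows "\<exists>C\<^sub>1 C\<^sub>2 :: real \<Rightarrow> real \<Rightarrow> real \<Rightarrow> real \<Rightarrow> real \<Rightarrow> real.
    (\<forall>a b c d e. 0 < C\<^sub>1 a b c d e \<and> 0 < C\<^sub>2 a b c d e) \<and>
    (\<forall>(\<tau>::real) (K::real \<Rightarrow> real) f\<^sub>l f\<^sub>u l\<^sub>0 \<upsilon>\<^sub>0 \<gamma> \<kappa>\<^sub>l.
      0 < \<tau> \<and> \<tau> < 1 \<and> cond_B2 K \<and> is_kernel_min K \<kappa>\<^sub>l \<and> 0 < \<kappa>\<^sub>l \<longrightarrow>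
      (\<exists>c\<^sub>0>0. \<forall>c\<^sub>1\<ge>c\<^sub>0. \<exists>c\<^sub>h>0.
        \<forall>(p::nat) (n::nat) (s::nat) (D::obs measure) \<beta> (lam::real) (h::real).
          1 \<le> p \<and> 1 \<le> n \<and>
          quantile_model p \<tau> D \<beta> \<and> card (support \<beta>) = s \<and>
          is_smallest_eigenvalue (Sigma_mat p D) \<gamma> \<and> 0 < \<gamma> \<and> \<gamma> \<le> 1 \<and>
          cond_B1 p D \<beta> f\<^sub>l f\<^sub>u l\<^sub>0 \<and> cond_B3 p D \<upsilon>\<^sub>0 \<and>
          c\<^sub>0 * (sigma_x p D * sqrt (\<tau> * (1 - \<tau>) * ln p / n)) \<le> lam \<and>
          lam \<le> c\<^sub>1 * (sigma_x p D * sqrt (\<tau> * (1 - \<tau>) * ln p / n)) \<and>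
          0 < h \<and>
          c\<^sub>h * max (sigma_x p D / f\<^sub>l * sqrt (s * ln p / n))
                  ((sigma_x p D)\<^sup>2 * f\<^sub>u / f\<^sub>l\<^sup>2 * (s * ln p / n)) \<le> h \<and>
          h \<le> min (f\<^sub>l / (2 * l\<^sub>0)) (sqrt (sqrt s * lam)) \<longrightarrow>
          with_prob_at_least (PiM {..<n} (\<lambda>_. D)) (1 - 1 / p)
            (\<lambda>\<omega>. \<forall>\<beta>'. l1_sqr_solution p \<tau> K h lam n \<omega> \<beta>' \<longrightarrow>
               l2_norm (\<beta>' - \<beta>) \<le>
                 C\<^sub>1 l\<^sub>0 \<upsilon>\<^sub>0 \<gamma> \<kappa>\<^sub>l (kernel_moment K 2) / f\<^sub>l * sqrt s * lam \<and>
               l1_norm (\<beta>' - \<beta>) \<le>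
                 C\<^sub>2 l\<^sub>0 \<upsilon>\<^sub>0 \<gamma> \<kappa>\<^sub>l (kernel_moment K 2) / f\<^sub>l * s * lam)))"
proof -
  define L :: "real \<Rightarrow> real \<Rightarrow> real \<Rightarrow> real" where "L = (\<lambda>l g k. 4 / sqrt g + 2 * (l * k))"
  \<comment> \<open>The constants have to be positive at all real arguments, so they default to 1
    where the formula would be meaningless.\<close>
  define valid :: "real \<Rightarrow> real \<Rightarrow> real \<Rightarrow> real \<Rightarrow> bool" where
    "valid = (\<lambda>l g m k. 0 < l \<and> 0 < g \<and> 0 < m \<and> 0 \<le> k)"
  define C1 :: "real \<Rightarrow> real \<Rightarrow> real \<Rightarrow> real \<Rightarrow> real \<Rightarrow> real" where
    "C1 = (\<lambda>l v g m k. if valid l g m k then 64 * L l g k / m / sqrt g else 1)"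
  define C2 :: "real \<Rightarrow> real \<Rightarrow> real \<Rightarrow> real \<Rightarrow> real \<Rightarrow> real" where
    "C2 = (\<lambda>l v g m k. if valid l g m k then L l g k * (64 * L l g k / m) else 1)"
  have Lpos: "0 < L l g k" if "valid l g m k" for l g m k
    using that by (simp add: L_def valid_def add_pos_nonneg)
  have pos: "\<forall>a b c d e. 0 < C1 a b c d e \<and> 0 < C2 a b c d e"
    using Lpos by (auto simp: C1_def C2_def valid_def)
  show ?thesis
  proof (rule exI[of _ C1], rule exI[of _ C2], rule conjI[OF pos], intro allI impI, goal_cases)
    case hyp: (1 \<tau> K f\<^sub>l f\<^sub>u l\<^sub>0 \<upsilon>\<^sub>0 \<gamma> \<kappa>\<^sub>l)
    let ?b = "sqrt (\<tau> * (1 - \<tau>))" and ?A = "48 * \<upsilon>\<^sub>0\<^sup>2 + 4" and ?L = "L l\<^sub>0 \<gamma> (kernel_moment K 2)"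
    have b: "0 < ?b" "?b \<le> 1"
      using hyp by (auto intro!: mult_le_one)
    \<comment> \<open>The division cancels the factor \<open>sqrt (\<tau> * (1 - \<tau>))\<close> of
      the prescribed rate, since the score deviation is of order \<open>\<sigma> * \<rho>\<close>
      without it.\<close>
    define c0 where "c0 = 4 * ?A / ?b"
    have A: "0 < ?A" by (intro add_nonneg_pos) auto
    have c0: "0 < c0" unfolding c0_def using A b by (intro divide_pos_pos mult_pos_pos) auto
    show ?case
    proof (rule exI[of _ c0], rule conjI[OF c0], intro allI impI, goal_cases)
      case (1 c1)
      then have c1: "0 < c1" using c0 by simp
      \<comment> \<open>One summand per demand on the bandwidth:
        \<open>\<upsilon>\<^sub>0 * \<rho> \<le> 1/2\<close>, the deviation in
        \<open>restricted_curvature\<close>, and \<open>R \<le> h / 2\<close>, where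
        \<open>51200 = 2 * 400 * 64\<close> and \<open>c1\<close> bounds \<open>lam\<close> from
        above. The absolute values are there because the signs of the parameters are not yet
        known.\<close>
      define ch where "ch = 1 + \<bar>\<upsilon>\<^sub>0 * f\<^sub>l\<^sup>2 / l\<^sub>0\<bar> + \<bar>5000 * ?L * \<upsilon>\<^sub>0\<^sup>2 * ?A\<bar> + \<bar>51200 * \<upsilon>\<^sub>0\<^sup>2 * ?L * c1 / \<kappa>\<^sub>l\<bar>"
      have ch: "0 < ch" "\<upsilon>\<^sub>0 * f\<^sub>l\<^sup>2 / l\<^sub>0 \<le> ch" "5000 * ?L * \<upsilon>\<^sub>0\<^sup>2 * ?A \<le> ch" "51200 * \<upsilon>\<^sub>0\<^sup>2 * ?L * c1 / \<kappa>\<^sub>l \<le> ch"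
        unfolding ch_def by linarith+
      show ?case
      proof (rule exI[of _ ch], rule conjI[OF ch(1)], intro allI impI, goal_cases)
        case (1 p n s D \<beta> lam h)
        let ?\<sigma> = "sigma_x p D"
        from 1 have p1: "1 \<le> p" and n: "1 \<le> n" and model: "quantile_model p \<tau> D \<beta>"
          and s: "card (support \<beta>) = s"
          and eig: "is_smallest_eigenvalue (Sigma_mat p D) \<gamma>" "0 < \<gamma>"
          and B1: "cond_B1 p D \<beta> f\<^sub>l f\<^sub>u l\<^sub>0" and B3: "cond_B3 p D \<upsilon>\<^sub>0"
          and lam_ge: "c0 * (?\<sigma> * sqrt (\<tau> * (1 - \<tau>) * ln p / n)) \<le> lam"
          and lam_le: "lam \<le> c1 * (?\<sigma> * sqrt (\<tau> * (1 - \<tau>) * ln p / n))"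
          and h0: "0 < h"
          and h_ge: "ch * max (?\<sigma> / f\<^sub>l * sqrt (s * ln p / n)) (?\<sigma>\<^sup>2 * f\<^sub>u / f\<^sub>l\<^sup>2 * (s * ln p / n)) \<le> h"
          and h_le: "h \<le> min (f\<^sub>l / (2 * l\<^sub>0)) (sqrt (sqrt s * lam))"
          by blast+
        interpret smoothed_quantile_regression p \<tau> D \<beta> f\<^sub>l f\<^sub>u l\<^sub>0 \<upsilon>\<^sub>0 \<gamma> K h
          using p1 model B1 B3 eig h0 hyp by unfold_locales auto
        define \<rho> where "\<rho> = sqrt (ln p / n)"
        have \<rho>0: "0 \<le> \<rho>" using p1 by (simp add: \<rho>_def)
        have sq: "sqrt (\<tau> * (1 - \<tau>) * ln p / n) = ?b * \<rho>" "sqrt (s * ln p / n) = sqrt s * \<rho>"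
          unfolding \<rho>_def by (simp_all add: real_sqrt_mult real_sqrt_divide)
        have fl: "0 < f\<^sub>l" and l0: "0 < l\<^sub>0" using B1 by (auto simp: cond_B1_def)
        have \<sigma>1: "1 \<le> ?\<sigma>" by (rule sigma_x_ge_1)
        \<comment> \<open>A positive bandwidth below \<open>sqrt (sqrt s * lam)\<close> excludes an
          empty support and a vanishing penalty. The latter excludes \<open>p = 1\<close>, for which
          \<open>ln p = 0\<close> would force \<open>lam \<le> 0\<close>.\<close>
        have "0 < sqrt s * lam"
          using h0 h_le by (metis min.boundedE not_le order_less_le_trans real_sqrt_gt_0_iff)
        then have s0: "0 < s" and lam0: "0 < lam"
          by (auto simp: zero_less_mult_iff not_less)
        then have s1: "1 \<le> sqrt s" by simp
        have p2: "2 \<le> p"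
        proof (rule ccontr)
          assume "\<not> 2 \<le> p"
          then have "p = 1" using p1 by simp
          then show False using lam_le lam0 by simp
        qed
        have valid: "valid l\<^sub>0 \<gamma> \<kappa>\<^sub>l (kernel_moment K 2)"
          using l0 eig hyp kernel_moment_nonneg by (simp add: valid_def)
        have L: "cone_const = ?L" by (simp add: cone_const_def bias_def L_def)
        have h2: "h\<^sup>2 \<le> sqrt s * lam"
        proof -
          have "h\<^sup>2 \<le> (sqrt (sqrt s * lam))\<^sup>2" using h0 h_le by (intro power_mono) auto
          then show ?thesis using \<open>0 < sqrt s * lam\<close> by simp
        qed
        have h_ge': "ch * (?\<sigma> / f\<^sub>l * (sqrt s * \<rho>)) \<le> h"
          using h_ge ch(1) mult_left_mono[OF max.cobounded1, of ch "?\<sigma> / f\<^sub>l * (sqrt s * \<rho>)" "?\<sigma>\<^sup>2 * f\<^sub>u / f\<^sub>l\<^sup>2 * (s * ln p / n)"]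
          unfolding sq by linarith
        then have hfl: "ch * (?\<sigma> * sqrt s * \<rho>) \<le> h * f\<^sub>l"
          using fl by (simp add: field_simps)
        \<comment> \<open>The lower bound on \<open>h\<close> is played against the upper bound
          \<open>f\<^sub>l / (2 * l\<^sub>0)\<close>, which bounds \<open>\<rho>\<close>
          itself.\<close>
        have small: "\<upsilon>\<^sub>0 * \<rho> \<le> 1/2"
        proof -
          have "1 * 1 \<le> ?\<sigma> * sqrt s" using \<sigma>1 s1 by (intro mult_mono) auto
          then have "ch * (1 * \<rho>) \<le> ch * (?\<sigma> * sqrt s * \<rho>)"
            using ch(1) \<rho>0 by (intro mult_left_mono mult_right_mono) auto
          also have "\<dots> \<le> h * f\<^sub>l" by (rule hfl)
          also have "\<dots> \<le> f\<^sub>l / (2 * l\<^sub>0) * f\<^sub>l" using h_le fl by (intro mult_right_mono) auto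
          finally have "ch * \<rho> \<le> f\<^sub>l\<^sup>2 / (2 * l\<^sub>0)" by (simp add: power2_eq_square)
          moreover have "\<upsilon>\<^sub>0 * f\<^sub>l\<^sup>2 / l\<^sub>0 * \<rho> \<le> ch * \<rho>" using ch(2) \<rho>0 by (rule mult_right_mono)
          ultimately have "\<upsilon>\<^sub>0 * f\<^sub>l\<^sup>2 / l\<^sub>0 * \<rho> \<le> f\<^sub>l\<^sup>2 / (2 * l\<^sub>0)" by simp
          then have "(\<upsilon>\<^sub>0 * \<rho>) * (f\<^sub>l\<^sup>2 / l\<^sub>0) \<le> 1/2 * (f\<^sub>l\<^sup>2 / l\<^sub>0)" by (simp add: mult_ac)
          then show ?thesis using fl l0 by (subst (asm) mult_le_cancel_right_pos) auto
        qed
        have lam: "4 * ?A * (?\<sigma> * \<rho>) \<le> lam"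
        proof -
          have "x / y * y = x" if "0 < y" for x y :: real using that by simp
          from this[OF b(1)] have "4 * ?A * (?\<sigma> * \<rho>) = c0 * ?b * (?\<sigma> * \<rho>)" by (simp only: c0_def)
          also have "\<dots> = c0 * (?\<sigma> * (?b * \<rho>))" by (simp only: mult_ac)
          also have "\<dots> \<le> lam" using lam_ge unfolding sq .
          finally show ?thesis .
        qed
        have lam': "lam \<le> c1 * (?\<sigma> * \<rho>)"
        proof -
          have "c1 * (?\<sigma> * (?b * \<rho>)) \<le> c1 * (?\<sigma> * (1 * \<rho>))"
            using c1 \<sigma>1 b \<rho>0 by (intro mult_left_mono mult_right_mono) auto
          then show ?thesis using lam_le unfolding sq by simp
        qed
        have hl: "5000 * (sqrt s * cone_const) * \<upsilon>\<^sub>0\<^sup>2 * ?A * ?\<sigma> * \<rho> \<le> h * f\<^sub>l"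
        proof -
          have "5000 * ?L * \<upsilon>\<^sub>0\<^sup>2 * ?A * (?\<sigma> * sqrt s * \<rho>) \<le> ch * (?\<sigma> * sqrt s * \<rho>)"
            using ch(3) \<sigma>1 \<rho>0 by (intro mult_right_mono) auto
          also note hfl
          finally show ?thesis unfolding L by (simp add: mult_ac)
        qed
        have R: "400 * \<upsilon>\<^sub>0\<^sup>2 * (64 * cone_const / \<kappa>\<^sub>l * (sqrt s * lam / f\<^sub>l)) \<le> h / 2"
        proof -
          have "51200 * \<upsilon>\<^sub>0\<^sup>2 * ?L / \<kappa>\<^sub>l * (sqrt s / f\<^sub>l) * lam \<le> 51200 * \<upsilon>\<^sub>0\<^sup>2 * ?L / \<kappa>\<^sub>l * (sqrt s / f\<^sub>l) * (c1 * (?\<sigma> * \<rho>))"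
            using lam' Lpos[OF valid] hyp fl by (intro mult_left_mono) auto
          also have "\<dots> = 51200 * \<upsilon>\<^sub>0\<^sup>2 * ?L * c1 / \<kappa>\<^sub>l * (?\<sigma> / f\<^sub>l * (sqrt s * \<rho>))" by simp
          also have "\<dots> \<le> ch * (?\<sigma> / f\<^sub>l * (sqrt s * \<rho>))"
            using ch(4) \<sigma>1 fl \<rho>0 by (intro mult_right_mono) auto
          also note h_ge'
          finally show ?thesis unfolding L by simp
        qed
        have \<kappa>: "\<kappa>\<^sub>l \<le> K u" if "\<bar>u\<bar> \<le> 1" for u
          using hyp that by (auto simp: is_kernel_min_def)
        have "with_prob_at_least (PiM {..<n} (\<lambda>_. D)) (1 - 1 / p)
          (\<lambda>\<omega>. \<forall>\<beta>'. l1_sqr_solution p \<tau> K h lam n \<omega> \<beta>' \<longrightarrow>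
            l2_norm (\<beta>' - \<beta>) \<le> 64 * cone_const / \<kappa>\<^sub>l * (sqrt s * lam / f\<^sub>l) / sqrt \<gamma> \<and>
            l1_norm (\<beta>' - \<beta>) \<le> sqrt s * cone_const * (64 * cone_const / \<kappa>\<^sub>l * (sqrt s * lam / f\<^sub>l)))"
          using oracle_inequality[of n lam \<kappa>\<^sub>l] p2 n s0 lam0 hyp \<kappa> h2 h_le small lam hl R
          unfolding \<rho>_def s by simp
        moreover have "64 * cone_const / \<kappa>\<^sub>l * (sqrt s * lam / f\<^sub>l) / sqrt \<gamma>
            = C1 l\<^sub>0 \<upsilon>\<^sub>0 \<gamma> \<kappa>\<^sub>l (kernel_moment K 2) / f\<^sub>l * sqrt s * lam"
          using valid by (simp add: C1_def L mult_ac)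
        moreover have "sqrt s * cone_const * (64 * cone_const / \<kappa>\<^sub>l * (sqrt s * lam / f\<^sub>l))
            = C2 l\<^sub>0 \<upsilon>\<^sub>0 \<gamma> \<kappa>\<^sub>l (kernel_moment K 2) / f\<^sub>l * s * lam"
        proof -
          have "sqrt s * cone_const * (64 * cone_const / \<kappa>\<^sub>l * (sqrt s * lam / f\<^sub>l))
            = (sqrt s * sqrt s) * (cone_const * (64 * cone_const / \<kappa>\<^sub>l) * lam / f\<^sub>l)"
            by (simp only: times_divide_eq_left times_divide_eq_right divide_divide_eq_left mult_ac)
          also have "sqrt s * sqrt s = s" by simp
          finally show ?thesis using valid by (simp add: C2_def L mult_ac)
        qed
        ultimately show ?case by simp
      qed
    qed
  qed
qed

end
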